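(* Any $o$-minimal structure $R$ admits a natural $b$-minimal expansion, obtained by taking as main sort $R$ with the induced structure, as auxiliary sort the two-point set $\{0,1\}$, and two constant symbols to denote these auxiliary points. A possible interpretation for the ball predicate $B$ is $$B=\{(x,y,m)\in R^2\times R\mid x<m<y\text{ when }x<y,\ \ x<m\text{ when }x=y,\ \text{ and }\ m<y\text{ when }x>y\},$$ so that in the $m$ variable one gets all open intervals as fibers of $B$ above $R^2$. In this case, axiom (b3) of $b$-minimality and preservation of all balls are corollaries of the Monotonicity Theorem for $o$-minimal structures (so the structure is $b$-minimal and preserves all balls).
   Context: **$o$-minimality** is about expansions of a dense linear order $<$ without endpoints. **$b$-minimality.** Structures are many-sorted with a unique main sort, with universe $M$, and auxiliary sorts. The predicate $B$ is a nonempty subset of $A_B\times M$, with $A_B$ a finite product of sorts (here $A_B=R^2$, $M=R$); a ball is a nonempty fiber $B(a)=\{m\in M\mid(a,m)\in B\}$, $a\in A_B$. "Definable" means with parameters from any sorts; "$A$-definable" means with parameters in $A$. A point is a singleton; an auxiliary set is a definable subset of a finite product of auxiliary sorts. A structure is $b$-minimal if for every parameter set $A$ (any sorts), every $A$-definable $X\subset M$ and $A$-definable $F:X\to M$: (b1) there is an $A$-definable $f:X\to S$, $S$ auxiliary, each of whose fibers $f^{-1}(s)$, $s\in f(X)$, is a point or a ball (such $f$ is called a $b$-map on $X$); (b2) no definable function from an auxiliary set to a ball is surjective; (b3) there is an $A$-definable $f:X\to S$, $S$ auxiliary, such that for each $s\in f(X)$, $F_{|f^{-1}(s)}$ is injective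 or constant. **Preservation of all balls.** A refinement of $f:X\to S$ is a definable $f':X\to S'$, $S'$ auxiliary, with $f=g\circ f'$ for some definable $g:f'(X)\to S$. A $b$-minimal structure preserves all balls if for every parameter set $A$ and every $A$-definable $F:X\subset M\to Y\subset M$ there is an $A$-definable $b$-map $f:X\to S$ such that $F(f^{-1}(s))$ is a ball or a point for each $s\in f(X)$, and for every $b$-map $f_1:X\to S_1$ refining $f$ the set $F(f_1^{-1}(s_1))$ is also a ball or a point for each $s_1\in f_1(X)$.
   Formalization: The stated B never has the whole line as a fiber, so (b1) and preservation of all balls fail for (Q,<) with A empty; they are proved for this B exactly when R has a 0-definable point (or over A defining a point), and for every R after adding the whole line as a ball. *)

theory Defs
  imports Main
begin

section \<open>Many-sorted first-order structures and definable sets\<close>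

text \<open>
  The sorts are the elements of the type \<open>'s\<close>, and the elements of all sorts live in one type \<open>'u\<close>.
  The fields \<open>funs\<close> and \<open>rels\<close> pick out the symbols that belong to the language, so that for
  instance a language without function symbols is possible.
\<close>

record ('s, 'f, 'p, 'u) fo_structure =
  univ :: "'s \<Rightarrow> 'u set"
  funs :: "'f set"
  rels :: "'p set"
  fun_arity :: "'f \<Rightarrow> 's list"
  fun_sort :: "'f \<Rightarrow> 's"
  fun_int :: "'f \<Rightarrow> 'u list \<Rightarrow> 'u"
  rel_arity :: "'p \<Rightarrow> 's list"
  rel_int :: "'p \<Rightarrow> 'u list set"

definition tuples :: "('s, 'f, 'p, 'u, 'z) fo_structure_scheme \<Rightarrow> 's list \<Rightarrow> 'u list set" where
  "tuples S ss = {us. list_all2 (\<lambda>u s. u \<in> univ S s) us ss}"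

definition elements :: "('s, 'f, 'p, 'u, 'z) fo_structure_scheme \<Rightarrow> 'u set" where
  "elements S = (\<Union>s. univ S s)"

definition wf_structure :: "('s, 'f, 'p, 'u, 'z) fo_structure_scheme \<Rightarrow> bool" where
  "wf_structure S \<longleftrightarrow>
     (\<forall>s. univ S s \<noteq> {}) \<and>
     (\<forall>s t. s \<noteq> t \<longrightarrow> univ S s \<inter> univ S t = {}) \<and>
     (\<forall>f\<in>funs S. \<forall>us\<in>tuples S (fun_arity S f). fun_int S f us \<in> univ S (fun_sort S f)) \<and>
     (\<forall>p\<in>rels S. rel_int S p \<subseteq> tuples S (rel_arity S p))"

text \<open>
  Formulas use de Bruijn indices: \<open>Var i\<close> is the \<open>i\<close>-th entry of the current list of values, and
  \<open>Ex s\<close> pushes an element of sort \<open>s\<close> on that list. Parameters occur in formulas as \<open>Par a\<close>.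
\<close>

datatype ('f, 'u) trm = Var nat | Par 'u | App 'f "('f, 'u) trm list"

datatype ('s, 'f, 'p, 'u) fm =
    Eq "('f, 'u) trm" "('f, 'u) trm"
  | Rel 'p "('f, 'u) trm list"
  | Neg "('s, 'f, 'p, 'u) fm"
  | Conj "('s, 'f, 'p, 'u) fm" "('s, 'f, 'p, 'u) fm"
  | Ex 's "('s, 'f, 'p, 'u) fm"

text \<open>
  \<open>has_sort S A ss t s\<close>: the term \<open>t\<close>, with parameters in \<open>A\<close> and variables of the sorts \<open>ss\<close>, is
  well-formed and has sort \<open>s\<close>.
\<close>

inductive has_sort ::
  "('s, 'f, 'p, 'u, 'z) fo_structure_scheme \<Rightarrow> 'u set \<Rightarrow> 's list \<Rightarrow> ('f, 'u) trm \<Rightarrow> 's \<Rightarrow> bool"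
  for S A ss where
    has_sort_Var: "i < length ss \<Longrightarrow> has_sort S A ss (Var i) (ss ! i)"
  | has_sort_Par: "a \<in> A \<Longrightarrow> a \<in> univ S s \<Longrightarrow> has_sort S A ss (Par a) s"
  | has_sort_App: "f \<in> funs S \<Longrightarrow> list_all2 (has_sort S A ss) ts (fun_arity S f)
      \<Longrightarrow> has_sort S A ss (App f ts) (fun_sort S f)"

primrec wf_fm ::
  "('s, 'f, 'p, 'u, 'z) fo_structure_scheme \<Rightarrow> 'u set \<Rightarrow> 's list \<Rightarrow> ('s, 'f, 'p, 'u) fm \<Rightarrow> bool"
where
  "wf_fm S A ss (Eq t u) \<longleftrightarrow> (\<exists>s. has_sort S A ss t s \<and> has_sort S A ss u s)"
| "wf_fm S A ss (Rel p ts) \<longleftrightarrow> p \<in> rels S \<and> list_all2 (has_sort S A ss) ts (rel_arity S p)"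
| "wf_fm S A ss (Neg \<phi>) \<longleftrightarrow> wf_fm S A ss \<phi>"
| "wf_fm S A ss (Conj \<phi> \<psi>) \<longleftrightarrow> wf_fm S A ss \<phi> \<and> wf_fm S A ss \<psi>"
| "wf_fm S A ss (Ex s \<phi>) \<longleftrightarrow> wf_fm S A (s # ss) \<phi>"

primrec trm_val ::
  "('s, 'f, 'p, 'u, 'z) fo_structure_scheme \<Rightarrow> 'u list \<Rightarrow> ('f, 'u) trm \<Rightarrow> 'u"
where
  "trm_val S us (Var i) = us ! i"
| "trm_val S us (Par a) = a"
| "trm_val S us (App f ts) = fun_int S f (map (trm_val S us) ts)"

primrec sat ::
  "('s, 'f, 'p, 'u, 'z) fo_structure_scheme \<Rightarrow> 'u list \<Rightarrow> ('s, 'f, 'p, 'u) fm \<Rightarrow> bool"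
where
  "sat S us (Eq t u) \<longleftrightarrow> trm_val S us t = trm_val S us u"
| "sat S us (Rel p ts) \<longleftrightarrow> map (trm_val S us) ts \<in> rel_int S p"
| "sat S us (Neg \<phi>) \<longleftrightarrow> \<not> sat S us \<phi>"
| "sat S us (Conj \<phi> \<psi>) \<longleftrightarrow> sat S us \<phi> \<and> sat S us \<psi>"
| "sat S us (Ex s \<phi>) \<longleftrightarrow> (\<exists>u\<in>univ S s. sat S (u # us) \<phi>)"

text \<open>
  \<open>definable S A ss X\<close>: \<open>X\<close> is an \<open>A\<close>-definable subset of the product of the sorts \<open>ss\<close>.
  Definable without reference to \<open>A\<close> means \<open>elements S\<close>-definable.
\<close>

definition definable ::
  "('s, 'f, 'p, 'u, 'z) fo_structure_scheme \<Rightarrow> 'u set \<Rightarrow> 's list \<Rightarrow> 'u list set \<Rightarrow> bool" where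
  "definable S A ss X \<longleftrightarrow> (\<exists>\<phi>. wf_fm S A ss \<phi> \<and> X = {us \<in> tuples S ss. sat S us \<phi>})"

definition definable_map ::
  "('s, 'f, 'p, 'u, 'z) fo_structure_scheme \<Rightarrow> 'u set \<Rightarrow> 's list \<Rightarrow> 'u list set
     \<Rightarrow> 's list \<Rightarrow> 'u list set \<Rightarrow> ('u list \<Rightarrow> 'u list) \<Rightarrow> bool" where
  "definable_map S A ss X ts Y f \<longleftrightarrow>
     definable S A ss X \<and> definable S A ts Y \<and> f ` X \<subseteq> Y \<and>
     definable S A (ss @ ts) ((\<lambda>x. x @ f x) ` X)"


section \<open>b-minimality\<close>

text \<open>
  A subset of the main sort is treated as a set of lists of length one. All sorts other than
  \<open>main\<close> are auxiliary. The predicate \<open>B\<close> is the relation symbol \<open>ball\<close>.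
\<close>

record ('s, 'f, 'p, 'u) ball_structure = "('s, 'f, 'p, 'u) fo_structure" +
  main :: 's
  ball :: 'p

definition wf_ball_structure :: "('s, 'f, 'p, 'u, 'z) ball_structure_scheme \<Rightarrow> bool" where
  "wf_ball_structure S \<longleftrightarrow>
     wf_structure S \<and> ball S \<in> rels S \<and> (\<exists>ab. rel_arity S (ball S) = ab @ [main S]) \<and>
     rel_int S (ball S) \<noteq> {}"

definition is_ball :: "('s, 'f, 'p, 'u, 'z) ball_structure_scheme \<Rightarrow> 'u list set \<Rightarrow> bool" where
  "is_ball S b \<longleftrightarrow> b \<noteq> {} \<and>
     (\<exists>a\<in>tuples S (butlast (rel_arity S (ball S))).
        b = {m \<in> tuples S [main S]. a @ m \<in> rel_int S (ball S)})"

definition is_point :: "('s, 'f, 'p, 'u, 'z) ball_structure_scheme \<Rightarrow> 'u list set \<Rightarrow> bool" where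
  "is_point S b \<longleftrightarrow> (\<exists>m\<in>tuples S [main S]. b = {m})"

definition auxiliary_set ::
  "('s, 'f, 'p, 'u, 'z) ball_structure_scheme \<Rightarrow> 's list \<Rightarrow> 'u list set \<Rightarrow> bool" where
  "auxiliary_set S ts T \<longleftrightarrow> main S \<notin> set ts \<and> definable S (elements S) ts T"

definition fiber :: "('a \<Rightarrow> 'b) \<Rightarrow> 'a set \<Rightarrow> 'b \<Rightarrow> 'a set" where
  "fiber f X s = {x \<in> X. f x = s}"

definition b_map ::
  "('s, 'f, 'p, 'u, 'z) ball_structure_scheme \<Rightarrow> 'u set \<Rightarrow> 'u list set
     \<Rightarrow> 's list \<Rightarrow> 'u list set \<Rightarrow> ('u list \<Rightarrow> 'u list) \<Rightarrow> bool" where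
  "b_map S A X ts T f \<longleftrightarrow>
     auxiliary_set S ts T \<and> definable_map S A [main S] X ts T f \<and>
     (\<forall>s\<in>f ` X. is_point S (fiber f X s) \<or> is_ball S (fiber f X s))"

definition axiom_b1 :: "('s, 'f, 'p, 'u, 'z) ball_structure_scheme \<Rightarrow> 'u set \<Rightarrow> bool" where
  "axiom_b1 S A \<longleftrightarrow> (\<forall>X. definable S A [main S] X \<longrightarrow> (\<exists>ts T f. b_map S A X ts T f))"

definition axiom_b2 :: "('s, 'f, 'p, 'u, 'z) ball_structure_scheme \<Rightarrow> bool" where
  "axiom_b2 S \<longleftrightarrow>
     \<not> (\<exists>ts T b f. auxiliary_set S ts T \<and> is_ball S b \<and>
           definable_map S (elements S) ts T [main S] b f \<and> f ` T = b)"

definition axiom_b3 :: "('s, 'f, 'p, 'u, 'z) ball_structure_scheme \<Rightarrow> 'u set \<Rightarrow> bool" where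
  "axiom_b3 S A \<longleftrightarrow>
     (\<forall>X F. definable_map S A [main S] X [main S] (tuples S [main S]) F \<longrightarrow>
        (\<exists>ts T f. auxiliary_set S ts T \<and> definable_map S A [main S] X ts T f \<and>
           (\<forall>s\<in>f ` X. inj_on F (fiber f X s) \<or> (\<exists>c. \<forall>x\<in>fiber f X s. F x = c))))"

definition b_minimal :: "('s, 'f, 'p, 'u, 'z) ball_structure_scheme \<Rightarrow> bool" where
  "b_minimal S \<longleftrightarrow>
     wf_ball_structure S \<and> (\<forall>A\<subseteq>elements S. axiom_b1 S A \<and> axiom_b2 S \<and> axiom_b3 S A)"

definition refinement ::
  "('s, 'f, 'p, 'u, 'z) ball_structure_scheme \<Rightarrow> 'u list set
     \<Rightarrow> 's list \<Rightarrow> 'u list set \<Rightarrow> ('u list \<Rightarrow> 'u list)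
     \<Rightarrow> 's list \<Rightarrow> 'u list set \<Rightarrow> ('u list \<Rightarrow> 'u list) \<Rightarrow> bool" where
  "refinement S X ts T f ts' T' f' \<longleftrightarrow>
     auxiliary_set S ts' T' \<and> definable_map S (elements S) [main S] X ts' T' f' \<and>
     (\<exists>g. definable_map S (elements S) ts' (f' ` X) ts T g \<and> (\<forall>x\<in>X. f x = g (f' x)))"

definition preserves_balls_over ::
  "('s, 'f, 'p, 'u, 'z) ball_structure_scheme \<Rightarrow> 'u set \<Rightarrow> bool" where
  "preserves_balls_over S A \<longleftrightarrow>
     (\<forall>X Y F. definable_map S A [main S] X [main S] Y F \<longrightarrow>
        (\<exists>ts T f. b_map S A X ts T f \<and>
           (\<forall>s\<in>f ` X. is_ball S (F ` fiber f X s) \<or> is_point S (F ` fiber f X s)) \<and>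
           (\<forall>ts1 T1 f1. b_map S (elements S) X ts1 T1 f1 \<and> refinement S X ts T f ts1 T1 f1 \<longrightarrow>
              (\<forall>s\<in>f1 ` X. is_ball S (F ` fiber f1 X s) \<or> is_point S (F ` fiber f1 X s)))))"

definition preserves_all_balls :: "('s, 'f, 'p, 'u, 'z) ball_structure_scheme \<Rightarrow> bool" where
  "preserves_all_balls S \<longleftrightarrow> (\<forall>A\<subseteq>elements S. preserves_balls_over S A)"


section \<open>o-minimal structures and their two-sorted expansion\<close>

definition open_interval :: "'r::linorder set \<Rightarrow> bool" where
  "open_interval I \<longleftrightarrow>
     (\<exists>a b. I = {a<..<b}) \<or> (\<exists>a. I = {a<..}) \<or> (\<exists>b. I = {..<b}) \<or> I = UNIV"

definition o_minimal ::
  "(unit, 'f, 'p, 'r::unbounded_dense_linorder, 'z) fo_structure_scheme \<Rightarrow> bool" where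
  "o_minimal R \<longleftrightarrow>
     wf_structure R \<and> univ R () = UNIV \<and>
     (\<exists>p\<in>rels R. rel_arity R p = [(), ()] \<and> (\<forall>x y. [x, y] \<in> rel_int R p \<longleftrightarrow> x < y)) \<and>
     (\<forall>X. definable R UNIV [()] X \<longrightarrow>
        (\<exists>C. finite C \<and> (\<forall>I\<in>C. (\<exists>a. I = {a}) \<or> open_interval I) \<and> X = (\<lambda>x. [x]) ` \<Union>C))"

datatype o_sort = MainSort | AuxSort

text \<open>
  The two-sorted expansion of \<open>R\<close> by the auxiliary sort \<open>{0,1}\<close>, rendered as \<open>bool\<close>, with the two
  constants \<open>Inr False\<close>, \<open>Inr True\<close>, and by a predicate \<open>B\<close> (the symbol \<open>None\<close>) between the
  product of the sorts \<open>ab\<close> and the main sort.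
\<close>

definition expansion ::
  "(unit, 'f, 'p, 'r) fo_structure \<Rightarrow> o_sort list \<Rightarrow> ('r + bool) list set
     \<Rightarrow> (o_sort, 'f + bool, 'p option, 'r + bool) ball_structure" where
  "expansion R ab B =
     \<lparr> univ = (\<lambda>s. case s of MainSort \<Rightarrow> Inl ` univ R () | AuxSort \<Rightarrow> range Inr),
       funs = funs R <+> UNIV,
       rels = insert None (Some ` rels R),
       fun_arity = (\<lambda>f. case f of Inl g \<Rightarrow> map (\<lambda>_. MainSort) (fun_arity R g) | Inr e \<Rightarrow> []),
       fun_sort = (\<lambda>f. case f of Inl g \<Rightarrow> MainSort | Inr e \<Rightarrow> AuxSort),
       fun_int = (\<lambda>f us. case f of Inl g \<Rightarrow> Inl (fun_int R g (map projl us)) | Inr e \<Rightarrow> Inr e),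
       rel_arity = (\<lambda>p. case p of Some q \<Rightarrow> map (\<lambda>_. MainSort) (rel_arity R q)
                               | None \<Rightarrow> ab @ [MainSort]),
       rel_int = (\<lambda>p. case p of Some q \<Rightarrow> map Inl ` rel_int R q | None \<Rightarrow> B),
       main = MainSort,
       ball = None \<rparr>"

definition between :: "'r::linorder \<Rightarrow> 'r \<Rightarrow> 'r \<Rightarrow> bool" where
  "between x y m \<longleftrightarrow>
     (if x < y then x < m \<and> m < y else if x = y then x < m else m < y)"

definition o_expansion ::
  "(unit, 'f, 'p, 'r::unbounded_dense_linorder) fo_structure
     \<Rightarrow> (o_sort, 'f + bool, 'p option, 'r + bool) ball_structure" where
  "o_expansion R =
     expansion R [MainSort, MainSort] {[Inl x, Inl y, Inl m] | x y m. between x y m}"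

text \<open>
  The fibers of the ball predicate of \<open>o_expansion\<close> are the bounded open intervals and the open
  half-lines, but not the whole line. If \<open>R\<close> has no point definable over \<open>A\<close>, for example in the
  pure order of the rationals with \<open>A\<close> empty, then the whole line can not be cut into pieces over
  \<open>A\<close>, and (b1) fails for it. The following variant has one more index coordinate, of auxiliary
  sort, whose value 1 gives the whole line; so its balls are all the nonempty open intervals.
\<close>

definition o_expansion_line ::
  "(unit, 'f, 'p, 'r::unbounded_dense_linorder) fo_structure
     \<Rightarrow> (o_sort, 'f + bool, 'p option, 'r + bool) ball_structure" where
  "o_expansion_line R =
     expansion R [MainSort, MainSort, AuxSort]
       {[Inl x, Inl y, Inr e, Inl m] | x y e m. e \<or> between x y m}"

definition has_definable_point :: "('s, 'f, 'p, 'u, 'z) ball_structure_scheme \<Rightarrow> 'u set \<Rightarrow> bool" where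
  "has_definable_point S A \<longleftrightarrow> (\<exists>c\<in>univ S (main S). definable S A [main S] {[c]})"

end

theory Submission
  imports Defs
begin

text \<open>
  By the Monotonicity Theorem the domain of a definable unary function splits at finitely many
  points into open intervals on which the function is constant, or strictly monotone with an
  open interval as image. The exceptional points form a finite set definable over the given
  parameters, so the order makes each of them definable, and the finite auxiliary sort can record
  the position of \<open>x\<close> relative to them. This gives b-maps over the given parameters. A definable
  point is needed exactly when the whole line is not a ball: it cuts both the domain and the range.

  The Monotonicity Theorem reduces to the fact that a definable linear order \<open>r\<close> on an interval
  agrees with the order of the line or with its converse on a subinterval. The critical case is that
  every point is a strict local \<open>r\<close>-minimum. Then an interval of points admits a downward jump (some \<open>r\<close>-level lies below
  the points just to the left and above those just to the right). Reversing the direction of the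
  line gives points that also admit an upward jump, which is impossible.
\<close>

section \<open>One-variable consequences of o-minimality\<close>

text \<open>Two notions of definability run in parallel. Tameness is about arbitrary parameters,
  while cuts and b-maps must be definable over the given \<open>A\<close>; the two meet where a
  finite set that exists by tameness is seen to be definable over \<open>A\<close>. Definability is
  handled through predicates closed under the logical operations, so that most of the argument does
  not mention formulas. The o-minimality of \<open>R\<close> is available in the expansion because
  auxiliary variables range over two named values and no function symbol leads from the main sort to
  the auxiliary sort. Refinements are b-maps with possibly further parameters, so good behaviour
  must be established on all open subintervals of a piece, not on the piece alone. The necessity of
  a definable point comes from (b1) for the whole line: a fiber of a b-map is then a nonempty proper
  subset, definable over \<open>A\<close> since the auxiliary values have names, and its finite
  nonempty boundary consists of definable points.\<close>

definition tame :: "'r::linorder set \<Rightarrow> bool" where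
  "tame X \<longleftrightarrow> (\<exists>C. finite C \<and> (\<forall>I\<in>C. (\<exists>a. I = {a}) \<or> open_interval I) \<and> X = \<Union>C)"

lemma tame_induct [consumes 1, case_names empty point interval]:
  assumes "tame X"
    and "P {}"
    and "\<And>a Y. P Y \<Longrightarrow> P ({a} \<union> Y)"
    and "\<And>I Y. open_interval I \<Longrightarrow> P Y \<Longrightarrow> P (I \<union> Y)"
  shows "P X"
proof -
  obtain C where C: "finite C" "\<forall>I\<in>C. (\<exists>a. I = {a}) \<or> open_interval I" and X: "X = \<Union>C"
    using assms(1) unfolding tame_def by auto
  from C have "P (\<Union>C)"
  proof (induction C rule: finite_induct)
    case empty
    then show ?case using assms(2) by simp
  next
    case (insert I C)
    then have "P (\<Union>C)" "(\<exists>a. I = {a}) \<or> open_interval I" by auto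
    then show ?case using assms(3,4) by auto
  qed
  then show ?thesis using X by simp
qed

definition orientation :: "('r::linorder \<Rightarrow> 'r \<Rightarrow> bool) \<Rightarrow> bool" where
  "orientation lt \<longleftrightarrow> lt = (<) \<or> lt = (>)"

section \<open>One-sided behaviour of tame sets near a point\<close>

lemma orientation_less [simp]: "orientation (<)" and orientation_greater [simp]: "orientation (>)"
  by (auto simp: orientation_def)

text \<open>Truth on a one-sided germ: with \<open>lt = (<)\<close> on the left of \<open>d\<close>,
  with \<open>lt = (>)\<close> on the right. Quantifying over \<open>orientation\<close> makes one
  proof serve both sides, and later both increasing and decreasing functions.\<close>

definition all_before :: "('r \<Rightarrow> 'r \<Rightarrow> bool) \<Rightarrow> ('r \<Rightarrow> bool) \<Rightarrow> 'r \<Rightarrow> bool" where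
  "all_before lt P d \<longleftrightarrow> (\<exists>c. lt c d \<and> (\<forall>y. lt c y \<and> lt y d \<longrightarrow> P y))"

lemma all_before_mono:
  "all_before lt P d \<Longrightarrow> (\<And>y. P y \<Longrightarrow> Q y) \<Longrightarrow> all_before lt Q d"
  by (auto simp: all_before_def)

context
  fixes lt :: "'r::unbounded_dense_linorder \<Rightarrow> 'r \<Rightarrow> bool"
  assumes lt: "orientation lt"
begin

lemma lt_irrefl: "\<not> lt x x"
  and lt_trans: "lt x y \<Longrightarrow> lt y z \<Longrightarrow> lt x z"
  and lt_total: "x \<noteq> y \<Longrightarrow> lt x y \<or> lt y x"
  and lt_dense: "lt x y \<Longrightarrow> \<exists>z. lt x z \<and> lt z y"
  and lt_below: "\<exists>y. lt y x"
  using lt dense[of x y] dense[of y x] by (auto simp: orientation_def gt_ex lt_ex)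

lemma all_before_conj:
  assumes "all_before lt P d" "all_before lt Q d"
  shows "all_before lt (\<lambda>y. P y \<and> Q y) d"
proof -
  obtain c c' where c: "lt c d" "\<And>y. lt c y \<Longrightarrow> lt y d \<Longrightarrow> P y"
    and c': "lt c' d" "\<And>y. lt c' y \<Longrightarrow> lt y d \<Longrightarrow> Q y"
    using assms unfolding all_before_def by blast
  consider "lt c c'" | "lt c' c" | "c = c'" using lt_total by blast
  then show ?thesis
    unfolding all_before_def using c c' lt_trans by cases blast+
qed

lemma all_before_gt: "lt c d \<Longrightarrow> all_before lt (\<lambda>y. lt c y \<and> lt y d) d"
  by (auto simp: all_before_def)

lemma all_before_ex: "all_before lt P d \<Longrightarrow> \<exists>y. lt y d \<and> P y"
  unfolding all_before_def using lt_dense by blast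

lemma all_before_const: "all_before lt (\<lambda>y. b) d \<longleftrightarrow> b"
  using all_before_ex[of "\<lambda>_. b"] lt_below by (auto simp: all_before_def)

text \<open>O-minimality in germ form. Each generating set is described by comparisons with fixed
  points, every such comparison is constant close to \<open>d\<close> on one side, and the
  alternative passes to unions.\<close>

lemma tame_all_before:
  assumes "tame X"
  shows "all_before lt (\<lambda>y. y \<in> X) d \<or> all_before lt (\<lambda>y. y \<notin> X) d"
  using assms
proof (induction rule: tame_induct)
  case empty
  then show ?case by (simp add: all_before_const)
next
  case (point a Y)
  have "all_before lt (\<lambda>y. y \<noteq> a) d"
    unfolding all_before_def using lt_below lt_irrefl lt_total lt_trans by metis
  with point show ?case
    using all_before_conj[of "\<lambda>y. y \<noteq> a" d "\<lambda>y. y \<notin> Y"]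
    by (auto elim: all_before_mono)
next
  case (interval I Y)
  \<comment> \<open>If \<open>a\<close> comes before \<open>d\<close>, then \<open>y\<close>
    eventually lies beyond \<open>a\<close>; otherwise every \<open>y\<close> before
    \<open>d\<close> also comes before \<open>a\<close>. Which of \<open><\<close> and
    \<open>>\<close> this means depends on \<open>lt\<close>.\<close>
  have less: "all_before lt (\<lambda>y. y < a) d \<or> all_before lt (\<lambda>y. a < y) d" for a
  proof -
    consider "lt a d" | "\<not> lt a d" by blast
    then show ?thesis
    proof cases
      case 1
      then have "all_before lt (lt a) d"
        using all_before_gt[OF 1] by (auto elim: all_before_mono)
      then show ?thesis using lt unfolding orientation_def by auto
    next
      case 2
      obtain c where c: "lt c d" using lt_below by blast
      have "lt y a" if "lt y d" for y using 2 that lt_total lt_trans by metis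
      then have "all_before lt (\<lambda>y. lt y a) d"
        using all_before_gt[OF c] by (auto elim: all_before_mono)
      then show ?thesis using lt unfolding orientation_def by auto
    qed
  qed
  have "all_before lt (\<lambda>y. y \<in> I) d \<or> all_before lt (\<lambda>y. y \<notin> I) d"
  proof -
    from interval(1) consider (both) a b where "I = {a<..<b}" | (above) a where "I = {a<..}"
      | (below) b where "I = {..<b}" | (UNIV) "I = UNIV"
      unfolding open_interval_def by auto
    then show ?thesis
    proof cases
      case both
      have "all_before lt (\<lambda>y. y \<notin> I) d"
        if "all_before lt (\<lambda>y. y < a) d \<or> all_before lt (\<lambda>y. b < y) d"
        using that unfolding both by (auto elim: all_before_mono)
      then show ?thesis
        using less[of a] less[of b] all_before_conj[of "\<lambda>y. a < y" d "\<lambda>y. y < b"]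
        unfolding both by auto
    next
      case above
      then show ?thesis
        using less[of a] all_before_mono[of lt "\<lambda>y. y < a" d "\<lambda>y. \<not> a < y", OF _ less_not_sym] by auto
    next
      case below
      then show ?thesis
        using less[of b] all_before_mono[of lt "\<lambda>y. b < y" d "\<lambda>y. \<not> y < b", OF _ less_not_sym] by auto
    next
      case UNIV
      then show ?thesis by (simp add: all_before_const)
    qed
  qed
  with interval(2) show ?case
    using all_before_conj[of "\<lambda>y. y \<notin> I" d "\<lambda>y. y \<notin> Y"]
    by (auto elim: all_before_mono)
qed

section \<open>Definable completeness: suprema of tame sets\<close>

definition is_sup :: "'r set \<Rightarrow> 'r \<Rightarrow> bool" where
  "is_sup X s \<longleftrightarrow> (\<forall>x\<in>X. \<not> lt s x) \<and> (\<forall>t. lt t s \<longrightarrow> (\<exists>x\<in>X. lt t x))"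

definition sup_or_unbounded :: "'r set \<Rightarrow> bool" where
  "sup_or_unbounded X \<longleftrightarrow> X = {} \<or> (\<forall>b. \<exists>x\<in>X. lt b x) \<or> (\<exists>s. is_sup X s)"

lemma sup_or_unbounded_Un:
  assumes "sup_or_unbounded X" "sup_or_unbounded Y"
  shows "sup_or_unbounded (X \<union> Y)"
proof -
  have *: "is_sup (X \<union> Y) t" if s: "is_sup X s" and t: "is_sup Y t" and st: "\<not> lt t s" for s t X Y
  proof -
    have "\<not> lt t x" if "x \<in> X" for x
    proof (cases "s = t")
      case False
      then have "lt s t" using st lt_total by blast
      then show ?thesis using s that lt_trans unfolding is_sup_def by blast
    qed (use s that in \<open>simp add: is_sup_def\<close>)
    then show ?thesis using t unfolding is_sup_def by blast
  qed
  have "is_sup (X \<union> Y) t \<or> is_sup (X \<union> Y) s" if "is_sup X s" "is_sup Y t" for s t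
  proof (cases "lt t s")
    case True
    then have "\<not> lt s t" using lt_trans lt_irrefl by blast
    then show ?thesis using *[OF that(2,1)] by (simp add: Un_commute)
  qed (use *[OF that] in simp)
  then have sups: "\<exists>u. is_sup (X \<union> Y) u" if "\<exists>s. is_sup X s" "\<exists>t. is_sup Y t"
    using that by blast
  have "(X = {} \<or> Y = {} \<or> (\<forall>b. \<exists>x\<in>X. lt b x)) \<or> (\<forall>b. \<exists>x\<in>Y. lt b x)
    \<or> (\<exists>s. is_sup X s) \<and> (\<exists>t. is_sup Y t)"
    using assms unfolding sup_or_unbounded_def by argo
  then consider "X = {}" | "Y = {}" | "\<forall>b. \<exists>x\<in>X. lt b x" | "\<forall>b. \<exists>x\<in>Y. lt b x"
    | "\<exists>s. is_sup X s" "\<exists>t. is_sup Y t"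
    by blast
  then show ?thesis
  proof cases
    case 5
    then show ?thesis using sups unfolding sup_or_unbounded_def by blast
  qed (use assms in \<open>auto simp: sup_or_unbounded_def\<close>)
qed

lemma tame_sup_or_unbounded: "tame X \<Longrightarrow> sup_or_unbounded X"
proof (induction rule: tame_induct)
  case empty
  then show ?case by (simp add: sup_or_unbounded_def)
next
  case (point a Y)
  have "is_sup {a} a" by (simp add: is_sup_def lt_irrefl)
  then show ?case using point sup_or_unbounded_Un unfolding sup_or_unbounded_def by blast
next
  case (interval I Y)
  from interval(1) consider (both) a b where "I = {a<..<b}" "a < b" | "I = {}"
    | (above) a where "I = {a<..}" | (below) b where "I = {..<b}" | (UNIV) "I = UNIV"
    unfolding open_interval_def
    by (metis greaterThanLessThan_empty leI)
  then have "sup_or_unbounded I"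
  proof cases
    case both
    have "\<exists>x\<in>I. t < x" if "t < b" for t
      using both dense[of "max a t" b] that by auto
    moreover have "\<exists>x\<in>I. x < t" if "a < t" for t
      using both dense[of a "min t b"] that by auto
    ultimately have "is_sup I (if lt = (<) then b else a)"
      using lt both unfolding orientation_def is_sup_def by auto
    then show ?thesis unfolding sup_or_unbounded_def by blast
  next
    case above
    have *: "\<exists>x\<in>I. t < x" for t
      using above gt_ex[of "max a t"] by auto
    have "\<exists>x\<in>I. x < t" if "a < t" for t
      using above dense[OF that] by auto
    then have "lt = (>) \<Longrightarrow> is_sup I a"
      using above unfolding is_sup_def by auto
    then show ?thesis using * lt unfolding orientation_def sup_or_unbounded_def by blast
  next
    case below
    have *: "\<exists>x\<in>I. x < t" for t
      using below lt_ex[of "min b t"] by auto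
    have "\<exists>x\<in>I. t < x" if "t < b" for t
      using below dense[OF that] by auto
    then have "lt = (<) \<Longrightarrow> is_sup I b"
      using below unfolding is_sup_def by auto
    then show ?thesis using * lt unfolding orientation_def sup_or_unbounded_def by blast
  next
    case UNIV
    then show ?thesis using lt gt_ex lt_ex unfolding orientation_def sup_or_unbounded_def by blast
  qed (simp add: sup_or_unbounded_def)
  then show ?case using interval(2) sup_or_unbounded_Un by blast
qed

text \<open>For \<open>lt = (>)\<close> this produces an infimum. The bound is stated with a
  negation because \<open>s\<close> may or may not belong to \<open>X\<close>; the later arguments
  decide this case by case.\<close>

lemma tame_sup:
  assumes "tame X" "x0 \<in> X" "\<And>x. x \<in> X \<Longrightarrow> \<not> lt b x"
  obtains s where "\<And>x. x \<in> X \<Longrightarrow> \<not> lt s x" "\<And>t. lt t s \<Longrightarrow> \<exists>x\<in>X. lt t x"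
  using tame_sup_or_unbounded[OF assms(1)] assms(2,3)
  unfolding sup_or_unbounded_def is_sup_def by blast

end

text \<open>Finitely many points form a finite set, so a nonempty interval occurs among the pieces.
  Applied to a definable set of exceptional points, this turns failure at infinitely many points
  into failure throughout an interval.\<close>

lemma tame_infinite_interval:
  fixes X :: "'r::unbounded_dense_linorder set"
  assumes "tame X" "infinite X"
  shows "\<exists>a b. a < b \<and> (\<forall>x. a < x \<and> x < b \<longrightarrow> x \<in> X)"
proof -
  have "infinite X \<longrightarrow> (\<exists>a b. a < b \<and> (\<forall>x. a < x \<and> x < b \<longrightarrow> x \<in> X))" using assms(1)
  proof (induction rule: tame_induct)
    case (point a Y)
    then show ?case by (metis UnCI finite.emptyI finite_Un finite_insert)
  next
    case (interval I Y)
    from interval(1) consider "I = {}" | "\<exists>a b. a < b \<and> (\<forall>x. a < x \<and> x < b \<longrightarrow> x \<in> I)"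
      unfolding open_interval_def
      by (metis UNIV_I greaterThanLessThan_empty greaterThanLessThan_iff greaterThan_iff gt_ex lessThan_iff lt_ex leI)
    then show ?case using interval(2) by cases auto
  qed simp
  then show ?thesis using assms(2) by blast
qed

lemma infinite_between: "a < b \<Longrightarrow> (\<And>x. a < x \<Longrightarrow> x < b \<Longrightarrow> x \<in> X) \<Longrightarrow> infinite (X :: 'r::unbounded_dense_linorder set)"
  by (metis finite_subset greaterThanLessThan_iff infinite_Ioo subsetI)


section \<open>Definable predicates and definable linear orders\<close>

text \<open>
  A formula is represented by the predicate it defines on assignments \<open>\<rho>\<close> of its variables, with de
  Bruijn indices: a quantified variable becomes \<open>\<rho> 0\<close> and shifts the others.
\<close>

locale definable_preds =
  fixes D :: "((nat \<Rightarrow> 'r::unbounded_dense_linorder) \<Rightarrow> bool) \<Rightarrow> bool"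
  assumes D_neg: "D P \<Longrightarrow> D (\<lambda>\<rho>. \<not> P \<rho>)"
    and D_conj: "D P \<Longrightarrow> D Q \<Longrightarrow> D (\<lambda>\<rho>. P \<rho> \<and> Q \<rho>)"
    and D_ex: "D (\<lambda>\<rho>. P' (\<rho> 0) (\<lambda>i. \<rho> (Suc i))) \<Longrightarrow> D (\<lambda>\<rho>. \<exists>y. P' y \<rho>)"
    and D_less_vars: "D (\<lambda>\<rho>. \<rho> 0 < \<rho> 1)"
    and D_rename: "D P \<Longrightarrow> D (\<lambda>\<rho>. P (\<lambda>i. \<rho> (\<sigma> i)))"
begin

abbreviation D1 :: "('r \<Rightarrow> bool) \<Rightarrow> bool" where
  "D1 P \<equiv> D (\<lambda>\<rho>. P (\<rho> 0))"

abbreviation D2 :: "('r \<Rightarrow> 'r \<Rightarrow> bool) \<Rightarrow> bool" where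
  "D2 r \<equiv> D (\<lambda>\<rho>. r (\<rho> 0) (\<rho> 1))"

abbreviation definable_pt :: "'r \<Rightarrow> bool" where
  "definable_pt c \<equiv> D1 (\<lambda>x. x = c)"

text \<open>Besides variables, only points that the family itself defines count as terms, so that
  formulas built from them stay within the given parameters.\<close>

definition trm :: "((nat \<Rightarrow> 'r) \<Rightarrow> 'r) \<Rightarrow> bool" where
  "trm s \<longleftrightarrow> (\<exists>i. s = (\<lambda>\<rho>. \<rho> i)) \<or> (\<exists>c. definable_pt c \<and> s = (\<lambda>\<rho>. c))"

lemma trm_var: "trm (\<lambda>\<rho>. \<rho> i)"
  by (auto simp: trm_def)

lemma trm_const: "definable_pt c \<Longrightarrow> trm (\<lambda>\<rho>. c)"
  by (auto simp: trm_def)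

lemma trm_shift: "trm s \<Longrightarrow> trm (\<lambda>\<rho>. s (\<lambda>i. \<rho> (Suc i)))"
  by (auto simp: trm_def)

lemma D_disj: "D P \<Longrightarrow> D Q \<Longrightarrow> D (\<lambda>\<rho>. P \<rho> \<or> Q \<rho>)"
  using D_neg[OF D_conj[OF D_neg[of P] D_neg[of Q]]] by simp

lemma D_imp: "D P \<Longrightarrow> D Q \<Longrightarrow> D (\<lambda>\<rho>. P \<rho> \<longrightarrow> Q \<rho>)"
  using D_neg[OF D_conj[of P, OF _ D_neg[of Q]]] by simp

lemma D_iff: "D P \<Longrightarrow> D Q \<Longrightarrow> D (\<lambda>\<rho>. P \<rho> \<longleftrightarrow> Q \<rho>)"
  using D_conj[OF D_imp[of P Q] D_imp[of Q P]] by (simp add: iff_conv_conj_imp)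

lemma D_all: "D (\<lambda>\<rho>. P (\<rho> 0) (\<lambda>i. \<rho> (Suc i))) \<Longrightarrow> D (\<lambda>\<rho>. \<forall>y. P y \<rho>)"
  using D_neg[OF D_ex[of "\<lambda>y \<rho>. \<not> P y \<rho>", OF D_neg]] by simp

lemma D_less_var: "D (\<lambda>\<rho>. \<rho> i < \<rho> j)"
  using D_rename[OF D_less_vars, of "\<lambda>k. if k = 0 then i else j"] by simp

lemma D_eq_var: "D (\<lambda>\<rho>. \<rho> i = \<rho> j)"
proof -
  have "D (\<lambda>\<rho>. \<not> \<rho> i < \<rho> j \<and> \<not> \<rho> j < \<rho> i)"
    by (intro D_neg D_conj D_less_var)
  moreover have "(\<lambda>\<rho>. \<not> \<rho> i < \<rho> j \<and> \<not> \<rho> j < \<rho> i) = (\<lambda>\<rho>. (\<rho> i :: 'r) = \<rho> j)"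
    by (auto simp: fun_eq_iff)
  ultimately show ?thesis by simp
qed

lemma D_const: "D (\<lambda>\<rho>. b)"
  using D_eq_var[of 0 0] D_neg[OF D_eq_var[of 0 0]] by (cases b) simp_all

lemma D_eq:
  assumes "trm s" "trm t"
  shows "D (\<lambda>\<rho>. s \<rho> = t \<rho>)"
proof -
  have const: "D (\<lambda>\<rho>. \<rho> i = c)" if "definable_pt c" for i c
    using D_rename[OF that, of "\<lambda>_. i"] by simp
  then have "D (\<lambda>\<rho>. c = \<rho> i)" if "definable_pt c" for i c
    using that by (simp add: eq_commute)
  then show ?thesis
    using assms const D_eq_var D_const unfolding trm_def by auto
qed

text \<open>Renaming only replaces variables by variables. A constant is therefore substituted
  through a quantifier, as \<open>y = t\<close> together with \<open>P y\<close>.\<close>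

lemma D_rel1:
  assumes "D1 P" "trm t"
  shows "D (\<lambda>\<rho>. P (t \<rho>))"
proof -
  have "D (\<lambda>\<rho>. \<exists>y. y = t \<rho> \<and> P y)"
    by (intro D_ex D_conj D_eq trm_var trm_shift assms D_rename[OF assms(1), of "\<lambda>_. 0"])
  then show ?thesis by simp
qed

lemma D_rel2:
  assumes "D2 r" "trm s" "trm t"
  shows "D (\<lambda>\<rho>. r (s \<rho>) (t \<rho>))"
proof -
  have "D (\<lambda>\<rho>. r (\<rho> 1) (\<rho> 0))"
    using D_rename[OF assms(1), of "\<lambda>i. 1 - i"] by simp
  then have "D (\<lambda>\<rho>. \<exists>y z. y = s \<rho> \<and> z = t \<rho> \<and> r y z)"
    by (intro D_ex D_conj D_eq trm_var trm_shift assms) simp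
  then show ?thesis by simp
qed

lemma D_less: "trm s \<Longrightarrow> trm t \<Longrightarrow> D (\<lambda>\<rho>. s \<rho> < t \<rho>)"
  by (rule D_rel2[OF D_less_vars])

lemma D_le: "trm s \<Longrightarrow> trm t \<Longrightarrow> D (\<lambda>\<rho>. s \<rho> \<le> t \<rho>)"
  unfolding not_less[symmetric] by (intro D_neg D_less)

lemma D_orient: "orientation lt \<Longrightarrow> trm s \<Longrightarrow> trm t \<Longrightarrow> D (\<lambda>\<rho>. lt (s \<rho>) (t \<rho>))"
  using D_less unfolding orientation_def by auto

lemmas D_intros = D_neg D_conj D_disj D_imp D_iff D_ex D_all D_less D_le D_eq D_const trm_var

text \<open>The least element is defined by its minimality, hence without new parameters; removing
  it leaves a smaller set definable over the same parameters.\<close>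

lemma finite_definable_pts:
  assumes "finite {x. P x}" "D1 P" "P c"
  shows "definable_pt c"
  using assms
proof (induction "card {x. P x}" arbitrary: P rule: less_induct)
  case less
  define m where "m = Min {x. P x}"
  have m: "P m" "\<And>x. P x \<Longrightarrow> m \<le> x"
    unfolding m_def using Min_in[OF less.prems(1)] Min_le[OF less.prems(1)] less.prems(3) by auto
  have "D1 (\<lambda>x. P x \<and> (\<forall>y. P y \<longrightarrow> x \<le> y))"
    by (intro D_intros D_rel1[OF less.prems(2)])
  moreover have "(\<lambda>\<rho>::nat \<Rightarrow> 'r. P (\<rho> 0) \<and> (\<forall>y. P y \<longrightarrow> \<rho> 0 \<le> y)) = (\<lambda>\<rho>. \<rho> 0 = m)"
    using m by (auto simp: fun_eq_iff intro: order.antisym)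
  ultimately have pt: "definable_pt m" by simp
  show ?case
  proof (cases "c = m")
    case False
    have "{x. P x \<and> x \<noteq> m} \<subset> {x. P x}" using m by auto
    moreover have "D1 (\<lambda>x. P x \<and> x \<noteq> m)"
      by (intro D_intros D_rel1[OF less.prems(2)] trm_const[OF pt])
    ultimately show ?thesis
      using less.hyps[of "\<lambda>x. P x \<and> x \<noteq> m"] less.prems False
      by (simp add: psubset_card_mono)
  qed (use pt in simp)
qed

end

section \<open>Boundary points and local properties\<close>

definition bdry :: "('r::order \<Rightarrow> bool) \<Rightarrow> 'r \<Rightarrow> bool" where
  "bdry P x \<longleftrightarrow> (\<forall>a b. a < x \<and> x < b \<longrightarrow>
     (\<exists>u. a < u \<and> u < b \<and> P u) \<and> (\<exists>u. a < u \<and> u < b \<and> \<not> P u))"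

text \<open>The pair \<open>u\<close>, \<open>v\<close> need not straddle \<open>x\<close>, so the
  property is inherited by all points near \<open>x\<close>.\<close>

definition locally_rel :: "('r::order \<Rightarrow> 'r \<Rightarrow> bool) \<Rightarrow> 'r \<Rightarrow> bool" where
  "locally_rel Q x \<longleftrightarrow>
     (\<exists>a b. a < x \<and> x < b \<and> (\<forall>u v. a < u \<and> u < v \<and> v < b \<longrightarrow> Q u v))"

context definable_preds
begin

lemma D1_bdry: assumes "D1 P" shows "D1 (bdry P)"
  unfolding bdry_def by (intro D_intros D_rel1[OF assms])

lemma D1_locally_rel: assumes "D2 Q" shows "D1 (locally_rel Q)"
  unfolding locally_rel_def by (intro D_intros D_rel2[OF assms])

end

text \<open>Here every point counts as a parameter. In \<open>D_tame\<close> the constant assignment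
  identifies all variables with \<open>x\<close>; for a predicate that mentions only variable 0 this
  gives just the set it defines.\<close>

locale o_min_preds = definable_preds +
  assumes pt: "definable_pt c"
    and D_tame: "D P \<Longrightarrow> tame {x. P (\<lambda>_. x)}"
begin

lemma tame1: "D1 P \<Longrightarrow> tame {x. P x}"
  using D_tame[of "\<lambda>\<rho>. P (\<rho> 0)"] by simp

lemmas D_pintros = D_intros trm_const[OF pt]

lemma all_before_dichotomy:
  "orientation lt \<Longrightarrow> D1 P \<Longrightarrow> all_before lt P d \<or> all_before lt (\<lambda>y. \<not> P y) d"
  using tame_all_before[OF _ tame1, of lt P d] by simp

text \<open>Induction along a segment. At the infimum \<open>s\<close> of the points not reached
  from \<open>u\<close>, the left germ and transitivity give \<open>Q u s\<close>, and the right
  germ carries this beyond \<open>s\<close>. Applied to equality of truth values, constancy and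
  monotonicity, it turns local statements into global ones.\<close>

lemma local_global:
  assumes "D2 Q" and trans: "\<And>x y z. Q x y \<Longrightarrow> Q y z \<Longrightarrow> Q x z"
    and left: "\<And>x. u \<le> x \<Longrightarrow> x \<le> v \<Longrightarrow> all_before (<) (\<lambda>y. Q y x) x"
    and right: "\<And>x. u \<le> x \<Longrightarrow> x \<le> v \<Longrightarrow> all_before (>) (\<lambda>y. Q x y) x"
    and "u < v"
  shows "Q u v"
proof (rule ccontr)
  assume v: "\<not> Q u v"
  let ?S = "{y. u < y \<and> y \<le> v \<and> \<not> Q u y}"
  have "tame ?S"
    by (intro tame1 D_pintros D_rel2[OF assms(1)])
  moreover have "v \<in> ?S" using v \<open>u < v\<close> by simp
  moreover have "\<not> x < u" if "x \<in> ?S" for x using that by auto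
  ultimately obtain s where s: "\<And>x. x \<in> ?S \<Longrightarrow> \<not> x < s" "\<And>t. s < t \<Longrightarrow> \<exists>x\<in>?S. x < t"
    using tame_sup[OF orientation_greater, of ?S v u] by blast
  have "s \<le> v" using s(1) \<open>v \<in> ?S\<close> by fastforce
  have "u \<le> s" using s(2)[of u] by fastforce
  \<comment> \<open>The left germ at \<open>s\<close> is of help only if it meets points beyond
    \<open>u\<close>; the right germ at \<open>u\<close> ensures that.\<close>
  have "u \<noteq> s"
  proof
    assume "u = s"
    obtain c where "u < c" "\<And>y. u < y \<Longrightarrow> y < c \<Longrightarrow> Q u y"
      using right[OF order_refl less_imp_le[OF \<open>u < v\<close>]] unfolding all_before_def by blast
    then show False using s(2)[of c] \<open>u = s\<close> by auto
  qed
  with \<open>u \<le> s\<close> have "u < s" by simp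
  obtain c where c: "c < s" "\<And>y. c < y \<Longrightarrow> y < s \<Longrightarrow> Q y s"
    using left[OF \<open>u \<le> s\<close> \<open>s \<le> v\<close>] unfolding all_before_def by blast
  obtain y where y: "max u c < y" "y < s"
    using dense[of "max u c" s] c \<open>u < s\<close> by auto
  then have "Q u y" using s(1)[of y] less_imp_le[OF order.strict_trans2[OF y(2) \<open>s \<le> v\<close>]] by auto
  then have "Q u s" using c(2)[of y] y trans by auto
  obtain c' where c': "s < c'" "\<And>y. s < y \<Longrightarrow> y < c' \<Longrightarrow> Q s y"
    using right[OF \<open>u \<le> s\<close> \<open>s \<le> v\<close>] unfolding all_before_def by blast
  obtain x where "x \<in> ?S" "x < c'" using s(2)[OF c'(1)] by blast
  then show False
    using s(1)[of x] c'(2)[of x] \<open>Q u s\<close> trans by (cases "x = s") auto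
qed

text \<open>Definable connectedness of a segment: away from the boundary the truth value of
  \<open>P\<close> is constant near each point, and having the same truth value is a transitive
  relation, so \<open>local_global\<close> applies.\<close>

lemma constant_off_bdry:
  assumes "D1 P" "\<And>x. u \<le> x \<Longrightarrow> x \<le> v \<Longrightarrow> \<not> bdry P x" "u \<le> v"
  shows "P u \<longleftrightarrow> P v"
proof (cases "u = v")
  case False
  have near: "\<exists>a b. a < x \<and> x < b \<and> (\<forall>y. a < y \<and> y < b \<longrightarrow> (P y \<longleftrightarrow> P x))"
    if "u \<le> x" "x \<le> v" for x
    using assms(2)[OF that] unfolding bdry_def by blast
  show ?thesis
  proof (rule local_global[of "\<lambda>x y. P x \<longleftrightarrow> P y"])
    show "D (\<lambda>\<rho>. P (\<rho> 0) \<longleftrightarrow> P (\<rho> 1))"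
      by (intro D_intros D_rel1[OF assms(1)])
    show "u < v" using False assms(3) by simp
    show "all_before (<) (\<lambda>y. P y \<longleftrightarrow> P x) x" "all_before (>) (\<lambda>y. P x \<longleftrightarrow> P y) x"
      if "u \<le> x" "x \<le> v" for x
      using near[OF that] unfolding all_before_def by (metis order.strict_trans)+
  qed blast
qed simp

lemma constant_on_subinterval:
  assumes "a < b" "D1 P"
  obtains a' b' where "a' < b'" "\<And>x. a' < x \<Longrightarrow> x < b' \<Longrightarrow> a < x \<and> x < b"
    "(\<forall>x. a' < x \<and> x < b' \<longrightarrow> P x) \<or> (\<forall>x. a' < x \<and> x < b' \<longrightarrow> \<not> P x)"
proof -
  obtain c where "c < b" "(\<forall>x. c < x \<and> x < b \<longrightarrow> P x) \<or> (\<forall>x. c < x \<and> x < b \<longrightarrow> \<not> P x)"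
    using all_before_dichotomy[of "(<)" P b] assms(2) unfolding all_before_def by auto
  then show ?thesis by (intro that[of "max a c" b]; simp add: assms(1)) blast
qed

text \<open>An infinite boundary would contain an interval, and \<open>P\<close> is constant on some
  subinterval of it, whose points are then not on the boundary.\<close>

lemma finite_bdry:
  assumes "D1 P"
  shows "finite {x. bdry P x}"
proof (rule ccontr)
  assume "infinite {x. bdry P x}"
  then obtain a b where ab: "a < b" "\<And>x. a < x \<Longrightarrow> x < b \<Longrightarrow> bdry P x"
    using tame_infinite_interval[OF tame1[OF D1_bdry[OF assms]]] by auto
  obtain a' b' where a'b': "a' < b'" "\<And>x. a' < x \<Longrightarrow> x < b' \<Longrightarrow> a < x \<and> x < b"
    "(\<forall>x. a' < x \<and> x < b' \<longrightarrow> P x) \<or> (\<forall>x. a' < x \<and> x < b' \<longrightarrow> \<not> P x)"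
    using constant_on_subinterval[OF ab(1) assms] by blast
  obtain x where x: "a' < x" "x < b'" using dense[OF a'b'(1)] by blast
  then have "bdry P x" using ab a'b'(2) by blast
  then show False using a'b'(3) x unfolding bdry_def by blast
qed

text \<open>
  Near \<open>b\<close> each \<open>x\<close> is \<open>r\<close>-above all sufficiently late points. The supremum \<open>y\<close> of
  the later points that are not \<open>r\<close>-below \<open>x\<close> is a downward jump through the level of \<open>x\<close>.
\<close>

lemma strict_local_min_jump:
  assumes gt_def: "gt = (\<lambda>x y. lt y x)" and lt: "orientation lt" and "lt a b" and r: "D2 r"
    and irrefl: "\<And>x. \<not> r x x" and trans: "\<And>x y z. r x y \<Longrightarrow> r y z \<Longrightarrow> r x z"
    and total: "\<And>x y. lt a x \<Longrightarrow> lt x b \<Longrightarrow> lt a y \<Longrightarrow> lt y b \<Longrightarrow> x \<noteq> y \<Longrightarrow> r x y \<or> r y x"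
    and minl: "\<And>x. lt a x \<Longrightarrow> lt x b \<Longrightarrow> all_before lt (\<lambda>y. r x y) x"
    and minr: "\<And>x. lt a x \<Longrightarrow> lt x b \<Longrightarrow> all_before gt (\<lambda>y. r x y) x"
  obtains c where "lt c b" and "\<And>y. lt c y \<Longrightarrow> lt y b \<Longrightarrow>
    \<exists>x. all_before lt (\<lambda>z. r x z) y \<and> all_before gt (\<lambda>z. r z x) y"
proof -
  note lt_irrefl = lt_irrefl[OF lt] and lt_trans = lt_trans[OF lt] and lt_total = lt_total[OF lt]
    and ab_conj = all_before_conj[OF lt] and ab_gt = all_before_gt[OF lt] and ab_ex = all_before_ex[OF lt]
  have gt: "orientation gt" using lt unfolding gt_def orientation_def by auto
  note D_facts = D_pintros D_orient[OF lt] D_orient[OF gt] D_rel2[OF r]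
  \<comment> \<open>If all late \<open>y\<close> satisfied \<open>?B\<close>, the order
    \<open>r\<close> would be increasing there, contrary to the points just before \<open>y\<close>
    being \<open>r\<close>-above \<open>y\<close>. So beyond some \<open>d\<close> every point has a
    later point \<open>r\<close>-below it.\<close>
  let ?B = "\<lambda>y. \<forall>z. lt y z \<and> lt z b \<longrightarrow> r y z"
  have "D1 ?B" by (intro D_facts)
  from all_before_dichotomy[OF lt this, of b]
  consider "all_before lt ?B b" | "all_before lt (\<lambda>y. \<not> ?B y) b" by blast
  then obtain d where d: "lt d b" "d = a \<or> lt a d"
    and down: "\<And>x. lt d x \<Longrightarrow> lt x b \<Longrightarrow> \<exists>z. lt x z \<and> lt z b \<and> r z x"
  proof cases
    case 1
    then obtain c where c: "lt c b" "\<And>y. lt c y \<Longrightarrow> lt y b \<Longrightarrow> ?B y"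
      unfolding all_before_def by blast
    obtain y where y: "lt c y" "lt y b" "lt a y"
      using ab_ex[OF ab_conj[OF ab_gt[OF c(1)] ab_gt[OF \<open>lt a b\<close>]]] by blast
    obtain x where x: "lt x y" "r y x" "lt c x"
      using ab_ex[OF ab_conj[OF minl[OF y(3,2)] ab_gt[OF y(1)]]] by blast
    then have "r x y" using c(2)[of x] y lt_trans by blast
    then show ?thesis using x trans irrefl by blast
  next
    case 2
    then obtain c where c: "lt c b" "\<And>y. lt c y \<Longrightarrow> lt y b \<Longrightarrow> \<not> ?B y"
      unfolding all_before_def by blast
    define d where "d = (if lt a c then c else a)"
    have "lt d b" "d = a \<or> lt a d" using c \<open>lt a b\<close> by (auto simp: d_def)
    moreover have "\<exists>z. lt x z \<and> lt z b \<and> r z x" if x: "lt d x" "lt x b" for x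
    proof -
      have "lt a x" "lt c x"
        using x(1) lt_trans lt_total[of a c] unfolding d_def by (auto split: if_splits)
      then obtain z where z: "lt x z" "lt z b" "\<not> r x z" using c(2) x(2) by blast
      then have "r z x" using total[of x z] \<open>lt a x\<close> x lt_trans lt_irrefl by blast
      then show ?thesis using z by blast
    qed
    ultimately show ?thesis using that by blast
  qed
  have lt_d: "lt a x" if "lt d x" for x using that d(2) lt_trans by blast
  \<comment> \<open>Otherwise let \<open>e\<close> be the supremum of the points after
    \<open>x\<close> that are \<open>r\<close>-below \<open>x\<close>. If \<open>e\<close> is
    \<open>r\<close>-below \<open>x\<close>, so is some point beyond \<open>e\<close>; if not, the
    points just before \<open>e\<close> are \<open>r\<close>-above \<open>e\<close> and hence above
    \<open>x\<close>. Both contradict the choice of \<open>e\<close>.\<close>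
  have falls: "all_before lt (\<lambda>y. r y x) b" if x: "lt d x" "lt x b" for x
  proof (rule ccontr)
    assume "\<not> all_before lt (\<lambda>y. r y x) b"
    moreover have "D1 (\<lambda>y. r y x)" by (intro D_facts)
    ultimately obtain c where c: "lt c b" "\<And>y. lt c y \<Longrightarrow> lt y b \<Longrightarrow> \<not> r y x"
      using all_before_dichotomy[OF lt, of "\<lambda>y. r y x" b] unfolding all_before_def by blast
    let ?S = "{y. lt x y \<and> lt y b \<and> r y x}"
    have S: "tame ?S" by (intro tame1 D_facts)
    obtain z where z: "z \<in> ?S" using down[OF x] by blast
    have "\<not> lt c y" if "y \<in> ?S" for y using c that by blast
    from tame_sup[OF lt S z this] obtain e where
      e: "\<And>y. y \<in> ?S \<Longrightarrow> \<not> lt e y" "\<And>t. lt t e \<Longrightarrow> \<exists>y\<in>?S. lt t y" by blast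
    have "lt e b"
    proof (rule ccontr)
      assume "\<not> lt e b"
      then have "lt c e" using c(1) lt_total lt_trans by metis
      then show False using e(2) c(2) by blast
    qed
    have "lt x e" using e(1)[OF z] z lt_total[of z e] lt_trans by blast
    then have "lt d e" using x lt_trans by blast
    show False
    proof (cases "r e x")
      case True
      obtain y where "lt e y" "lt y b" "r y e" using down[OF \<open>lt d e\<close> \<open>lt e b\<close>] by blast
      then have "y \<in> ?S" using True \<open>lt x e\<close> lt_trans trans by blast
      then show False using e(1) \<open>lt e y\<close> by blast
    next
      case False
      then have "r x e"
        using total[of x e] x \<open>lt x e\<close> \<open>lt e b\<close> \<open>lt d e\<close> lt_irrefl lt_d by blast
      obtain c' where c': "lt c' e" "\<And>y. lt c' y \<Longrightarrow> lt y e \<Longrightarrow> r e y"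
        using minl[OF lt_d[OF \<open>lt d e\<close>] \<open>lt e b\<close>] unfolding all_before_def by blast
      obtain y where y: "y \<in> ?S" "lt c' y" using e(2)[OF c'(1)] by blast
      then have "lt y e" using e(1)[of y] lt_total[of y e] False by blast
      then have "r x y" using c'(2) y(2) \<open>r x e\<close> trans by blast
      then show False using y(1) trans irrefl by blast
    qed
  qed
  let ?J = "\<lambda>y. \<exists>x. all_before lt (\<lambda>z. r x z) y \<and> all_before gt (\<lambda>z. r z x) y"
  have jump: "\<exists>y. lt x y \<and> lt y b \<and> ?J y" if x: "lt d x" "lt x b" for x
  proof -
    obtain c where c: "lt c b" "\<And>y. lt c y \<Longrightarrow> lt y b \<Longrightarrow> r y x"
      using falls[OF x] unfolding all_before_def by blast
    let ?T = "{y. lt x y \<and> lt y b \<and> \<not> r y x}"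
    have T: "tame ?T" by (intro tame1 D_facts)
    have "all_before gt (\<lambda>y. gt b y \<and> gt y x) x"
      using x(2) unfolding all_before_def gt_def by blast
    from all_before_ex[OF gt all_before_conj[OF gt minr[OF lt_d[OF x(1)] x(2)] this]]
    obtain z where z: "z \<in> ?T" unfolding gt_def using trans irrefl by blast
    have "\<not> lt c y" if "y \<in> ?T" for y using c that by blast
    from tame_sup[OF lt T z this] obtain e where
      e: "\<And>y. y \<in> ?T \<Longrightarrow> \<not> lt e y" "\<And>t. lt t e \<Longrightarrow> \<exists>y\<in>?T. lt t y" by blast
    have "lt e b"
    proof (rule ccontr)
      assume "\<not> lt e b"
      then have "lt c e" using c(1) lt_total lt_trans by metis
      then show False using e(2) c(2) by blast
    qed
    have "lt x e" using e(1)[OF z] z lt_total[of z e] lt_trans by blast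
    then have "lt d e" using x lt_trans by blast
    have "r y x" if "lt e y" "lt y b" for y
      using e(1)[of y] that \<open>lt x e\<close> lt_trans by blast
    then have right: "all_before gt (\<lambda>z. r z x) e"
      unfolding all_before_def gt_def using \<open>lt e b\<close> by blast
    \<comment> \<open>The points just after \<open>e\<close> are \<open>r\<close>-above
      \<open>e\<close> by \<open>minr\<close> and \<open>r\<close>-below \<open>x\<close>. Hence
      \<open>e\<close> is not in \<open>?T\<close>, which therefore accumulates at \<open>e\<close>
      from before.\<close>
    have "r e x"
      using all_before_ex[OF gt all_before_conj[OF gt minr[OF lt_d[OF \<open>lt d e\<close>] \<open>lt e b\<close>] right]] trans
      by blast
    have "\<not> all_before lt (\<lambda>z. r z x) e"
    proof
      assume "all_before lt (\<lambda>z. r z x) e"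
      then obtain c' where c': "lt c' e" "\<And>y. lt c' y \<Longrightarrow> lt y e \<Longrightarrow> r y x"
        unfolding all_before_def by blast
      obtain y where y: "y \<in> ?T" "lt c' y" using e(2)[OF c'(1)] by blast
      then have "lt y e" using e(1)[of y] lt_total[of y e] \<open>r e x\<close> by blast
      then show False using c'(2) y by blast
    qed
    moreover have "D1 (\<lambda>z. r z x)" by (intro D_facts)
    ultimately have "all_before lt (\<lambda>z. \<not> r z x) e"
      using all_before_dichotomy[OF lt, of "\<lambda>z. r z x" e] by blast
    from ab_conj[OF this ab_gt[OF \<open>lt x e\<close>]] have "all_before lt (\<lambda>z. r x z) e"
    proof (rule all_before_mono)
      fix z assume "\<not> r z x \<and> lt x z \<and> lt z e"
      then show "r x z"
        using total[of x z] x \<open>lt e b\<close> lt_d lt_trans lt_irrefl by blast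
    qed
    then show ?thesis using right \<open>lt x e\<close> \<open>lt e b\<close> by blast
  qed
  \<comment> \<open>Jumps occur beyond every point past \<open>d\<close>, which leaves only the
    alternative that all late points are jumps.\<close>
  have "D1 ?J" unfolding all_before_def by (intro D_facts)
  from all_before_dichotomy[OF lt this, of b]
  consider "all_before lt ?J b" | "all_before lt (\<lambda>y. \<not> ?J y) b" by blast
  then show ?thesis
  proof cases
    case 1
    then obtain c where "lt c b" "\<And>y. lt c y \<Longrightarrow> lt y b \<Longrightarrow> ?J y"
      unfolding all_before_def by blast
    then show ?thesis using that by blast
  next
    case 2
    then obtain c where c: "lt c b" "\<And>y. lt c y \<Longrightarrow> lt y b \<Longrightarrow> \<not> ?J y"
      unfolding all_before_def by blast
    obtain x where x: "lt c x" "lt x b" "lt d x"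
      using ab_ex[OF ab_conj[OF ab_gt[OF c(1)] ab_gt[OF d(1)]]] by blast
    obtain y where "lt x y" "lt y b" "?J y" using jump[OF x(3,2)] by blast
    then show ?thesis using c(2)[of y] x lt_trans by blast
  qed
qed

lemma no_strict_local_min:
  assumes "a < b" and r: "D2 r"
    and irrefl: "\<And>x. \<not> r x x" and trans: "\<And>x y z. r x y \<Longrightarrow> r y z \<Longrightarrow> r x z"
    and total: "\<And>x y. a < x \<Longrightarrow> x < b \<Longrightarrow> a < y \<Longrightarrow> y < b \<Longrightarrow> x \<noteq> y \<Longrightarrow> r x y \<or> r y x"
    and minl: "\<And>x. a < x \<Longrightarrow> x < b \<Longrightarrow> all_before (<) (\<lambda>y. r x y) x"
    and minr: "\<And>x. a < x \<Longrightarrow> x < b \<Longrightarrow> all_before (>) (\<lambda>y. r x y) x"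
  shows False
proof -
  obtain c where c: "c < b" and jump: "\<And>y. c < y \<Longrightarrow> y < b \<Longrightarrow>
      \<exists>x. all_before (<) (\<lambda>z. r x z) y \<and> all_before (>) (\<lambda>z. r z x) y"
  proof (rule strict_local_min_jump[OF refl orientation_less \<open>a < b\<close> r irrefl])
    show "r x z" if "r x y" "r y z" for x y z using trans that .
    show "r x y \<or> r y x" if "a < x" "x < b" "a < y" "y < b" "x \<noteq> y" for x y using total that .
  qed (use minl minr in blast)+
  \<comment> \<open>The first application fills a final segment of the interval with downward jumps.
    The second runs from \<open>b\<close> back to \<open>d\<close> and fills a segment adjacent to
    \<open>d\<close>; placing \<open>d\<close> at or after \<open>c\<close> makes the two segments
    overlap.\<close>
  define d where "d = max a c"
  have d: "d < b" "a \<le> d" "c \<le> d" using \<open>a < b\<close> c by (auto simp: d_def)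
  obtain c' where c': "d < c'" and jump': "\<And>y. d < y \<Longrightarrow> y < c' \<Longrightarrow>
      \<exists>x. all_before (>) (\<lambda>z. r x z) y \<and> all_before (<) (\<lambda>z. r z x) y"

  proof (rule strict_local_min_jump[OF refl orientation_greater \<open>d < b\<close> r irrefl])
    show "r x z" if "r x y" "r y z" for x y z using trans that .
    show "r x y \<or> r y x" if "x < b" "d < x" "y < b" "d < y" "x \<noteq> y" for x y
      using total that d by simp
  qed (use minl minr d in auto)
  obtain y where y: "d < y" "y < min b c'" using dense[of d "min b c'"] c' d by auto
  obtain x where x: "all_before (<) (\<lambda>z. r x z) y" "all_before (>) (\<lambda>z. r z x) y"
    using jump[of y] y d by (meson min_less_iff_conj order.strict_trans1)
  obtain x' where x': "all_before (>) (\<lambda>z. r x' z) y" "all_before (<) (\<lambda>z. r z x') y"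
    using jump'[of y] y d by (meson min_less_iff_conj)
  \<comment> \<open>In the order \<open>r\<close>, the left germ at \<open>y\<close> lies above
    \<open>x\<close> and below \<open>x'\<close>, while the right germ lies above \<open>x'\<close>
    and below \<open>x\<close>.\<close>
  have "r x x'" using all_before_ex[OF _ all_before_conj[OF _ x(1) x'(2)]] trans by auto
  moreover have "r x' x" using all_before_ex[OF _ all_before_conj[OF _ x(2) x'(1)]] trans by auto
  ultimately show False using trans irrefl by blast
qed

text \<open>On a subinterval it is uniform whether points are \<open>r\<close>-below their left and
  right germs. If both or neither holds, \<open>no_strict_local_min\<close> refutes it, for
  \<open>r\<close> or for its converse; if exactly one holds, the two germs of each point lie on
  opposite \<open>r\<close>-sides of it, and \<open>local_global\<close> gives monotonicity.\<close>

lemma definable_order_monotone: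
  assumes "a < b" and r: "D2 r"
    and irrefl: "\<And>x. \<not> r x x" and trans: "\<And>x y z. r x y \<Longrightarrow> r y z \<Longrightarrow> r x z"
    and total: "\<And>x y. a < x \<Longrightarrow> x < b \<Longrightarrow> a < y \<Longrightarrow> y < b \<Longrightarrow> x \<noteq> y \<Longrightarrow> r x y \<or> r y x"
  obtains a' b' where "a' < b'" "\<And>x. a' < x \<Longrightarrow> x < b' \<Longrightarrow> a < x \<and> x < b"
    "(\<forall>u v. a' < u \<and> u < v \<and> v < b' \<longrightarrow> r u v) \<or> (\<forall>u v. a' < u \<and> u < v \<and> v < b' \<longrightarrow> r v u)"
proof -
  note D_facts = D_pintros D_rel2[OF r]
  let ?L = "\<lambda>x. all_before (<) (\<lambda>y. r x y) x" and ?R = "\<lambda>x. all_before (>) (\<lambda>y. r x y) x"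
  have L: "D1 ?L" and R: "D1 ?R" unfolding all_before_def by (intro D_facts)+
  obtain a1 b1 where 1: "a1 < b1" "\<And>x. a1 < x \<Longrightarrow> x < b1 \<Longrightarrow> a < x \<and> x < b"
    "(\<forall>x. a1 < x \<and> x < b1 \<longrightarrow> ?L x) \<or> (\<forall>x. a1 < x \<and> x < b1 \<longrightarrow> \<not> ?L x)"
    using constant_on_subinterval[OF \<open>a < b\<close> L] by blast
  obtain a2 b2 where 2: "a2 < b2" "\<And>x. a2 < x \<Longrightarrow> x < b2 \<Longrightarrow> a1 < x \<and> x < b1"
    "(\<forall>x. a2 < x \<and> x < b2 \<longrightarrow> ?R x) \<or> (\<forall>x. a2 < x \<and> x < b2 \<longrightarrow> \<not> ?R x)"
    using constant_on_subinterval[OF 1(1) R] by blast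
  have sub: "a < x" "x < b" if "a2 < x" "x < b2" for x
    using 1(2) 2(2) that by blast+
  have total2: "r x y \<or> r y x" if "a2 < x" "x < b2" "a2 < y" "y < b2" "x \<noteq> y" for x y
    using total sub that by blast
  have D': "D1 (\<lambda>y. r x y)" for x by (intro D_facts)
  \<comment> \<open>Where \<open>x\<close> is not \<open>r\<close>-below its left germ, the germ
    alternative and totality put that germ \<open>r\<close>-below \<open>x\<close>.\<close>
  have L': "all_before (<) (\<lambda>y. r y x) x" if x: "a2 < x" "x < b2" "\<not> ?L x" for x
  proof (rule all_before_mono)
    show "all_before (<) (\<lambda>y. \<not> r x y \<and> a2 < y \<and> y < x) x"
      using all_before_dichotomy[OF orientation_less D'[of x], of x] x all_before_gt[OF orientation_less x(1)]
      by (intro all_before_conj[of _ "\<lambda>y. \<not> r x y"]) simp_all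
    show "r y x" if "\<not> r x y \<and> a2 < y \<and> y < x" for y
      using that x(1,2) total2[of x y] by auto
  qed
  have R': "all_before (>) (\<lambda>y. r y x) x" if x: "a2 < x" "x < b2" "\<not> ?R x" for x
  proof (rule all_before_mono)
    show "all_before (>) (\<lambda>y. \<not> r x y \<and> y < b2 \<and> x < y) x"
      using all_before_dichotomy[OF orientation_greater D'[of x], of x] x all_before_gt[OF orientation_greater x(2)]
      by (intro all_before_conj[of _ "\<lambda>y. \<not> r x y"]) simp_all
    show "r y x" if "\<not> r x y \<and> y < b2 \<and> x < y" for y
      using that x(1,2) total2[of x y] by auto
  qed
  have flip: "D2 (\<lambda>x y. r y x)" by (intro D_facts)
  have L_cases: "(\<forall>x. a2 < x \<and> x < b2 \<longrightarrow> ?L x) \<or> (\<forall>x. a2 < x \<and> x < b2 \<longrightarrow> \<not> ?L x)"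
    using 1(3) 2(2) by blast
  then consider (LR) "\<And>x. a2 < x \<Longrightarrow> x < b2 \<Longrightarrow> ?L x" "\<And>x. a2 < x \<Longrightarrow> x < b2 \<Longrightarrow> ?R x"
    | (L) "\<And>x. a2 < x \<Longrightarrow> x < b2 \<Longrightarrow> ?L x" "\<And>x. a2 < x \<Longrightarrow> x < b2 \<Longrightarrow> \<not> ?R x"
    | (R) "\<And>x. a2 < x \<Longrightarrow> x < b2 \<Longrightarrow> \<not> ?L x" "\<And>x. a2 < x \<Longrightarrow> x < b2 \<Longrightarrow> ?R x"
    | (none) "\<And>x. a2 < x \<Longrightarrow> x < b2 \<Longrightarrow> \<not> ?L x" "\<And>x. a2 < x \<Longrightarrow> x < b2 \<Longrightarrow> \<not> ?R x"
    using 2(3) by metis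
  then show ?thesis
  proof cases
    case LR
    have False
    proof (rule no_strict_local_min[OF 2(1) r irrefl])
      show "r x z" if "r x y" "r y z" for x y z using trans that .
    qed (use total2 LR in blast)+
    then show ?thesis ..
  next
    case none
    have False
    proof (rule no_strict_local_min[OF 2(1) flip irrefl])
      show "r z x" if "r y x" "r z y" for x y z using trans that(2,1) .
    qed (use total2 none L' R' in blast)+
    then show ?thesis ..
  next
    case L
    have "r v u" if "a2 < u" "u < v" "v < b2" for u v
      by (rule local_global[OF flip]) (use that L trans R' in auto)
    then show ?thesis using that[OF 2(1)] sub by blast
  next
    case R
    have "r u v" if "a2 < u" "u < v" "v < b2" for u v
      by (rule local_global[OF r]) (use that R trans L' in auto)
    then show ?thesis using that[OF 2(1)] sub by blast
  qed
qed

end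


section \<open>The monotonicity theorem\<close>

text \<open>Functions enter as graphs: a partial function then has no default values, and its values
  can be quantified inside definable predicates.\<close>

definition functional :: "('a \<Rightarrow> 'b \<Rightarrow> bool) \<Rightarrow> bool" where
  "functional G \<longleftrightarrow> (\<forall>x y y'. G x y \<longrightarrow> G x y' \<longrightarrow> y = y')"

lemma functionalD: "functional G \<Longrightarrow> G x y \<Longrightarrow> G x y' \<Longrightarrow> y = y'"
  by (simp add: functional_def)

definition const_rel :: "('r \<Rightarrow> 'r \<Rightarrow> bool) \<Rightarrow> 'r \<Rightarrow> 'r \<Rightarrow> bool" where
  "const_rel G u v \<longleftrightarrow> (\<exists>p. G u p \<and> G v p)"

text \<open>The last clause is an intermediate value property. With it inside the relation,
  transitivity and \<open>local_global\<close> propagate strict monotonicity and convexity of the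
  image together.\<close>

definition mono_rel :: "('r::order \<Rightarrow> 'r \<Rightarrow> bool) \<Rightarrow> ('r \<Rightarrow> 'r \<Rightarrow> bool) \<Rightarrow> 'r \<Rightarrow> 'r \<Rightarrow> bool" where
  "mono_rel lt G u v \<longleftrightarrow> u < v \<and> (\<exists>p q. G u p \<and> G v q \<and> lt p q \<and>
     (\<forall>z. lt p z \<and> lt z q \<longrightarrow> (\<exists>w. u < w \<and> w < v \<and> G w z)))"

lemma (in definable_preds) D2_const_rel: assumes "D2 G" shows "D2 (const_rel G)"
  unfolding const_rel_def by (intro D_intros D_rel2[OF assms])

lemma (in definable_preds) D2_mono_rel: assumes "D2 G" "orientation lt" shows "D2 (mono_rel lt G)"
  unfolding mono_rel_def by (intro D_intros D_orient[OF assms(2)] D_rel2[OF assms(1)])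

context o_min_preds
begin

context
  fixes G :: "'a \<Rightarrow> 'a \<Rightarrow> bool"
  assumes G: "D2 G" and fG: "functional G"
begin

lemmas functional = functionalD[OF fG]

lemma const_rel_trans: "const_rel G x y \<Longrightarrow> const_rel G y z \<Longrightarrow> const_rel G x z"
  using functional unfolding const_rel_def by blast

lemma mono_rel_trans:
  assumes lt: "orientation lt" and "mono_rel lt G x y" "mono_rel lt G y z"
  shows "mono_rel lt G x z"
proof -
  obtain p q r where pqr: "G x p" "G y q" "G z r" "lt p q" "lt q r" "x < y" "y < z"
    and pq: "\<And>t. lt p t \<Longrightarrow> lt t q \<Longrightarrow> \<exists>w. x < w \<and> w < y \<and> G w t"
    and qr: "\<And>t. lt q t \<Longrightarrow> lt t r \<Longrightarrow> \<exists>w. y < w \<and> w < z \<and> G w t"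
    using assms(2,3) functional unfolding mono_rel_def by metis
  \<comment> \<open>A value strictly between \<open>p\<close> and \<open>r\<close> lies on one side
    of \<open>q\<close>, or equals \<open>q\<close> and is attained at \<open>y\<close>.\<close>
  have "\<exists>w. x < w \<and> w < z \<and> G w t" if "lt p t" "lt t r" for t
    using lt_total[OF lt, of t q] pq[of t] qr[of t] that pqr(2,6,7) order.strict_trans by metis
  then show ?thesis
    unfolding mono_rel_def using pqr lt_trans[OF lt] order.strict_trans by blast
qed

text \<open>If a value has infinitely many preimages, o-minimality yields an interval of them.
  Otherwise the points that are the least preimage of their value form an infinite set, as finitely
  many finite fibers cannot cover the interval; two such points never share a value.\<close>

lemma const_or_inj_on_subinterval:
  assumes "a < b" and total: "\<And>x. a < x \<Longrightarrow> x < b \<Longrightarrow> \<exists>y. G x y"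
  obtains a' b' where "a' < b'" "\<And>x. a' < x \<Longrightarrow> x < b' \<Longrightarrow> a < x \<and> x < b"
    "(\<exists>y. \<forall>x. a' < x \<and> x < b' \<longrightarrow> G x y) \<or>
     (\<forall>x x' y. a' < x \<and> x < b' \<and> a' < x' \<and> x' < b' \<and> G x y \<and> G x' y \<longrightarrow> x = x')"
proof (cases "\<exists>y. infinite {x. a < x \<and> x < b \<and> G x y}")
  case True
  then obtain y where y: "infinite {x. a < x \<and> x < b \<and> G x y}" by blast
  have "tame {x. a < x \<and> x < b \<and> G x y}" by (intro tame1 D_pintros D_rel2[OF G])
  from tame_infinite_interval[OF this y] obtain a' b' where
    "a' < b'" "\<And>x. a' < x \<Longrightarrow> x < b' \<Longrightarrow> a < x \<and> x < b \<and> G x y" by auto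
  then show ?thesis by (intro that[of a' b']) blast+
next
  case False
  then have fin: "finite {x. a < x \<and> x < b \<and> G x y}" for y by blast
  let ?B = "{x. a < x \<and> x < b \<and> (\<forall>x' y. a < x' \<and> x' < x \<and> G x y \<longrightarrow> \<not> G x' y)}"
  have tame: "tame ?B" by (intro tame1 D_pintros D_rel2[OF G])
  have "infinite ?B"
  proof
    assume "finite ?B"
    then have "finite (\<Union>m\<in>?B. {x. a < x \<and> x < b \<and> (\<exists>y. G m y \<and> G x y)})"
    proof (rule finite_UN_I)
      fix m assume "m \<in> ?B"
      then obtain y where y: "G m y" using total by blast
      then show "finite {x. a < x \<and> x < b \<and> (\<exists>y. G m y \<and> G x y)}"
        using functional by (intro finite_subset[OF _ fin[of y]]) blast
    qed
    moreover have "x \<in> (\<Union>m\<in>?B. {x. a < x \<and> x < b \<and> (\<exists>y. G m y \<and> G x y)})"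
      if x: "a < x" "x < b" for x
    proof -
      obtain y where y: "G x y" using total[OF x] by blast
      define m where "m = Min {x. a < x \<and> x < b \<and> G x y}"
      have m: "a < m" "m < b" "G m y" and least: "\<And>z. a < z \<Longrightarrow> z < b \<Longrightarrow> G z y \<Longrightarrow> m \<le> z"
        using Min_in[OF fin, of y] Min_le[OF fin] x y unfolding m_def by blast+
      have "\<not> G x' y'" if "a < x'" "x' < m" "G m y'" for x' y'
        using least[of x'] that m functional by (metis leD order.strict_trans)
      then show ?thesis using m x y by blast
    qed
    ultimately show False using infinite_between[OF \<open>a < b\<close>] by blast
  qed
  from tame_infinite_interval[OF tame this] obtain a' b'
    where "a' < b'" and B: "\<And>x. a' < x \<Longrightarrow> x < b' \<Longrightarrow> x \<in> ?B" by blast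
  have "x = x'" if "a' < x" "x < b'" "a' < x'" "x' < b'" "G x y" "G x' y" for x x' y
    using B[OF that(1,2)] B[OF that(3,4)] that(5,6) by (cases x x' rule: linorder_cases) blast+
  then show ?thesis by (intro that[OF \<open>a' < b'\<close>]) (use B in blast)+
qed

text \<open>The infinite image contains an interval of values. Preimages \<open>c\<close> and
  \<open>d\<close> of two of them bound an interval of arguments on which, by monotonicity, every
  value between those of \<open>u\<close> and \<open>v\<close> is attained between \<open>u\<close>
  and \<open>v\<close>.\<close>

lemma mono_rel_on_subinterval:
  assumes lt: "orientation lt" and "a < b"
    and total: "\<And>x. a < x \<Longrightarrow> x < b \<Longrightarrow> \<exists>y. G x y"
    and mono: "\<And>u v p q. a < u \<Longrightarrow> u < v \<Longrightarrow> v < b \<Longrightarrow> G u p \<Longrightarrow> G v q \<Longrightarrow> lt p q"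
  obtains a' b' where "a' < b'" "\<And>x. a' < x \<Longrightarrow> x < b' \<Longrightarrow> a < x \<and> x < b"
    "\<forall>u v. a' < u \<and> u < v \<and> v < b' \<longrightarrow> mono_rel lt G u v"
proof -
  let ?Y = "{y. \<exists>x. a < x \<and> x < b \<and> G x y}"
  have "tame ?Y" by (intro tame1 D_pintros D_rel2[OF G])
  moreover have "infinite ?Y"
  proof
    assume fin: "finite ?Y"
    obtain f where f: "\<And>x. a < x \<Longrightarrow> x < b \<Longrightarrow> G x (f x)" using total by metis
    have "inj_on f {a<..<b}"
    proof (rule inj_onI)
      fix x y assume "x \<in> {a<..<b}" "y \<in> {a<..<b}" "f x = f y"
      then show "x = y"
        using mono[of x y "f x" "f y"] mono[of y x "f y" "f x"] f[of x] f[of y] lt_irrefl[OF lt, of "f y"]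
        by (cases x y rule: linorder_cases) simp_all
    qed
    moreover have "f ` {a<..<b} \<subseteq> ?Y" using f by auto
    ultimately show False using fin finite_imageD finite_subset infinite_Ioo[OF \<open>a < b\<close>] by blast
  qed
  ultimately obtain r s where "r < s" and Y: "\<And>y. r < y \<Longrightarrow> y < s \<Longrightarrow> \<exists>x. a < x \<and> x < b \<and> G x y"
    using tame_infinite_interval[of ?Y] by auto
  obtain p where p: "r < p" "p < s" using dense[OF \<open>r < s\<close>] by blast
  obtain q where q: "p < q" "q < s" using dense[OF p(2)] by blast
  \<comment> \<open>For decreasing \<open>G\<close> the preimage of the larger value comes first, so
    \<open>p\<close> and \<open>q\<close> exchange roles.\<close>
  have "\<exists>c d p q. a < c \<and> c < d \<and> d < b \<and> G c p \<and> G d q \<and>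
    (\<forall>z. lt p z \<and> lt z q \<longrightarrow> (\<exists>x. a < x \<and> x < b \<and> G x z))"
  proof -
    obtain c d where cd: "a < c" "c < b" "G c p" "a < d" "d < b" "G d q"
      using Y[OF p] Y[OF order.strict_trans[OF p(1) q(1)] q(2)] by blast
    have "c \<noteq> d" using cd functional q by blast
    have Yz: "\<exists>x. a < x \<and> x < b \<and> G x z" if "p < z" "z < q" for z
      using Y[of z] p q that by simp
    from lt consider "lt = (<)" | "lt = (>)" unfolding orientation_def by blast
    then show ?thesis
    proof cases
      case 1
      have "c < d"
        using mono[of d c q p] cd q 1 \<open>c \<noteq> d\<close> by (cases c d rule: linorder_cases) auto
      then show ?thesis using cd Yz 1 by blast
    next
      case 2
      have "d < c"
        using mono[of c d p q] cd q 2 \<open>c \<noteq> d\<close> by (cases c d rule: linorder_cases) auto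
      then show ?thesis using cd Yz 2 by blast
    qed
  qed
  then obtain c d p q where cd: "a < c" "c < d" "d < b" "G c p" "G d q"
    and onto: "\<And>z. lt p z \<Longrightarrow> lt z q \<Longrightarrow> \<exists>x. a < x \<and> x < b \<and> G x z"
    by blast
  have "mono_rel lt G u v" if uv: "c < u" "u < v" "v < d" for u v
  proof -
    have "a < u" "v < b" "u < b" "a < v" using uv cd by (meson order.strict_trans)+
    then obtain p' q' where p'q': "G u p'" "G v q'" using total by blast
    have "lt p p'" "lt p' q'" "lt q' q"
      using mono[of c u] mono[of u v] mono[of v d] uv cd p'q' \<open>a < u\<close> \<open>v < b\<close> \<open>u < b\<close> \<open>a < v\<close> by blast+
    moreover have "\<exists>w. u < w \<and> w < v \<and> G w z" if z: "lt p' z" "lt z q'" for z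
    proof -
      have "lt p z" "lt z q" using z calculation lt_trans[OF lt] by blast+
      then obtain w where w: "a < w" "w < b" "G w z" using onto by blast
      have "\<not> lt z p'" "\<not> lt q' z" using z lt_trans[OF lt] lt_irrefl[OF lt] by blast+
      then have "w \<noteq> u" "\<not> w < u" "w \<noteq> v" "\<not> v < w"
        using mono[of w u z p'] mono[of v w q' z] w p'q' functional z lt_irrefl[OF lt] \<open>u < b\<close> \<open>a < v\<close>
        by blast+
      then show ?thesis using w by (metis linorder_cases)
    qed
    ultimately show ?thesis unfolding mono_rel_def using p'q' uv by blast
  qed
  moreover have "a < x \<and> x < b" if "c < x" "x < d" for x
    using that cd by (meson order.strict_trans)
  ultimately show ?thesis using that[OF \<open>c < d\<close>] by blast
qed

text \<open>The exceptional points form a definable set; if it is infinite, it contains an interval.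
  That interval has a subinterval of constancy or of injectivity, and in the injective case one of
  monotonicity with intermediate values; the points of these are not exceptional.\<close>

theorem monotonicity:
  "finite {x. (\<exists>y. G x y) \<and> \<not> (locally_rel (const_rel G) x \<or>
     locally_rel (mono_rel (<) G) x \<or> locally_rel (mono_rel (>) G) x)}" (is "finite {x. ?bad x}")
proof (rule ccontr)
  assume inf: "infinite {x. ?bad x}"
  note D_local = D_rel1[OF D1_locally_rel[OF D2_const_rel[OF G]]]
    D_rel1[OF D1_locally_rel[OF D2_mono_rel[OF G orientation_less]]]
    D_rel1[OF D1_locally_rel[OF D2_mono_rel[OF G orientation_greater]]]
  have "tame {x. ?bad x}" by (intro tame1 D_pintros D_local D_rel2[OF G])
  from tame_infinite_interval[OF this inf] obtain a b
    where "a < b" and bad: "\<And>x. a < x \<Longrightarrow> x < b \<Longrightarrow> ?bad x" by blast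
  have total: "\<And>x. a < x \<Longrightarrow> x < b \<Longrightarrow> \<exists>y. G x y" using bad by blast
  have no_subinterval: False
    if ab': "a' < b'" and sub: "\<And>x. a' < x \<Longrightarrow> x < b' \<Longrightarrow> a < x \<and> x < b"
      and Q: "Q \<in> {const_rel G, mono_rel (<) G, mono_rel (>) G}"
        "\<forall>u v. a' < u \<and> u < v \<and> v < b' \<longrightarrow> Q u v" for a' b' Q
  proof -
    obtain x where x: "a' < x" "x < b'" using dense[OF ab'] by blast
    then have "locally_rel Q x" using Q(2) unfolding locally_rel_def by blast
    then show False using bad[of x] sub[OF x] Q(1) by blast
  qed
  obtain a1 b1 where
    1: "a1 < b1" "\<And>x. a1 < x \<Longrightarrow> x < b1 \<Longrightarrow> a < x \<and> x < b" and
    "(\<exists>y. \<forall>x. a1 < x \<and> x < b1 \<longrightarrow> G x y) \<or>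
     (\<forall>x x' y. a1 < x \<and> x < b1 \<and> a1 < x' \<and> x' < b1 \<and> G x y \<and> G x' y \<longrightarrow> x = x')"
    by (rule const_or_inj_on_subinterval[OF \<open>a < b\<close>], use total in blast) (rule that)
  then consider (const) y where "\<And>x. a1 < x \<Longrightarrow> x < b1 \<Longrightarrow> G x y"
    | (inj) "\<And>x x' y. a1 < x \<Longrightarrow> x < b1 \<Longrightarrow> a1 < x' \<Longrightarrow> x' < b1 \<Longrightarrow> G x y \<Longrightarrow> G x' y \<Longrightarrow> x = x'"
    by metis
  then show False
  proof cases
    case const
    have "const_rel G u v" if "a1 < u" "u < v" "v < b1" for u v
      using const[of u] const[of v] that unfolding const_rel_def by (meson order.strict_trans)
    then show False using no_subinterval[OF 1, of "const_rel G"] by blast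
  next
    case inj
    \<comment> \<open>The order of the line, pulled back along an injective function, is a definable
      linear order on the interval.\<close>
    let ?r = "\<lambda>x y. \<exists>p q. G x p \<and> G y q \<and> p < q"
    have r: "D2 ?r" by (intro D_intros D_rel2[OF G])
    obtain a2 b2 where 2: "a2 < b2" "\<And>x. a2 < x \<Longrightarrow> x < b2 \<Longrightarrow> a1 < x \<and> x < b1"
      and "(\<forall>u v. a2 < u \<and> u < v \<and> v < b2 \<longrightarrow> ?r u v) \<or> (\<forall>u v. a2 < u \<and> u < v \<and> v < b2 \<longrightarrow> ?r v u)"
    proof (rule definable_order_monotone[OF 1(1) r])
      show "\<not> ?r x x" for x using functional by auto
      show "?r x z" if "?r x y" "?r y z" for x y z
        using that functional order.strict_trans by blast
      show "?r x y \<or> ?r y x" if xy: "a1 < x" "x < b1" "a1 < y" "y < b1" "x \<noteq> y" for x y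
      proof -
        obtain p q where "G x p" "G y q"
          using total[of x] total[of y] 1(2)[OF xy(1,2)] 1(2)[OF xy(3,4)] by blast
        then show ?thesis using inj[OF xy(1-4)] xy(5) by (metis linorder_cases)
      qed
    qed (rule that)
    then consider (inc) "\<forall>u v. a2 < u \<and> u < v \<and> v < b2 \<longrightarrow> ?r u v"
      | (dec) "\<forall>u v. a2 < u \<and> u < v \<and> v < b2 \<longrightarrow> ?r v u" by (elim disjE)
    then obtain lt where lt: "orientation lt"
      and mono: "\<And>u v p q. a2 < u \<Longrightarrow> u < v \<Longrightarrow> v < b2 \<Longrightarrow> G u p \<Longrightarrow> G v q \<Longrightarrow> lt p q"
    proof cases
      case inc
      have "p < q" if uv: "a2 < u" "u < v" "v < b2" and pq: "G u p" "G v q" for u v p q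
      proof -
        obtain p' q' where "G u p'" "G v q'" "p' < q'" using inc uv by blast
        then show ?thesis using functional[OF pq(1)] functional[OF pq(2)] by blast
      qed
      then show ?thesis by (intro that[OF orientation_less])
    next
      case dec
      have "q < p" if uv: "a2 < u" "u < v" "v < b2" and pq: "G u p" "G v q" for u v p q
      proof -
        obtain p' q' where "G u p'" "G v q'" "q' < p'" using dec uv by blast
        then show ?thesis using functional[OF pq(1)] functional[OF pq(2)] by blast
      qed
      then show ?thesis by (intro that[OF orientation_greater])
    qed
    have total2: "\<exists>y. G x y" if "a2 < x" "x < b2" for x using total 1(2) 2(2) that by blast
    obtain a3 b3 where
      3: "a3 < b3" "\<And>x. a3 < x \<Longrightarrow> x < b3 \<Longrightarrow> a2 < x \<and> x < b2"
      "\<forall>u v. a3 < u \<and> u < v \<and> v < b3 \<longrightarrow> mono_rel lt G u v"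
      by (rule mono_rel_on_subinterval[OF lt 2(1)], use total2 in blast, use mono in blast) (rule that)
    have "a < x \<and> x < b" if "a3 < x" "x < b3" for x using 1(2) 2(2) 3(2) that by blast
    moreover have "mono_rel lt G \<in> {const_rel G, mono_rel (<) G, mono_rel (>) G}"
      using lt unfolding orientation_def by auto
    ultimately show False using no_subinterval[OF 3(1) _ _ 3(3)] by blast
  qed
qed

end

end


section \<open>Definable cuts\<close>

text \<open>Where \<open>Y\<close> is bounded, definable completeness provides an endpoint, and the
  absence of extremal elements keeps it outside \<open>Y\<close>.\<close>

lemma tame_convex_open_interval:
  fixes Y :: "'r::unbounded_dense_linorder set"
  assumes "tame Y"
    and convex: "\<And>p q z. p \<in> Y \<Longrightarrow> q \<in> Y \<Longrightarrow> p < z \<Longrightarrow> z < q \<Longrightarrow> z \<in> Y"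
    and no_max: "\<And>p. p \<in> Y \<Longrightarrow> \<exists>q\<in>Y. p < q" and no_min: "\<And>p. p \<in> Y \<Longrightarrow> \<exists>q\<in>Y. q < p"
  shows "open_interval Y"
proof (cases "Y = {}")
  case True
  then have "Y = {undefined<..<undefined}" by simp
  then show ?thesis unfolding open_interval_def by blast
next
  case False
  then obtain y0 where y0: "y0 \<in> Y" by blast
  have upper: "(\<forall>t. \<exists>y\<in>Y. t < y) \<or> (\<exists>s. (\<forall>y\<in>Y. y < s) \<and> (\<forall>t<s. \<exists>y\<in>Y. t < y))"
  proof (rule disjCI)
    assume "\<not> (\<exists>s. (\<forall>y\<in>Y. y < s) \<and> (\<forall>t<s. \<exists>y\<in>Y. t < y))"
    show "\<forall>t. \<exists>y\<in>Y. t < y"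
    proof (rule ccontr)
      assume "\<not> (\<forall>t. \<exists>y\<in>Y. t < y)"
      then obtain b where "\<And>y. y \<in> Y \<Longrightarrow> \<not> b < y" by blast
      from tame_sup[OF orientation_less assms(1) y0 this] obtain s where
        s: "\<And>y. y \<in> Y \<Longrightarrow> \<not> s < y" "\<And>t. t < s \<Longrightarrow> \<exists>y\<in>Y. t < y" by blast
      have "y < s" if y: "y \<in> Y" for y
        using no_max[OF y] s(1) by (meson leI order.strict_trans2)
      then show False using s(2) \<open>\<not> (\<exists>s. _ s)\<close> by blast
    qed
  qed
  have lower: "(\<forall>t. \<exists>y\<in>Y. y < t) \<or> (\<exists>s. (\<forall>y\<in>Y. s < y) \<and> (\<forall>t>s. \<exists>y\<in>Y. y < t))"
  proof (rule disjCI)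
    assume "\<not> (\<exists>s. (\<forall>y\<in>Y. s < y) \<and> (\<forall>t>s. \<exists>y\<in>Y. y < t))"
    show "\<forall>t. \<exists>y\<in>Y. y < t"
    proof (rule ccontr)
      assume "\<not> (\<forall>t. \<exists>y\<in>Y. y < t)"
      then obtain b where "\<And>y. y \<in> Y \<Longrightarrow> \<not> y < b" by blast
      from tame_sup[OF orientation_greater assms(1) y0 this] obtain s where
        s: "\<And>y. y \<in> Y \<Longrightarrow> \<not> y < s" "\<And>t. s < t \<Longrightarrow> \<exists>y\<in>Y. y < t" by blast
      have "s < y" if y: "y \<in> Y" for y
        using no_min[OF y] s(1) by (meson leI order.strict_trans1)
      then show False using s(2) \<open>\<not> (\<exists>s. _ s)\<close> by blast
    qed
  qed
  have between: "z \<in> Y" if "\<exists>y\<in>Y. y < z" "\<exists>y\<in>Y. z < y" for z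
    using that convex by blast
  from upper lower show ?thesis
  proof (elim disjE exE conjE)
    assume "\<forall>t. \<exists>y\<in>Y. t < y" "\<forall>t. \<exists>y\<in>Y. y < t"
    then have "Y = UNIV" using between by blast
    then show ?thesis by (simp add: open_interval_def)
  next
    fix a assume "\<forall>t. \<exists>y\<in>Y. t < y" "\<forall>y\<in>Y. a < y" "\<forall>t>a. \<exists>y\<in>Y. y < t"
    then have "Y = {a<..}" using between unfolding set_eq_iff greaterThan_iff by blast
    then show ?thesis unfolding open_interval_def by blast
  next
    fix b assume "\<forall>t. \<exists>y\<in>Y. y < t" "\<forall>y\<in>Y. y < b" "\<forall>t<b. \<exists>y\<in>Y. t < y"
    then have "Y = {..<b}" using between unfolding set_eq_iff lessThan_iff by blast
    then show ?thesis unfolding open_interval_def by blast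
  next
    fix a b assume "\<forall>y\<in>Y. y < b" "\<forall>t<b. \<exists>y\<in>Y. t < y" "\<forall>y\<in>Y. a < y" "\<forall>t>a. \<exists>y\<in>Y. y < t"
    then have "Y = {a<..<b}" using between unfolding set_eq_iff greaterThanLessThan_iff by blast
    then show ?thesis unfolding open_interval_def by blast
  qed
qed

section \<open>Open intervals and the cells cut out by finitely many points\<close>

lemma open_interval_cases:
  assumes "open_interval I"
  obtains a b where "I = {a<..<b}" | a where "I = {a<..}" | b where "I = {..<b}" | "I = UNIV"
  using assms unfolding open_interval_def by blast

lemma open_interval_convex:
  "open_interval I \<Longrightarrow> u \<in> I \<Longrightarrow> v \<in> I \<Longrightarrow> u \<le> x \<Longrightarrow> x \<le> v \<Longrightarrow> x \<in> I"
  by (erule open_interval_cases) auto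

lemma open_interval_no_max:
  fixes u :: "'r::unbounded_dense_linorder"
  assumes "open_interval I" "u \<in> I"
  shows "\<exists>v\<in>I. u < v"
  using assms(1)
proof (cases rule: open_interval_cases)
  case (1 a b)
  then show ?thesis using assms(2) dense[of u b] by (metis greaterThanLessThan_iff order.strict_trans)
next
  case (2 a)
  then show ?thesis using assms(2) gt_ex[of u] by (metis greaterThan_iff order.strict_trans)
next
  case (3 b)
  then show ?thesis using assms(2) dense[of u b] by (metis lessThan_iff)
qed (use gt_ex[of u] in simp)

lemma open_interval_no_min:
  fixes u :: "'r::unbounded_dense_linorder"
  assumes "open_interval I" "u \<in> I"
  shows "\<exists>v\<in>I. v < u"
  using assms(1)
proof (cases rule: open_interval_cases)
  case (1 a b)
  then show ?thesis using assms(2) dense[of a u] by (metis greaterThanLessThan_iff order.strict_trans)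
next
  case (2 a)
  then show ?thesis using assms(2) dense[of a u] by (metis greaterThan_iff)
next
  case (3 b)
  then show ?thesis using assms(2) lt_ex[of u] by (metis lessThan_iff order.strict_trans)
qed (use lt_ex[of u] in simp)

text \<open>The cell of \<open>x\<close> among the points of \<open>E\<close>. It is phrased through
  the truth values of \<open>y = e\<close> and \<open>y < e\<close> because exactly these can be
  recorded in the auxiliary sort.\<close>

definition component :: "'r::linorder set \<Rightarrow> 'r \<Rightarrow> 'r set" where
  "component E x = {y. \<forall>e\<in>E. (y = e \<longleftrightarrow> x = e) \<and> (y < e \<longleftrightarrow> x < e)}"

lemma component_self: "x \<in> component E x"
  by (simp add: component_def)

lemma component_point: "x \<in> E \<Longrightarrow> component E x = {x}"
  by (auto simp: component_def)

lemma component_disjoint: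
  assumes "x \<notin> E"
  shows "component E x \<inter> E = {}"
proof -
  have False if "e \<in> component E x" "e \<in> E" for e
  proof -
    from that have "(e = e \<longleftrightarrow> x = e) \<and> (e < e \<longleftrightarrow> x < e)"
      unfolding component_def mem_Collect_eq by (rule bspec)
    then show False using that(2) assms by simp
  qed
  then show ?thesis by blast
qed

lemma component_interval:
  assumes "finite E" "x \<notin> E"
  shows "open_interval (component E x)"
  using assms
proof (induction E rule: finite_induct)
  case empty
  then show ?case by (simp add: component_def open_interval_def)
next
  case (insert e E)
  have *: "component (insert e E) x = component E x \<inter> (if x < e then {..<e} else {e<..})"
    using insert.prems by (auto simp: component_def)
  have "open_interval (I \<inter> {..<e})" "open_interval (I \<inter> {e<..})" if "open_interval I" for I
  proof -
    have "{a<..<b} \<inter> {..<e} = {a<..<min b e}" "{a<..<b} \<inter> {e<..} = {max a e<..<b}"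
      "{a<..} \<inter> {..<e} = {a<..<e}" "{a<..} \<inter> {e<..} = {max a e<..}"
      "{..<b} \<inter> {..<e} = {..<min b e}" "{..<b} \<inter> {e<..} = {e<..<b}" for a b
      by auto
    then show "open_interval (I \<inter> {..<e})" "open_interval (I \<inter> {e<..})"
      using that unfolding open_interval_def by (metis Int_UNIV_left)+
  qed
  then show ?case using insert unfolding * by auto
qed

text \<open>A cell meets \<open>E\<close> only if it is the singleton of a point of
  \<open>E\<close>, and the line has more than one point.\<close>

lemma component_not_UNIV:
  fixes x :: "'r::unbounded_dense_linorder"
  assumes "E \<noteq> {}"
  shows "component E x \<noteq> UNIV"
proof
  assume UNIV: "component E x = UNIV"
  obtain c where c: "c \<in> E" using assms by blast
  then have "c = x" using UNIV by (auto simp: component_def)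
  then have "{x} = UNIV" using UNIV component_point c by blast
  then show False using gt_ex[of x] by (metis UNIV_I less_irrefl singletonD)
qed

context o_min_preds
begin

lemma D1_open_interval:
  assumes "open_interval I"
  shows "D1 (\<lambda>x. x \<in> I)"
  using assms
proof (cases rule: open_interval_cases)
  case (1 a b)
  show ?thesis unfolding 1 greaterThanLessThan_iff by (intro D_pintros)
next
  case (2 a)
  show ?thesis unfolding 2 greaterThan_iff by (intro D_pintros)
next
  case (3 b)
  show ?thesis unfolding 3 lessThan_iff by (intro D_pintros)
next
  case 4
  then show ?thesis using D_const[of True] by simp
qed

text \<open>Absence of boundary points spreads the local property from \<open>x\<close> over
  \<open>J\<close>; transitivity then extends it to arbitrary pairs of points of
  \<open>J\<close>.\<close>

lemma locally_to_globally:
  assumes Q: "D2 Q" "\<And>x y z. Q x y \<Longrightarrow> Q y z \<Longrightarrow> Q x z"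
    and J: "open_interval J" "\<And>x. x \<in> J \<Longrightarrow> \<not> bdry (locally_rel Q) x"
    and x: "x \<in> J" "locally_rel Q x" and uv: "u \<in> J" "v \<in> J" "u < v"
  shows "Q u v"
proof -
  have loc: "locally_rel Q y" if y: "y \<in> J" for y
  proof (cases "x \<le> y")
    case True
    then show ?thesis
      using constant_off_bdry[OF D1_locally_rel[OF Q(1)] _ True] J open_interval_convex[OF J(1) x(1) y] x(2)
      by blast
  next
    case False
    then have "y \<le> x" by simp
    then show ?thesis
      using constant_off_bdry[OF D1_locally_rel[OF Q(1)] _ \<open>y \<le> x\<close>] J open_interval_convex[OF J(1) y x(1)] x(2)
      by blast
  qed
  show ?thesis
  proof (rule local_global[OF Q(1)])
    fix y assume "u \<le> y" "y \<le> v"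
    then have "locally_rel Q y" using loc open_interval_convex[OF J(1) uv(1,2)] by blast
    then obtain a b where ab: "a < y" "y < b" "\<And>s t. a < s \<Longrightarrow> s < t \<Longrightarrow> t < b \<Longrightarrow> Q s t"
      unfolding locally_rel_def by blast
    show "all_before (<) (\<lambda>z. Q z y) y" "all_before (>) (\<lambda>z. Q y z) y"
      unfolding all_before_def using ab by blast+
  qed (use Q(2) uv(3) in blast)+
qed

text \<open>Intermediate values make the image convex, and since \<open>J\<close> has no extremal
  points, strict monotonicity leaves the image without extremal values.\<close>

lemma image_mono_rel:
  assumes "D2 G" "functional G" and lt: "orientation lt"
    and J: "open_interval J" and mono: "\<And>u v. u \<in> J \<Longrightarrow> v \<in> J \<Longrightarrow> u < v \<Longrightarrow> mono_rel lt G u v"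
  shows "open_interval {y. \<exists>x\<in>J. G x y}"
proof (rule tame_convex_open_interval)
  show "tame {y. \<exists>x\<in>J. G x y}"
    unfolding Bex_def by (intro tame1 D_pintros D_rel2[OF assms(1)] D_rel1[OF D1_open_interval[OF J]])
next
  fix p
  assume "p \<in> {y. \<exists>x\<in>J. G x y}"
  then obtain u where u: "u \<in> J" "G u p" by blast
  obtain v w where "v \<in> J" "u < v" "w \<in> J" "w < u"
    using open_interval_no_max[OF J u(1)] open_interval_no_min[OF J u(1)] by blast
  then have "mono_rel lt G u v" "mono_rel lt G w u" using mono u by blast+
  then obtain q r where "G v q" "lt p q" "G w r" "lt r p"
    using u(2) functionalD[OF assms(2)] unfolding mono_rel_def by metis
  then show "\<exists>q\<in>{y. \<exists>x\<in>J. G x y}. p < q" "\<exists>q\<in>{y. \<exists>x\<in>J. G x y}. q < p"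
    using lt \<open>v \<in> J\<close> \<open>w \<in> J\<close> unfolding orientation_def by blast+
next
  have between: "\<exists>x\<in>J. G x z"
    if uv: "u \<in> J" "v \<in> J" "G u p" "G v q" and z: "lt p z" "lt z q" for u v p q z
  proof -
    have pq: "lt p q" using lt_trans[OF lt] z by blast
    then have "u \<noteq> v" using functionalD[OF assms(2)] uv lt_irrefl[OF lt] by blast
    moreover have "\<not> v < u"
    proof
      assume "v < u"
      then have "lt q p" using mono[OF uv(2,1)] uv(3,4) functionalD[OF assms(2)] unfolding mono_rel_def by metis
      then show False using pq lt_trans[OF lt] lt_irrefl[OF lt] by blast
    qed
    ultimately have "u < v" by simp
    from mono[OF uv(1,2) this] obtain w where "u < w" "w < v" "G w z"
      using uv(3,4) functionalD[OF assms(2)] z unfolding mono_rel_def by metis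
    then show ?thesis using open_interval_convex[OF J uv(1,2), of w] by auto
  qed
  fix p q z
  assume "p \<in> {y. \<exists>x\<in>J. G x y}" "q \<in> {y. \<exists>x\<in>J. G x y}" "p < z" "z < q"
  then show "z \<in> {y. \<exists>x\<in>J. G x y}"
    using between[of _ _ p q z] between[of _ _ q p z] lt unfolding orientation_def by auto
qed

end

text \<open>\<open>D\<close> admits all points as parameters and supplies tameness, hence
  finiteness; \<open>DA\<close> stands for definability over the given parameters, in which the cut
  points must be found.\<close>

locale o_min_over = o_min_preds D + A: definable_preds DA
  for D DA :: "((nat \<Rightarrow> 'r::unbounded_dense_linorder) \<Rightarrow> bool) \<Rightarrow> bool" +
  assumes DA_D: "DA P \<Longrightarrow> D P"
begin

text \<open>The second clause serves (b3), the third and fourth preservation of balls. The flag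
  \<open>b\<close> is set when cut points are available; images must then avoid the whole line,
  which need not be a ball.\<close>

definition tame_on :: "('r \<Rightarrow> 'r \<Rightarrow> bool) \<Rightarrow> bool \<Rightarrow> 'r set \<Rightarrow> bool" where
  "tame_on G b J \<longleftrightarrow>
     (\<forall>x\<in>J. \<exists>y. G x y) \<and>
     ((\<exists>y. \<forall>x\<in>J. G x y) \<or> (\<forall>x\<in>J. \<forall>x'\<in>J. \<forall>y. G x y \<and> G x' y \<longrightarrow> x = x')) \<and>
     ((\<exists>p. {y. \<exists>x\<in>J. G x y} = {p}) \<or> open_interval {y. \<exists>x\<in>J. G x y}) \<and>
     (b \<longrightarrow> {y. \<exists>x\<in>J. G x y} \<noteq> UNIV)"

text \<open>\<open>E\<close> collects the cut points \<open>C\<close>, the exceptional points of the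
  monotonicity theorem, and the boundaries of finitely many sets: the domain, the places of each
  local behaviour, and the places where the value lies below a point of \<open>C\<close>. All of
  these are finite, and their points are definable over the given parameters.\<close>

lemma definable_pieces:
  assumes G: "A.D2 G" "functional G"
    and C: "finite C" "\<forall>c\<in>C. A.definable_pt c"
  shows "\<exists>E. finite E \<and> C \<subseteq> E \<and> (\<forall>e\<in>E. A.definable_pt e) \<and>
    (\<forall>J x y. open_interval J \<longrightarrow> J \<inter> E = {} \<longrightarrow> x \<in> J \<longrightarrow> G x y \<longrightarrow> tame_on G (C \<noteq> {}) J)"
proof -
  note G' = DA_D[OF G(1)]
  let ?dom = "\<lambda>x. \<exists>y. G x y"
  let ?Q = "[const_rel G, mono_rel (<) G, mono_rel (>) G]"
  let ?bad = "\<lambda>x. ?dom x \<and> \<not> (locally_rel (const_rel G) x \<or>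
     locally_rel (mono_rel (<) G) x \<or> locally_rel (mono_rel (>) G) x)"
  let ?below = "\<lambda>c x. \<exists>y. G x y \<and> y < c"
  define Us where "Us = {?dom} \<union> locally_rel ` set ?Q \<union> ?below ` C"
  have Q: "A.D2 Q" if "Q \<in> set ?Q" for Q
    using that A.D2_const_rel[OF G(1)] A.D2_mono_rel[OF G(1) orientation_less]
      A.D2_mono_rel[OF G(1) orientation_greater] by auto
  have Q_trans: "Q x z" if "Q \<in> set ?Q" "Q x y" "Q y z" for Q x y z
  proof -
    from that(1) consider "Q = const_rel G" | lt where "orientation lt" "Q = mono_rel lt G"
      using orientation_less orientation_greater by (metis empty_iff empty_set list.set_intros set_ConsD)
    then show ?thesis
    proof cases
      case 1
      then show ?thesis using const_rel_trans[OF G' G(2)] that(2,3) by blast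
    next
      case 2
      then show ?thesis using mono_rel_trans[OF G' G(2) 2(1)] that(2,3) by blast
    qed
  qed
  have Us: "A.D1 U" if "U \<in> Us" for U
  proof -
    have dom: "A.D1 ?dom" by (intro A.D_intros A.D_rel2[OF G(1)])
    have below: "A.D1 (?below c)" if "c \<in> C" for c
      by (intro A.D_intros A.D_rel2[OF G(1)] A.trm_const[OF C(2)[rule_format, OF that]])
    from that consider "U = ?dom" | Q where "Q \<in> set ?Q" "U = locally_rel Q" | c where "c \<in> C" "U = ?below c"
      unfolding Us_def by blast
    then show ?thesis
    proof cases
      case 2
      then show ?thesis using A.D1_locally_rel[OF Q[OF 2(1)]] by simp
    qed (use dom below in blast)+
  qed
  have bad: "finite {x. ?bad x}"
    by (rule monotonicity[OF G' G(2)])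
  have bad_pt: "A.definable_pt e" if "?bad e" for e
  proof (rule A.finite_definable_pts[OF bad _ that])
    show "A.D1 ?bad"
      using Us Us_def by (intro A.D_conj A.D_neg A.D_disj) auto
  qed
  define E where "E = C \<union> (\<Union>U\<in>Us. {x. bdry U x}) \<union> {x. ?bad x}"
  have "finite Us" using C by (simp add: Us_def)
  have bdry: "finite {x. bdry U x}" if "U \<in> Us" for U
    using finite_bdry[OF DA_D[OF Us[OF that]]] .
  with \<open>finite Us\<close> have "finite E"
    unfolding E_def using bad C by auto
  moreover have "C \<subseteq> E" by (auto simp: E_def)
  moreover have "A.definable_pt e" if e: "e \<in> E" for e
  proof -
    from e consider "e \<in> C" | U where "U \<in> Us" "bdry U e" | "?bad e" unfolding E_def by blast
    then show ?thesis
    proof cases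
      case 2
      then show ?thesis
        using A.finite_definable_pts[OF bdry[OF 2(1)] A.D1_bdry[OF Us[OF 2(1)]]] by blast
    qed (use C bad_pt in blast)+
  qed
  moreover have "tame_on G (C \<noteq> {}) J"
    if J: "open_interval J" "J \<inter> E = {}" and xy: "x \<in> J" "G x y" for J x y
  proof -
    have nb: "\<not> bdry U z" if "U \<in> Us" "z \<in> J" for U z
      using J(2) that unfolding E_def by blast
    have const: "U u \<longleftrightarrow> U v" if "U \<in> Us" "u \<in> J" "v \<in> J" for U u v
    proof (cases "u \<le> v")
      case True
      then show ?thesis
        using constant_off_bdry[OF DA_D[OF Us[OF that(1)]] _ True] nb[OF that(1)]
          open_interval_convex[OF J(1) that(2,3)] by blast
    next
      case False
      then have "v \<le> u" by simp
      then show ?thesis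
        using constant_off_bdry[OF DA_D[OF Us[OF that(1)]] _ \<open>v \<le> u\<close>] nb[OF that(1)]
          open_interval_convex[OF J(1) that(3,2)] by blast
    qed
    have dom: "?dom z" if "z \<in> J" for z
      using const[of ?dom z x] xy that unfolding Us_def by blast
    have "\<not> ?bad x" using J(2) xy(1) unfolding E_def by blast
    then obtain Q where Q': "Q \<in> set ?Q" "locally_rel Q x" using xy(2) by auto
    have "locally_rel Q \<in> Us" using Q' by (auto simp: Us_def)
    have QJ: "Q u v" if "u \<in> J" "v \<in> J" "u < v" for u v
      by (rule locally_to_globally[OF DA_D[OF Q[OF Q'(1)]] Q_trans[OF Q'(1)] J(1) nb[OF \<open>locally_rel Q \<in> Us\<close>]
            xy(1) Q'(2) that])
    let ?Y = "{y. \<exists>x\<in>J. G x y}"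
    \<comment> \<open>Taking all values would mean taking \<open>c\<close> and also a value below
      \<open>c\<close>, whereas \<open>?below c\<close> has a constant truth value on
      \<open>J\<close>.\<close>
    have notUNIV: "?Y \<noteq> UNIV" if Cne: "C \<noteq> {}"
    proof
      assume UNIV: "?Y = UNIV"
      obtain c where c: "c \<in> C" using Cne by blast
      obtain c' where "c' < c" using lt_ex by blast
      obtain u where u: "u \<in> J" "G u c'" using UNIV by blast
      obtain v where v: "v \<in> J" "G v c" using UNIV by blast
      have "?below c u" using u \<open>c' < c\<close> by blast
      moreover have "\<not> ?below c v" using v functionalD[OF G(2)] by blast
      ultimately show False using const[of "?below c" u v] u v c unfolding Us_def by blast
    qed
    from Q'(1) consider "Q = const_rel G" | lt where "orientation lt" "Q = mono_rel lt G"
      using orientation_less orientation_greater by (metis empty_iff empty_set list.set_intros set_ConsD)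
    then show ?thesis
    proof cases
      case 1
      have "G u y" if "u \<in> J" for u
        using QJ[of u x] QJ[of x u] xy that functionalD[OF G(2)] unfolding 1 const_rel_def
        by (cases u x rule: linorder_cases) blast+
      then have "\<forall>u\<in>J. G u y" "?Y = {y}" using xy functionalD[OF G(2)] by blast+
      then show ?thesis using dom notUNIV unfolding tame_on_def by blast
    next
      case 2
      have "u = v" if uv: "u \<in> J" "v \<in> J" "G u z" "G v z" for u v z
      proof (rule ccontr)
        assume "u \<noteq> v"
        then have "mono_rel lt G u v \<or> mono_rel lt G v u" using QJ uv 2 by (metis linorder_neqE)
        then have "lt z z" using uv(3,4) functionalD[OF G(2)] unfolding mono_rel_def by metis
        then show False using lt_irrefl[OF 2(1)] by blast
      qed
      moreover have "open_interval ?Y"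
        using image_mono_rel[OF G' G(2) 2(1) J(1)] QJ 2(2) by blast
      ultimately show ?thesis using dom notUNIV unfolding tame_on_def by blast
    qed
  qed
  ultimately show ?thesis by blast
qed

text \<open>A nonempty proper subset of the line has a boundary point by connectedness; the boundary
  is finite and definable over the same parameters, so each of its points is definable.\<close>

lemma definable_pt_of_proper:
  assumes "A.D1 P" "P u" "\<not> P v"
  shows "\<exists>c. A.definable_pt c"
proof -
  have "\<exists>c. bdry P c"
    using constant_off_bdry[OF DA_D[OF assms(1)], of u v] constant_off_bdry[OF DA_D[OF assms(1)], of v u]
      assms(2,3) by (metis linorder_linear)
  then show ?thesis
    using A.finite_definable_pts[OF finite_bdry[OF DA_D[OF assms(1)]] A.D1_bdry[OF assms(1)]] by blast
qed

end


section \<open>Substitution and definable predicates of a structure\<close>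

primrec subst_trm :: "(nat \<Rightarrow> ('f, 'u) trm) \<Rightarrow> ('f, 'u) trm \<Rightarrow> ('f, 'u) trm" where
  "subst_trm \<sigma> (Var i) = \<sigma> i"
| "subst_trm \<sigma> (Par a) = Par a"
| "subst_trm \<sigma> (App f ts) = App f (map (subst_trm \<sigma>) ts)"

definition lift :: "(nat \<Rightarrow> ('f, 'u) trm) \<Rightarrow> nat \<Rightarrow> ('f, 'u) trm" where
  "lift \<sigma> = case_nat (Var 0) (\<lambda>i. subst_trm (\<lambda>j. Var (Suc j)) (\<sigma> i))"

primrec subst_fm :: "('s, 'f, 'p, 'u) fm \<Rightarrow> (nat \<Rightarrow> ('f, 'u) trm) \<Rightarrow> ('s, 'f, 'p, 'u) fm" where
  "subst_fm (Eq t u) \<sigma> = Eq (subst_trm \<sigma> t) (subst_trm \<sigma> u)"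
| "subst_fm (Rel p ts) \<sigma> = Rel p (map (subst_trm \<sigma>) ts)"
| "subst_fm (Neg \<phi>) \<sigma> = Neg (subst_fm \<phi> \<sigma>)"
| "subst_fm (Conj \<phi> \<psi>) \<sigma> = Conj (subst_fm \<phi> \<sigma>) (subst_fm \<psi> \<sigma>)"
| "subst_fm (Ex s \<phi>) \<sigma> = Ex s (subst_fm \<phi> (lift \<sigma>))"

lemma has_sort_subst:
  assumes "has_sort S A ss t s" "\<And>i. i < length ss \<Longrightarrow> has_sort S A ss' (\<sigma> i) (ss ! i)"
  shows "has_sort S A ss' (subst_trm \<sigma> t) s"
  using assms(1)
proof (induction rule: has_sort.induct)
  case (has_sort_App f ts)
  then show ?case
    by (auto intro!: has_sort.has_sort_App simp: list_all2_conv_all_nth)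
qed (use assms(2) in \<open>auto intro: has_sort.intros\<close>)

lemma trm_val_subst:
  assumes "has_sort S A ss t s" "\<And>i. i < length ss \<Longrightarrow> trm_val S us' (\<sigma> i) = us ! i"
  shows "trm_val S us' (subst_trm \<sigma> t) = trm_val S us t"
  using assms(1)
proof (induction rule: has_sort.induct)
  case (has_sort_App f ts)
  then have "map (trm_val S us' \<circ> subst_trm \<sigma>) ts = map (trm_val S us) ts"
    by (intro nth_equalityI) (simp_all add: list_all2_conv_all_nth)
  then show ?case by (simp only: subst_trm.simps trm_val.simps map_map)
qed (use assms(2) in auto)

lemma trm_val_shift: "trm_val S (u # us) (subst_trm (\<lambda>j. Var (Suc j)) t) = trm_val S us t"
  by (induction t) (auto cong: map_cong)

lemma wf_fm_subst:
  "wf_fm S A ss \<phi> \<Longrightarrow> (\<And>i. i < length ss \<Longrightarrow> has_sort S A ss' (\<sigma> i) (ss ! i)) \<Longrightarrow>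
    wf_fm S A ss' (subst_fm \<phi> \<sigma>)"
proof (induction \<phi> arbitrary: ss ss' \<sigma>)
  case (Eq t u)
  then show ?case using has_sort_subst[of S A ss _ _ ss' \<sigma>] by auto
next
  case (Rel p ts)
  then show ?case using has_sort_subst[of S A ss _ _ ss' \<sigma>] by (auto simp: list_all2_conv_all_nth)
next
  case (Ex s \<phi>)
  have "has_sort S A (s # ss') (lift \<sigma> i) ((s # ss) ! i)" if "i < length (s # ss)" for i
  proof (cases i)
    case 0
    then show ?thesis using has_sort_Var[of 0 "s # ss'"] by (simp add: lift_def)
  next
    case (Suc j)
    have "has_sort S A (s # ss') (Var (Suc k)) (ss' ! k)" if "k < length ss'" for k
      using has_sort_Var[of "Suc k" "s # ss'"] that by simp
    then show ?thesis
      using Suc that Ex.prems(2)[of j] has_sort_subst[of S A ss' "\<sigma> j" "ss ! j" "s # ss'"]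
      by (simp add: lift_def)
  qed
  then show ?case using Ex.IH[of "s # ss"] Ex.prems by simp
qed auto

lemma sat_subst:
  "wf_fm S A ss \<phi> \<Longrightarrow> (\<And>i. i < length ss \<Longrightarrow> trm_val S us' (\<sigma> i) = us ! i) \<Longrightarrow>
    sat S us' (subst_fm \<phi> \<sigma>) \<longleftrightarrow> sat S us \<phi>"
proof (induction \<phi> arbitrary: ss us us' \<sigma>)
  case (Eq t u)
  then show ?case using trm_val_subst[of S A ss _ _ us' \<sigma> us] by auto
next
  case (Rel p ts)
  then have "map (trm_val S us' \<circ> subst_trm \<sigma>) ts = map (trm_val S us) ts"
    using trm_val_subst[of S A ss _ _ us' \<sigma> us]
    by (intro nth_equalityI) (auto simp: list_all2_conv_all_nth)
  then show ?case by (simp only: subst_fm.simps sat.simps map_map)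
next
  case (Ex s \<phi>)
  have "trm_val S (u # us') (lift \<sigma> i) = (u # us) ! i" if "i < length (s # ss)" for i u
    using that Ex.prems(2) by (cases i) (auto simp: lift_def trm_val_shift)
  then show ?case using Ex.IH[of "s # ss"] Ex.prems(1) by simp
next
  case (Neg \<phi>)
  then show ?case using Neg.IH[of ss] by simp
next
  case (Conj \<phi> \<psi>)
  then show ?case using Conj.IH[of ss] by simp
qed

section \<open>Predicates on assignments that formulas define\<close>

definition env :: "('r \<Rightarrow> 'u) \<Rightarrow> nat \<Rightarrow> (nat \<Rightarrow> 'r) \<Rightarrow> 'u list" where
  "env \<iota> n \<rho> = map (\<lambda>i. \<iota> (\<rho> i)) [0..<n]"

lemma length_env [simp]: "length (env \<iota> n \<rho>) = n"
  and nth_env [simp]: "i < n \<Longrightarrow> env \<iota> n \<rho> ! i = \<iota> (\<rho> i)"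
  by (simp_all add: env_def)

lemma env_Suc: "env \<iota> (Suc n) \<rho> = \<iota> (\<rho> 0) # env \<iota> n (\<lambda>i. \<rho> (Suc i))"
  unfolding env_def by (rule map_upt_Suc)

lemma env_0: "env \<iota> 0 \<rho> = []"
  by (simp add: env_def)

definition definable_at ::
  "('s, 'f, 'p, 'u, 'z) fo_structure_scheme \<Rightarrow> 's \<Rightarrow> ('r \<Rightarrow> 'u) \<Rightarrow> 'u set \<Rightarrow> nat
     \<Rightarrow> ((nat \<Rightarrow> 'r) \<Rightarrow> bool) \<Rightarrow> bool" where
  "definable_at S m \<iota> A n P \<longleftrightarrow>
     (\<exists>\<phi>. wf_fm S A (replicate n m) \<phi> \<and> (\<forall>\<rho>. P \<rho> \<longleftrightarrow> sat S (env \<iota> n \<rho>) \<phi>))"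

text \<open>The number of variables is forgotten so that predicates combine freely; a formula may
  always be read with further variables. The map \<open>\<iota>\<close> embeds the line in the
  universe: the identity for \<open>R\<close>, \<open>Inl\<close> for its expansion.\<close>

definition definable_pred ::
  "('s, 'f, 'p, 'u, 'z) fo_structure_scheme \<Rightarrow> 's \<Rightarrow> ('r \<Rightarrow> 'u) \<Rightarrow> 'u set
     \<Rightarrow> ((nat \<Rightarrow> 'r) \<Rightarrow> bool) \<Rightarrow> bool" where
  "definable_pred S m \<iota> A P \<longleftrightarrow> (\<exists>n. definable_at S m \<iota> A n P)"

lemma definable_at_rename:
  assumes "definable_at S m \<iota> A n P" "\<And>i. i < n \<Longrightarrow> \<sigma> i < k"
  shows "definable_at S m \<iota> A k (\<lambda>\<rho>. P (\<lambda>i. \<rho> (\<sigma> i)))"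
proof -
  obtain \<phi> where \<phi>: "wf_fm S A (replicate n m) \<phi>" "\<And>\<rho>. P \<rho> \<longleftrightarrow> sat S (env \<iota> n \<rho>) \<phi>"
    using assms(1) unfolding definable_at_def by blast
  let ?\<psi> = "subst_fm \<phi> (\<lambda>i. Var (\<sigma> i))"
  have "has_sort S A (replicate k m) (Var (\<sigma> i)) m" if "i < n" for i
    using has_sort_Var[of "\<sigma> i" "replicate k m"] assms(2)[OF that] by simp
  then have "wf_fm S A (replicate k m) ?\<psi>"
    by (intro wf_fm_subst[OF \<phi>(1)]) simp
  moreover have "P (\<lambda>i. \<rho> (\<sigma> i)) \<longleftrightarrow> sat S (env \<iota> k \<rho>) ?\<psi>" for \<rho>
    unfolding \<phi>(2) by (rule sat_subst[OF \<phi>(1), symmetric]) (simp add: assms(2))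
  ultimately show ?thesis unfolding definable_at_def by blast
qed

lemma definable_at_mono: "definable_at S m \<iota> A n P \<Longrightarrow> n \<le> k \<Longrightarrow> definable_at S m \<iota> A k P"
  using definable_at_rename[of S m \<iota> A n P "\<lambda>i. i" k] by simp

lemma definable_pred_rename:
  assumes "definable_pred S m \<iota> A P"
  shows "definable_pred S m \<iota> A (\<lambda>\<rho>. P (\<lambda>i. \<rho> (\<sigma> i)))"
proof -
  obtain n where "definable_at S m \<iota> A n P" using assms unfolding definable_pred_def by blast
  \<comment> \<open>The bound exceeds every index that \<open>\<sigma>\<close> takes below
    \<open>n\<close>; for \<open>n = 0\<close> the maximum is unspecified and the condition on the
    indices is vacuous.\<close>
  then have "definable_at S m \<iota> A (Suc (Max (\<sigma> ` {..<n}))) (\<lambda>\<rho>. P (\<lambda>i. \<rho> (\<sigma> i)))"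
    by (rule definable_at_rename) (simp add: le_imp_less_Suc)
  then show ?thesis unfolding definable_pred_def by blast
qed

lemma definable_pred_neg:
  "definable_pred S m \<iota> A P \<Longrightarrow> definable_pred S m \<iota> A (\<lambda>\<rho>. \<not> P \<rho>)"
  unfolding definable_pred_def definable_at_def by (metis sat.simps(3) wf_fm.simps(3))

lemma definable_pred_conj:
  assumes "definable_pred S m \<iota> A P" "definable_pred S m \<iota> A Q"
  shows "definable_pred S m \<iota> A (\<lambda>\<rho>. P \<rho> \<and> Q \<rho>)"
proof -
  obtain n k where "definable_at S m \<iota> A n P" "definable_at S m \<iota> A k Q"
    using assms unfolding definable_pred_def by blast
  then have "definable_at S m \<iota> A (max n k) P" "definable_at S m \<iota> A (max n k) Q"
    by (auto intro: definable_at_mono)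
  then have "definable_at S m \<iota> A (max n k) (\<lambda>\<rho>. P \<rho> \<and> Q \<rho>)"
    unfolding definable_at_def by (metis sat.simps(4) wf_fm.simps(4))
  then show ?thesis unfolding definable_pred_def by blast
qed

lemma definable_pred_ex:
  assumes "univ S m = range \<iota>" "definable_pred S m \<iota> A (\<lambda>\<rho>. P (\<rho> 0) (\<lambda>i. \<rho> (Suc i)))"
  shows "definable_pred S m \<iota> A (\<lambda>\<rho>. \<exists>y. P y \<rho>)"
proof -
  obtain n where "definable_at S m \<iota> A n (\<lambda>\<rho>. P (\<rho> 0) (\<lambda>i. \<rho> (Suc i)))"
    using assms(2) unfolding definable_pred_def by blast
  \<comment> \<open>Widening to \<open>Suc n\<close> variables guarantees a variable 0 to be
    quantified, even for \<open>n = 0\<close>.\<close>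
  then have "definable_at S m \<iota> A (Suc n) (\<lambda>\<rho>. P (\<rho> 0) (\<lambda>i. \<rho> (Suc i)))"
    by (rule definable_at_mono) simp
  then obtain \<phi> where \<phi>: "wf_fm S A (m # replicate n m) \<phi>"
    "\<And>\<rho>. P (\<rho> 0) (\<lambda>i. \<rho> (Suc i)) \<longleftrightarrow> sat S (env \<iota> (Suc n) \<rho>) \<phi>"
    unfolding definable_at_def by auto
  have "P y \<rho> \<longleftrightarrow> sat S (\<iota> y # env \<iota> n \<rho>) \<phi>" for y \<rho>
    using \<phi>(2)[of "case_nat y \<rho>"] by (simp add: env_Suc)
  then have "(\<exists>y. P y \<rho>) \<longleftrightarrow> sat S (env \<iota> n \<rho>) (Ex m \<phi>)" for \<rho>
    using assms(1) by simp
  moreover have "wf_fm S A (replicate n m) (Ex m \<phi>)" using \<phi>(1) by simp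
  ultimately show ?thesis unfolding definable_pred_def definable_at_def by blast
qed

lemma definable_pred_less:
  assumes "p \<in> rels S" "rel_arity S p = [m, m]" "\<And>x y. [\<iota> x, \<iota> y] \<in> rel_int S p \<longleftrightarrow> x < y"
  shows "definable_pred S m \<iota> A (\<lambda>\<rho>. \<rho> 0 < \<rho> 1)"
proof -
  have "has_sort S A (replicate 2 m) (Var i) m" if "i < 2" for i
    using has_sort_Var[of i "replicate 2 m"] that by simp
  then have "wf_fm S A (replicate 2 m) (Rel p [Var 0, Var 1])" using assms(1,2) by simp
  moreover have "sat S (env \<iota> 2 \<rho>) (Rel p [Var 0, Var 1]) \<longleftrightarrow> \<rho> 0 < \<rho> 1" for \<rho>
    by (simp add: assms(3))
  ultimately show ?thesis unfolding definable_pred_def definable_at_def by blast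
qed

lemma definable_preds_definable_pred:
  fixes \<iota> :: "'r::unbounded_dense_linorder \<Rightarrow> 'u"
  assumes "univ S m = range \<iota>" "p \<in> rels S" "rel_arity S p = [m, m]"
    "\<And>x y. [\<iota> x, \<iota> y] \<in> rel_int S p \<longleftrightarrow> x < y"
  shows "definable_preds (definable_pred S m \<iota> A)"
proof
  show "definable_pred S m \<iota> A (\<lambda>\<rho>. \<exists>y. P y \<rho>)"
    if "definable_pred S m \<iota> A (\<lambda>\<rho>. P (\<rho> 0) (\<lambda>i. \<rho> (Suc i)))" for P
    by (rule definable_pred_ex[OF assms(1) that])
  show "definable_pred S m \<iota> A (\<lambda>\<rho>. P (\<lambda>i. \<rho> (\<sigma> i)))" if "definable_pred S m \<iota> A P" for P \<sigma>
    by (rule definable_pred_rename[OF that])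
qed (rule definable_pred_neg definable_pred_conj definable_pred_less[OF assms(2-4)]; assumption)+

lemma definable_imp_pred:
  assumes "definable S A (replicate n m) X" "univ S m = range \<iota>"
  shows "definable_pred S m \<iota> A (\<lambda>\<rho>. env \<iota> n \<rho> \<in> X)"
proof -
  have "env \<iota> n \<rho> \<in> tuples S (replicate n m)" for \<rho>
    using assms(2) by (simp add: tuples_def list_all2_conv_all_nth)
  then show ?thesis
    using assms(1) unfolding definable_pred_def definable_at_def definable_def by blast
qed

lemma definable_pred1_fm:
  assumes "definable_pred S m \<iota> A P"
  obtains \<phi> where "wf_fm S A [m] \<phi>" "\<And>x. P (\<lambda>_. x) \<longleftrightarrow> sat S [\<iota> x] \<phi>"
proof -
  obtain n where "definable_at S m \<iota> A n P" using assms unfolding definable_pred_def by blast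
  \<comment> \<open>Sending all variables to variable 0 evaluates \<open>P\<close> on constant
    assignments, by a formula in a single variable.\<close>
  from definable_at_rename[OF this, of "\<lambda>_. 0" 1]
  obtain \<phi> where \<phi>: "wf_fm S A [m] \<phi>" "\<And>\<rho>. P (\<lambda>i. \<rho> 0) \<longleftrightarrow> sat S (env \<iota> 1 \<rho>) \<phi>"
    unfolding definable_at_def by auto
  have "P (\<lambda>_. x) \<longleftrightarrow> sat S [\<iota> x] \<phi>" for x
    using \<phi>(2)[of "\<lambda>_. x"] by (simp add: env_Suc env_0)
  then show ?thesis using that \<phi>(1) by blast
qed

lemma definable_pred1_imp:
  assumes "definable_pred S m \<iota> A P" "univ S m = range \<iota>"
  shows "definable S A [m] {[\<iota> x] | x. P (\<lambda>_. x)}"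
proof -
  obtain \<phi> where \<phi>: "wf_fm S A [m] \<phi>" "\<And>x. P (\<lambda>_. x) \<longleftrightarrow> sat S [\<iota> x] \<phi>"
    using definable_pred1_fm[OF assms(1)] by blast
  have "{[\<iota> x] | x. P (\<lambda>_. x)} = {us \<in> tuples S [m]. sat S us \<phi>}"
    using \<phi>(2) assms(2) by (auto simp: tuples_def list_all2_Cons2)
  then show ?thesis unfolding definable_def using \<phi>(1) by blast
qed


section \<open>From the two-sorted expansion back to the o-minimal structure\<close>

lemma expansion_simps [simp]:
  "univ (expansion R ab B) MainSort = Inl ` univ R ()"
  "univ (expansion R ab B) AuxSort = range Inr"
  "funs (expansion R ab B) = funs R <+> UNIV"
  "rels (expansion R ab B) = insert None (Some ` rels R)"
  "fun_arity (expansion R ab B) (Inl g) = map (\<lambda>_. MainSort) (fun_arity R g)"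
  "fun_arity (expansion R ab B) (Inr e) = []"
  "fun_sort (expansion R ab B) (Inl g) = MainSort"
  "fun_sort (expansion R ab B) (Inr e) = AuxSort"
  "fun_int (expansion R ab B) (Inl g) us = Inl (fun_int R g (map projl us))"
  "fun_int (expansion R ab B) (Inr e) us = Inr e"
  "rel_arity (expansion R ab B) (Some q) = map (\<lambda>_. MainSort) (rel_arity R q)"
  "rel_arity (expansion R ab B) None = ab @ [MainSort]"
  "rel_int (expansion R ab B) (Some q) = map Inl ` rel_int R q"
  "rel_int (expansion R ab B) None = B"
  "main (expansion R ab B) = MainSort"
  "ball (expansion R ab B) = None"
  by (simp_all add: expansion_def)

text \<open>Terms of \<open>R\<close> are treated as functions of assignments, so that several of
  them can be brought to a common number of variables.\<close>

definition rterm_at :: "(unit, 'f, 'p, 'r, 'z) fo_structure_scheme \<Rightarrow> nat \<Rightarrow> ((nat \<Rightarrow> 'r) \<Rightarrow> 'r) \<Rightarrow> bool" where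
  "rterm_at R n s \<longleftrightarrow> (\<exists>t. has_sort R UNIV (replicate n ()) t () \<and> (\<forall>\<rho>. s \<rho> = trm_val R (env (\<lambda>x. x) n \<rho>) t))"

definition rterm :: "(unit, 'f, 'p, 'r, 'z) fo_structure_scheme \<Rightarrow> ((nat \<Rightarrow> 'r) \<Rightarrow> 'r) \<Rightarrow> bool" where
  "rterm R s \<longleftrightarrow> (\<exists>n. rterm_at R n s)"

lemma rterm_at_mono:
  assumes "rterm_at R n s" "n \<le> k"
  shows "rterm_at R k s"
proof -
  obtain t where t: "has_sort R UNIV (replicate n ()) t ()" "\<And>\<rho>. s \<rho> = trm_val R (env (\<lambda>x. x) n \<rho>) t"
    using assms(1) unfolding rterm_at_def by blast
  have "has_sort R UNIV (replicate k ()) (subst_trm Var t) ()"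
    using assms(2) has_sort_Var[of _ "replicate k ()" R UNIV] by (intro has_sort_subst[OF t(1)]) simp
  moreover have "s \<rho> = trm_val R (env (\<lambda>x. x) k \<rho>) (subst_trm Var t)" for \<rho>
    unfolding t(2) by (rule trm_val_subst[OF t(1), symmetric]) (use assms(2) in simp)
  ultimately show ?thesis unfolding rterm_at_def by blast
qed

lemma rterm_list:
  assumes "\<forall>s\<in>set ss. rterm R s"
  shows "\<exists>n ts. list_all2 (has_sort R UNIV (replicate n ())) ts (replicate (length ss) ()) \<and>
    (\<forall>\<rho>. map (trm_val R (env (\<lambda>x. x) n \<rho>)) ts = map (\<lambda>s. s \<rho>) ss)"
proof -
  have "\<exists>n. \<forall>s\<in>set ss. rterm_at R n s" using assms
  proof (induction ss)
    case (Cons s ss)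
    then obtain n k where "\<forall>s\<in>set ss. rterm_at R n s" "rterm_at R k s"
      unfolding rterm_def by auto
    then have "\<forall>s\<in>set (s # ss). rterm_at R (max n k) s" by (auto intro: rterm_at_mono)
    then show ?case by blast
  qed simp
  then obtain n f where "\<forall>s\<in>set ss. has_sort R UNIV (replicate n ()) (f s) () \<and>
      (\<forall>\<rho>. s \<rho> = trm_val R (env (\<lambda>x. x) n \<rho>) (f s))"
    unfolding rterm_at_def by metis
  then show ?thesis
    by (intro exI[of _ n] exI[of _ "map f ss"]) (auto simp: list_all2_conv_all_nth)
qed

lemma rterm_var: "rterm R (\<lambda>\<rho>. \<rho> i)"
  unfolding rterm_def rterm_at_def
  using has_sort_Var[of i "replicate (Suc i) ()" R UNIV]
  by (intro exI[of _ "Suc i"] exI[of _ "Var i"]) simp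

lemma rterm_const: "univ R () = UNIV \<Longrightarrow> rterm R (\<lambda>\<rho>. c)"
  unfolding rterm_def rterm_at_def using has_sort_Par[of c UNIV R "()"]
  by (intro exI[of _ 0] exI[of _ "Par c"]) simp

lemma list_all2_unit: "list_all2 P ts (replicate (length us) ()) \<Longrightarrow> list_all2 P ts us"
  by (simp add: list_all2_conv_all_nth)

lemma rterm_app:
  assumes "g \<in> funs R" "length ss = length (fun_arity R g)" "\<forall>s\<in>set ss. rterm R s"
  shows "rterm R (\<lambda>\<rho>. fun_int R g (map (\<lambda>s. s \<rho>) ss))"
proof -
  obtain n ts where ts: "list_all2 (has_sort R UNIV (replicate n ())) ts (replicate (length ss) ())"
    "\<And>\<rho>. map (trm_val R (env (\<lambda>x. x) n \<rho>)) ts = map (\<lambda>s. s \<rho>) ss"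
    using rterm_list[OF assms(3)] by blast
  have "list_all2 (has_sort R UNIV (replicate n ())) ts (fun_arity R g)"
    using list_all2_unit[of _ ts "fun_arity R g"] ts(1) assms(2) by simp
  with assms(1) have "has_sort R UNIV (replicate n ()) (App g ts) (fun_sort R g)"
    by (rule has_sort_App)
  moreover have "fun_int R g (map (\<lambda>s. s \<rho>) ss) = trm_val R (env (\<lambda>x. x) n \<rho>) (App g ts)" for \<rho>
    by (simp add: ts(2))
  ultimately show ?thesis unfolding rterm_def rterm_at_def by force
qed

abbreviation DR where "DR R \<equiv> definable_pred R () (\<lambda>x. x) UNIV"

lemma DR_rel:
  assumes "q \<in> rels R" "length ss = length (rel_arity R q)" "\<forall>s\<in>set ss. rterm R s"
  shows "DR R (\<lambda>\<rho>. map (\<lambda>s. s \<rho>) ss \<in> rel_int R q)"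
proof -
  obtain n ts where ts: "list_all2 (has_sort R UNIV (replicate n ())) ts (replicate (length ss) ())"
    "\<And>\<rho>. map (trm_val R (env (\<lambda>x. x) n \<rho>)) ts = map (\<lambda>s. s \<rho>) ss"
    using rterm_list[OF assms(3)] by blast
  have "wf_fm R UNIV (replicate n ()) (Rel q ts)"
    using assms(1,2) ts(1) by (auto intro: list_all2_unit)
  moreover have "map (\<lambda>s. s \<rho>) ss \<in> rel_int R q \<longleftrightarrow> sat R (env (\<lambda>x. x) n \<rho>) (Rel q ts)" for \<rho>
    by (simp add: ts(2))
  ultimately show ?thesis unfolding definable_pred_def definable_at_def by blast
qed

lemma DR_eq:
  assumes "rterm R s" "rterm R t"
  shows "DR R (\<lambda>\<rho>. s \<rho> = t \<rho>)"
proof -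
  have "\<forall>s\<in>set [s, t]. rterm R s" using assms by simp
  from rterm_list[OF this] obtain n ts where
    ts: "list_all2 (has_sort R UNIV (replicate n ())) ts [(), ()]"
      "\<forall>\<rho>. map (trm_val R (env (\<lambda>x. x) n \<rho>)) ts = [s \<rho>, t \<rho>]" by auto
  then obtain t1 t2 where "ts = [t1, t2]" by (auto simp: list_all2_Cons2)
  then have "wf_fm R UNIV (replicate n ()) (Eq t1 t2)"
    "\<And>\<rho>. s \<rho> = t \<rho> \<longleftrightarrow> sat R (env (\<lambda>x. x) n \<rho>) (Eq t1 t2)"
    using ts by auto
  then show ?thesis unfolding definable_pred_def definable_at_def by blast
qed

text \<open>What a term of the expansion becomes once its auxiliary variables are fixed: a term of
  \<open>R\<close>, or a truth value independent of \<open>\<rho>\<close>, since the only function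
  symbols of auxiliary sort are constants.\<close>

definition sorted_val ::
  "(unit, 'f, 'p, 'r, 'z) fo_structure_scheme \<Rightarrow> o_sort \<Rightarrow> ((nat \<Rightarrow> 'r) \<Rightarrow> 'r + bool) \<Rightarrow> bool" where
  "sorted_val R s g \<longleftrightarrow> (case s of MainSort \<Rightarrow> \<exists>r. rterm R r \<and> g = (\<lambda>\<rho>. Inl (r \<rho>)) | AuxSort \<Rightarrow> \<exists>e. g = (\<lambda>\<rho>. Inr e))"

definition sorted_var :: "o_sort \<Rightarrow> ((nat \<Rightarrow> 'r) \<Rightarrow> 'r + bool) \<Rightarrow> bool" where
  "sorted_var s g \<longleftrightarrow> (case s of MainSort \<Rightarrow> \<exists>i. g = (\<lambda>\<rho>. Inl (\<rho> i)) | AuxSort \<Rightarrow> \<exists>e. g = (\<lambda>\<rho>. Inr e))"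

lemma sorted_var_val: "sorted_var s g \<Longrightarrow> sorted_val R s g"
  using rterm_var unfolding sorted_var_def sorted_val_def by (auto split: o_sort.splits)

lemma sorted_val_list:
  "list_all2 (\<lambda>t s. sorted_val R s (\<lambda>\<rho>. v \<rho> t)) ts (map (\<lambda>_. MainSort) xs) \<Longrightarrow>
    \<exists>rs. length rs = length xs \<and> (\<forall>r\<in>set rs. rterm R r) \<and> (\<forall>\<rho>. map (v \<rho>) ts = map (\<lambda>r. Inl (r \<rho>)) rs)"
proof (induction ts arbitrary: xs)
  case (Cons t ts)
  then obtain x ys where xs: "xs = x # ys" by (auto simp: list_all2_Cons1)
  with Cons.prems have "list_all2 (\<lambda>t s. sorted_val R s (\<lambda>\<rho>. v \<rho> t)) ts (map (\<lambda>_. MainSort) ys)"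
    by simp
  from Cons.IH[OF this] obtain rs where "length rs = length ys" "\<forall>r\<in>set rs. rterm R r"
    "\<forall>\<rho>. map (v \<rho>) ts = map (\<lambda>r. Inl (r \<rho>)) rs" by blast
  moreover obtain r where "rterm R r" "(\<lambda>\<rho>. v \<rho> t) = (\<lambda>\<rho>. Inl (r \<rho>))"
    using Cons.prems xs by (auto simp: sorted_val_def)
  ultimately show ?case by (intro exI[of _ "r # rs"]) (auto simp: xs dest: fun_cong)
qed simp

text \<open>What the two ball predicates have in common: with its auxiliary arguments fixed, the
  predicate is definable in \<open>R\<close>, and the balls are the nonempty open intervals, the
  whole line being among them just when \<open>whole\<close> holds.\<close>

locale o_min_expansion =
  fixes R :: "(unit, 'f, 'p, 'r::unbounded_dense_linorder) fo_structure"
    and ab :: "o_sort list" and B :: "('r + bool) list set" and whole :: bool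
  assumes omin: "o_minimal R"
    and B_nonempty: "B \<noteq> {}"
    and B_tuples: "us \<in> B \<Longrightarrow> us \<in> tuples (expansion R ab B) (ab @ [MainSort])"
    and B_definable: "list_all2 (sorted_val R) (ab @ [MainSort]) gs \<Longrightarrow> DR R (\<lambda>\<rho>. map (\<lambda>g. g \<rho>) gs \<in> B)"
    and ball_iff: "is_ball (expansion R ab B) b \<longleftrightarrow>
      (\<exists>J. open_interval J \<and> J \<noteq> {} \<and> (whole \<or> J \<noteq> UNIV) \<and> b = (\<lambda>x. [Inl x]) ` J)"
begin

abbreviation S where "S \<equiv> expansion R ab B"

abbreviation DS where "DS \<equiv> definable_pred S MainSort Inl"

lemma univ_R: "univ R () = UNIV" and univ_main: "univ S MainSort = range Inl"
  using omin by (simp_all add: o_minimal_def)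

lemma less_symbol:
  obtains p where "p \<in> rels R" "rel_arity R p = [(), ()]" "\<And>x y. [x, y] \<in> rel_int R p \<longleftrightarrow> x < y"
  using omin unfolding o_minimal_def by blast

lemma DR_preds: "definable_preds (DR R)"
proof -
  obtain p where "p \<in> rels R" "rel_arity R p = [(), ()]" "\<And>x y. [x, y] \<in> rel_int R p \<longleftrightarrow> x < y"
    using less_symbol by blast
  then show ?thesis using definable_preds_definable_pred[of R "()" "\<lambda>x. x" p] univ_R by simp
qed

sublocale DR: definable_preds "DR R"
  by (rule DR_preds)

sublocale DS: definable_preds "DS A" for A
proof -
  obtain p where p: "p \<in> rels R" "rel_arity R p = [(), ()]" "\<And>x y. [x, y] \<in> rel_int R p \<longleftrightarrow> x < y"
    using less_symbol by blast
  have "[Inl x, Inl y] \<in> map Inl ` rel_int R p \<longleftrightarrow> x < y" for x y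
  proof -
    have "[Inl x, Inl y] = map Inl [x, y]" by simp
    then show ?thesis using inj_image_mem_iff[OF inj_mapI[OF inj_Inl], of "[x, y]"] p(3) by metis
  qed
  then show "definable_preds (DS A)"
    using p by (intro definable_preds_definable_pred[of S MainSort Inl "Some p"]) (simp_all add: univ_R)
qed

lemma trm_template:
  assumes "has_sort S A ss t s" "list_all2 sorted_var ss gs"
  shows "sorted_val R s (\<lambda>\<rho>. trm_val S (map (\<lambda>g. g \<rho>) gs) t)"
  using assms(1)
proof (induction rule: has_sort.induct)
  case (has_sort_Var i)
  then have "sorted_val R (ss ! i) (gs ! i)"
    using assms(2) by (simp add: list_all2_conv_all_nth sorted_var_val)
  moreover have "i < length gs" using has_sort_Var assms(2) by (simp add: list_all2_conv_all_nth)
  ultimately show ?case by simp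
next
  case (has_sort_Par a s)
  have "rterm R (\<lambda>\<rho>. x)" for x by (rule rterm_const[OF univ_R])
  then have "sorted_val R MainSort (\<lambda>\<rho>. Inl x)" for x unfolding sorted_val_def by auto
  with has_sort_Par show ?case
    by (cases s) (auto simp: sorted_val_def[of R AuxSort] univ_R)
next
  case (has_sort_App f ts)
  show ?case
  proof (cases f)
    case (Inl g)
    let ?v = "\<lambda>\<rho>. trm_val S (map (\<lambda>g. g \<rho>) gs)"
    have "list_all2 (\<lambda>t s. sorted_val R s (\<lambda>\<rho>. ?v \<rho> t)) ts (map (\<lambda>_. MainSort) (fun_arity R g))"
      using has_sort_App(2) Inl by (auto elim: list_all2_mono)
    from sorted_val_list[OF this] obtain rs where rs: "length rs = length (fun_arity R g)"
      "\<forall>r\<in>set rs. rterm R r" "\<forall>\<rho>. map (?v \<rho>) ts = map (\<lambda>r. Inl (r \<rho>)) rs"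
      by blast
    have "g \<in> funs R" using has_sort_App(1) Inl by auto
    then have "rterm R (\<lambda>\<rho>. fun_int R g (map (\<lambda>r. r \<rho>) rs))" using rs(1,2) by (rule rterm_app)
    moreover have "?v \<rho> (App f ts) = Inl (fun_int R g (map (\<lambda>r. r \<rho>) rs))" for \<rho>
      using rs(3) Inl by (simp add: comp_def)
    ultimately show ?thesis unfolding sorted_val_def using Inl by auto
  next
    case (Inr e)
    then show ?thesis by (auto simp: sorted_val_def)
  qed
qed

text \<open>
  A formula of the expansion becomes a formula of \<open>R\<close> once its auxiliary variables are replaced by
  constants: an auxiliary quantifier is then a disjunction of two formulas.
\<close>

lemma fm_template:
  "wf_fm S A ss \<phi> \<Longrightarrow> list_all2 sorted_var ss gs \<Longrightarrow> DR R (\<lambda>\<rho>. sat S (map (\<lambda>g. g \<rho>) gs) \<phi>)"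
proof (induction \<phi> arbitrary: ss gs)
  case (Eq t u)
  then obtain s where "has_sort S A ss t s" "has_sort S A ss u s" by auto
  then have "sorted_val R s (\<lambda>\<rho>. trm_val S (map (\<lambda>g. g \<rho>) gs) t)"
    "sorted_val R s (\<lambda>\<rho>. trm_val S (map (\<lambda>g. g \<rho>) gs) u)"
    using trm_template Eq.prems(2) by blast+
  then consider r r' where "rterm R r" "rterm R r'" "(\<lambda>\<rho>. trm_val S (map (\<lambda>g. g \<rho>) gs) t) = (\<lambda>\<rho>. Inl (r \<rho>))"
      "(\<lambda>\<rho>. trm_val S (map (\<lambda>g. g \<rho>) gs) u) = (\<lambda>\<rho>. Inl (r' \<rho>))"
    | e e' where "(\<lambda>\<rho>. trm_val S (map (\<lambda>g. g \<rho>) gs) t) = (\<lambda>\<rho>. Inr e)"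
      "(\<lambda>\<rho>. trm_val S (map (\<lambda>g. g \<rho>) gs) u) = (\<lambda>\<rho>. Inr e')"
    unfolding sorted_val_def by (cases s) auto
  then show ?case
  proof cases
    case 1
    have "sat S (map (\<lambda>g. g \<rho>) gs) (Eq t u) \<longleftrightarrow> r \<rho> = r' \<rho>" for \<rho>
      using fun_cong[OF 1(3), of \<rho>] fun_cong[OF 1(4), of \<rho>] by simp
    then show ?thesis using DR_eq[OF 1(1,2)] by presburger
  next
    case 2
    have "sat S (map (\<lambda>g. g \<rho>) gs) (Eq t u) \<longleftrightarrow> e = e'" for \<rho>
      using fun_cong[OF 2(1), of \<rho>] fun_cong[OF 2(2), of \<rho>] by simp
    then show ?thesis using DR.D_const by presburger
  qed
next
  case (Rel p ts)
  let ?v = "\<lambda>\<rho>. trm_val S (map (\<lambda>g. g \<rho>) gs)"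
  have ts: "list_all2 (\<lambda>t s. sorted_val R s (\<lambda>\<rho>. ?v \<rho> t)) ts (rel_arity S p)"
    using Rel trm_template by (auto elim!: list_all2_mono)
  show ?case
  proof (cases p)
    case None
    have "list_all2 (sorted_val R) (ab @ [MainSort]) (map (\<lambda>t \<rho>. ?v \<rho> t) ts)"
      using ts None by (simp add: list_all2_conv_all_nth)
    from B_definable[OF this] have "DR R (\<lambda>\<rho>. map (\<lambda>g. g \<rho>) (map (\<lambda>t \<rho>. ?v \<rho> t) ts) \<in> B)" .
    moreover have "map (\<lambda>g. g \<rho>) (map (\<lambda>t \<rho>. ?v \<rho> t) ts) \<in> B \<longleftrightarrow> sat S (map (\<lambda>g. g \<rho>) gs) (Rel p ts)" for \<rho>
      using None by (simp add: comp_def)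
    ultimately show ?thesis by (simp only:)
  next
    case (Some q)
    with ts have "list_all2 (\<lambda>t s. sorted_val R s (\<lambda>\<rho>. ?v \<rho> t)) ts (map (\<lambda>_. MainSort) (rel_arity R q))"
      by simp
    from sorted_val_list[OF this] obtain rs where rs: "length rs = length (rel_arity R q)"
      "\<forall>r\<in>set rs. rterm R r" "\<forall>\<rho>. map (?v \<rho>) ts = map (\<lambda>r. Inl (r \<rho>)) rs"
      by blast
    have "q \<in> rels R" using Rel.prems(1) Some by auto
    then have "DR R (\<lambda>\<rho>. map (\<lambda>r. r \<rho>) rs \<in> rel_int R q)" using rs(1,2) by (rule DR_rel)
    moreover have "map (?v \<rho>) ts \<in> map Inl ` rel_int R q \<longleftrightarrow> map (\<lambda>r. r \<rho>) rs \<in> rel_int R q" for \<rho>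
    proof -
      have "map (?v \<rho>) ts = map Inl (map (\<lambda>r. r \<rho>) rs)" using rs(3) by (simp add: comp_def)
      then show ?thesis using inj_image_mem_iff[OF inj_mapI[OF inj_Inl]] by metis
    qed
    ultimately show ?thesis unfolding Some by (simp only: sat.simps expansion_simps)
  qed
next
  case (Neg \<phi>)
  then show ?case using DR.D_neg by auto
next
  case (Conj \<phi> \<psi>)
  then show ?case using DR.D_conj by auto
next
  case (Ex s \<phi>)
  show ?case
  proof (cases s)
    case MainSort
    let ?gs = "(\<lambda>\<rho>. Inl (\<rho> 0)) # map (\<lambda>g \<rho>. g (\<lambda>i. \<rho> (Suc i))) gs"
    have "sorted_var t (\<lambda>\<rho>. g (\<lambda>i. \<rho> (Suc i)))" if "sorted_var t g" for t and g :: "(nat \<Rightarrow> 'r) \<Rightarrow> 'r + bool"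
      using that unfolding sorted_var_def by (auto split: o_sort.splits)
    then have "list_all2 sorted_var ss (map (\<lambda>g \<rho>. g (\<lambda>i. \<rho> (Suc i))) gs)"
      using Ex.prems(2) by (simp add: list_all2_conv_all_nth)
    moreover have "sorted_var MainSort (\<lambda>\<rho>::nat \<Rightarrow> 'r. Inl (\<rho> 0))" by (auto simp: sorted_var_def)
    ultimately have "list_all2 sorted_var (s # ss) ?gs" using MainSort by simp
    moreover have "wf_fm S A (s # ss) \<phi>" using Ex.prems(1) by simp
    ultimately have "DR R (\<lambda>\<rho>. sat S (map (\<lambda>g. g \<rho>) ?gs) \<phi>)"
      using Ex.IH by blast
    then have "DR R (\<lambda>\<rho>. \<exists>y. sat S (Inl y # map (\<lambda>g. g \<rho>) gs) \<phi>)"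
      by (intro DR.D_ex) (simp add: comp_def)
    then show ?thesis using MainSort univ_R by simp
  next
    case AuxSort
    have "DR R (\<lambda>\<rho>. sat S (Inr e # map (\<lambda>g. g \<rho>) gs) \<phi>)" for e
    proof -
      have "sorted_var AuxSort (\<lambda>\<rho>::nat \<Rightarrow> 'r. Inr e)" by (auto simp: sorted_var_def)
      then show ?thesis
        using Ex.IH[of "s # ss" "(\<lambda>\<rho>. Inr e) # gs"] Ex.prems AuxSort by simp
    qed
    then have "DR R (\<lambda>\<rho>. sat S (Inr True # map (\<lambda>g. g \<rho>) gs) \<phi> \<or> sat S (Inr False # map (\<lambda>g. g \<rho>) gs) \<phi>)"
      by (intro DR.D_disj)
    then show ?thesis using AuxSort by (simp add: ex_bool_eq)
  qed
qed

text \<open>The main sort acquires no new definable sets: parameters of the main sort are points of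
  \<open>R\<close>, and those of the auxiliary sort are fixed truth values.\<close>

lemma DS_imp_DR:
  assumes "DS A P"
  shows "DR R P"
proof -
  obtain n \<phi> where \<phi>: "wf_fm S A (replicate n MainSort) \<phi>" "\<And>\<rho>. P \<rho> \<longleftrightarrow> sat S (env Inl n \<rho>) \<phi>"
    using assms unfolding definable_pred_def definable_at_def by blast
  have "list_all2 sorted_var (replicate n MainSort) (map (\<lambda>i (\<rho>::nat \<Rightarrow> 'r). Inl (\<rho> i)) [0..<n])"
    by (auto simp: list_all2_conv_all_nth sorted_var_def)
  from fm_template[OF \<phi>(1) this]
  have "DR R (\<lambda>\<rho>. sat S (map (\<lambda>g. g \<rho>) (map (\<lambda>i \<rho>. Inl (\<rho> i)) [0..<n])) \<phi>)" .
  moreover have "(\<lambda>\<rho>. sat S (map (\<lambda>g. g \<rho>) (map (\<lambda>i \<rho>. Inl (\<rho> i)) [0..<n])) \<phi>) = P"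
    using \<phi>(2) by (auto simp: env_def comp_def fun_eq_iff)
  ultimately show ?thesis by simp
qed

sublocale over: o_min_over "DR R" "DS A" for A
proof
  show "DR R (\<lambda>\<rho>. \<rho> 0 = c)" for c
    by (rule DR_eq[OF rterm_var rterm_const[OF univ_R]])
  show "DR R P" if "DS A P" for P using DS_imp_DR[OF that] .
  fix P assume P: "DR R P"
  have "definable R UNIV [()] {[x] | x. P (\<lambda>_. x)}"
    by (rule definable_pred1_imp[OF P]) (simp add: univ_R)
  moreover have "{[x] | x. P (\<lambda>_. x)} = (\<lambda>x. [x]) ` {x. P (\<lambda>_. x)}" by auto
  ultimately have "definable R UNIV [()] ((\<lambda>x. [x]) ` {x. P (\<lambda>_. x)})" by simp
  then obtain C where C: "finite C" "\<forall>I\<in>C. (\<exists>a. I = {a}) \<or> open_interval I"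
    "(\<lambda>x. [x]) ` {x. P (\<lambda>_. x)} = (\<lambda>x. [x]) ` \<Union>C"
    using omin unfolding o_minimal_def by meson
  moreover have "{x. P (\<lambda>_. x)} = \<Union>C"
    using C(3) by (subst (asm) inj_image_eq_iff) (simp_all add: inj_def)
  ultimately show "tame {x. P (\<lambda>_. x)}" unfolding tame_def by blast
qed

end


section \<open>b-minimality and preservation of balls\<close>

lemma has_sort_mono: "has_sort S A ss t s \<Longrightarrow> A \<subseteq> A' \<Longrightarrow> has_sort S A' ss t s"
proof (induction rule: has_sort.induct)
  case (has_sort_App f ts)
  then show ?case by (auto intro!: has_sort.has_sort_App elim: list_all2_mono)
qed (auto intro: has_sort.intros)

lemma wf_fm_mono: "wf_fm S A ss \<phi> \<Longrightarrow> A \<subseteq> A' \<Longrightarrow> wf_fm S A' ss \<phi>"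
proof (induction \<phi> arbitrary: ss)
  case (Eq t u)
  then show ?case using has_sort_mono by (metis wf_fm.simps(1))
next
  case (Rel p ts)
  then show ?case using has_sort_mono by (auto elim!: list_all2_mono)
qed auto

lemma definable_mono: "definable S A ss X \<Longrightarrow> A \<subseteq> A' \<Longrightarrow> definable S A' ss X"
  unfolding definable_def using wf_fm_mono by metis

lemma infinite_open_interval:
  fixes I :: "'r::unbounded_dense_linorder set"
  assumes "open_interval I" "I \<noteq> {}"
  shows "infinite I"
proof
  assume "finite I"
  then have "Max I \<in> I" using assms(2) by simp
  then obtain v where "v \<in> I" "Max I < v" using open_interval_no_max[OF assms(1)] by blast
  then show False using Max_ge[OF \<open>finite I\<close>] by (meson leD)
qed

section \<open>Definable maps into products of the auxiliary sort\<close>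

context o_min_expansion
begin

abbreviation emb :: "'r \<Rightarrow> ('r + bool) list" where
  "emb x \<equiv> [Inl x]"

lemma inj_emb: "inj emb"
  by (simp add: inj_def)

lemma tuples_main: "tuples S [MainSort] = range emb"
  by (auto simp: tuples_def list_all2_Cons2 univ_R)

lemma tuples_aux: "us \<in> tuples S (replicate n AuxSort) \<longleftrightarrow> length us = n \<and> (\<forall>i<n. us ! i \<in> range Inr)"
  by (auto simp: tuples_def list_all2_conv_all_nth)

lemma is_point_iff: "is_point S b \<longleftrightarrow> (\<exists>x. b = {emb x})"
  by (auto simp: is_point_def tuples_main)

definition aux_const :: "bool \<Rightarrow> ('f + bool, 'r + bool) trm" where
  "aux_const e = App (Inr e) []"

lemma aux_const_sort: "has_sort S A ss (aux_const e) AuxSort"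
  unfolding aux_const_def using has_sort_App[of "Inr e" S A ss "[]"] by (simp add: InrI)

lemma aux_const_val [simp]: "trm_val S us (aux_const e) = Inr e"
  by (simp add: aux_const_def)

definition verum :: "(o_sort, 'f + bool, 'p option, 'r + bool) fm" where
  "verum = Eq (aux_const True) (aux_const True)"

lemma verum [simp]: "wf_fm S A ss verum" "sat S us verum"
  unfolding verum_def using aux_const_sort by auto

lemma definable_tuples: "definable S A ss (tuples S ss)"
  unfolding definable_def by (intro exI[of _ verum]) simp

lemma auxiliary_tuples: "MainSort \<notin> set ss \<Longrightarrow> auxiliary_set S ss (tuples S ss)"
  by (simp add: auxiliary_set_def definable_tuples)

lemma wf_foldr_Conj: "wf_fm S A ss (foldr Conj \<phi>s verum) \<longleftrightarrow> (\<forall>\<phi>\<in>set \<phi>s. wf_fm S A ss \<phi>)"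
  by (induction \<phi>s) auto

lemma sat_foldr_Conj: "sat S us (foldr Conj \<phi>s verum) \<longleftrightarrow> (\<forall>\<phi>\<in>set \<phi>s. sat S us \<phi>)"
  by (induction \<phi>s) auto

text \<open>A finite list of definable properties is packed into one auxiliary tuple. The graph is
  defined by a conjunction stating, for each property, that it is equivalent to its coordinate being
  \<open>True\<close>.\<close>

lemma definable_indicator_map:
  assumes X: "definable S A [MainSort] X" and Ps: "\<And>P. P \<in> set Ps \<Longrightarrow> DS A (\<lambda>\<rho>. P (\<rho> 0))"
  defines "ss \<equiv> replicate (length Ps) AuxSort"
  shows "definable_map S A [MainSort] X ss (tuples S ss) (\<lambda>x. map (\<lambda>P. Inr (P (projl (hd x)))) Ps)"
    (is "definable_map _ _ _ _ _ _ ?f")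
proof -
  obtain \<phi> where \<phi>: "wf_fm S A [MainSort] \<phi>" "X = {us \<in> tuples S [MainSort]. sat S us \<phi>}"
    using X unfolding definable_def by blast
  have "\<exists>\<psi>. wf_fm S A [MainSort] \<psi> \<and> (\<forall>x. P x \<longleftrightarrow> sat S [Inl x] \<psi>)" if "P \<in> set Ps" for P
    using definable_pred1_fm[OF Ps[OF that]] by metis
  then obtain \<psi> where \<psi>: "\<And>P. P \<in> set Ps \<Longrightarrow> wf_fm S A [MainSort] (\<psi> P)"
    "\<And>P x. P \<in> set Ps \<Longrightarrow> P x \<longleftrightarrow> sat S [Inl x] (\<psi> P)" by metis
  \<comment> \<open>Substituting each variable by itself keeps the meaning but lets the formula be
    read over the longer list of sorts.\<close>
  define w where "w \<chi> = subst_fm \<chi> Var" for \<chi> :: "(o_sort, 'f + bool, 'p option, 'r + bool) fm"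
  have w_wf: "wf_fm S A (MainSort # ss) (w \<chi>)" if "wf_fm S A [MainSort] \<chi>" for \<chi>
    unfolding w_def by (rule wf_fm_subst[OF that]) (use has_sort_Var[of 0 "MainSort # ss" S A] in simp)
  have w_sat: "sat S (u # us) (w \<chi>) \<longleftrightarrow> sat S [u] \<chi>" if "wf_fm S A [MainSort] \<chi>" for \<chi> u us
    unfolding w_def by (rule sat_subst[OF that]) simp
  \<comment> \<open>The index is shifted by one since variable 0 is the main argument.\<close>
  define is_true where "is_true i = (Eq (Var (Suc i)) (aux_const True) :: (o_sort, 'f + bool, 'p option, 'r + bool) fm)"
    for i
  have is_true_wf: "wf_fm S A (MainSort # ss) (is_true i)" if "i < length Ps" for i
    using that has_sort_Var[of "Suc i" "MainSort # ss" S A] aux_const_sort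
    unfolding is_true_def ss_def by auto
  define iff where "iff a b = Conj (Neg (Conj a (Neg b))) (Neg (Conj b (Neg a)))"
    for a b :: "(o_sort, 'f + bool, 'p option, 'r + bool) fm"
  have iff: "wf_fm S A ss' (iff a b) \<longleftrightarrow> wf_fm S A ss' a \<and> wf_fm S A ss' b"
    "sat S us (iff a b) \<longleftrightarrow> (sat S us a \<longleftrightarrow> sat S us b)" for a b ss' us
    unfolding iff_def by auto
  let ?\<chi> = "foldr Conj (w \<phi> # map (\<lambda>i. iff (w (\<psi> (Ps ! i))) (is_true i)) [0..<length Ps]) verum"
  have "wf_fm S A (MainSort # ss) ?\<chi>"
    unfolding wf_foldr_Conj using w_wf \<phi>(1) \<psi>(1) is_true_wf iff(1) by auto
  moreover have "(\<lambda>x. x @ ?f x) ` X = {us \<in> tuples S (MainSort # ss). sat S us ?\<chi>}"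
  proof -
    have "us \<in> (\<lambda>x. x @ ?f x) ` X \<longleftrightarrow> sat S us ?\<chi>" if us: "us \<in> tuples S (MainSort # ss)" for us
    proof -
      obtain x es where x: "us = Inl x # es" and es: "es \<in> tuples S ss"
        using us by (auto simp: tuples_def list_all2_Cons2 univ_R)
      \<comment> \<open>There are two auxiliary values, so a coordinate is determined by whether it
        equals \<open>Inr True\<close>.\<close>
      have "es ! i = Inr (P x) \<longleftrightarrow> (P x \<longleftrightarrow> es ! i = Inr True)" if "i < length Ps" for i and P :: "'r \<Rightarrow> bool"
        using es that unfolding ss_def tuples_aux by (metis (full_types) rangeE sum.inject(2))
      then have "es = map (\<lambda>P. Inr (P x)) Ps \<longleftrightarrow> (\<forall>i<length Ps. (Ps ! i) x \<longleftrightarrow> es ! i = Inr True)"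
        using es unfolding ss_def tuples_aux by (simp add: list_eq_iff_nth_eq)
      also have "\<dots> \<longleftrightarrow> (\<forall>i<length Ps. sat S us (iff (w (\<psi> (Ps ! i))) (is_true i)))"
        unfolding iff(2) x using w_sat \<psi> by (simp add: is_true_def)
      finally have es_iff: "es = map (\<lambda>P. Inr (P x)) Ps \<longleftrightarrow>
        (\<forall>i<length Ps. sat S us (iff (w (\<psi> (Ps ! i))) (is_true i)))" .
      have "us \<in> (\<lambda>x. x @ ?f x) ` X \<longleftrightarrow> emb x \<in> X \<and> es = map (\<lambda>P. Inr (P x)) Ps"
      proof -
        have "X \<subseteq> range emb" using \<phi>(2) tuples_main by blast
        then have "us \<in> (\<lambda>x. x @ ?f x) ` X \<longleftrightarrow> (\<exists>y. emb y \<in> X \<and> us = emb y @ ?f (emb y))"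
          unfolding image_iff by blast
        then show ?thesis unfolding x by auto
      qed
      moreover have "emb x \<in> X \<longleftrightarrow> sat S us (w \<phi>)"
        using \<phi> tuples_main w_sat unfolding x by auto
      ultimately show ?thesis unfolding sat_foldr_Conj es_iff by auto
    qed
    moreover have "(\<lambda>x. x @ ?f x) ` X \<subseteq> tuples S (MainSort # ss)"
    proof
      fix us assume "us \<in> (\<lambda>x. x @ ?f x) ` X"
      then obtain y where "y \<in> X" "us = y @ ?f y" by blast
      moreover then obtain x where "y = emb x" using \<phi>(2) tuples_main by auto
      ultimately show "us \<in> tuples S (MainSort # ss)"
        by (auto simp: tuples_def list_all2_conv_all_nth univ_R ss_def nth_Cons split: nat.splits)
    qed
    ultimately show ?thesis by blast
  qed
  ultimately have "definable S A ([MainSort] @ ss) ((\<lambda>x. x @ ?f x) ` X)"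
    unfolding definable_def append_Cons append_Nil by blast
  moreover have "?f ` X \<subseteq> tuples S ss" by (auto simp: ss_def tuples_aux)
  ultimately show ?thesis
    unfolding definable_map_def using X definable_tuples by blast
qed

text \<open>The recorded properties are \<open>x = e\<close> and \<open>x < e\<close> for
  \<open>e\<close> in \<open>E\<close>, so equal tuples mean equal cells.\<close>

lemma cut_map:
  assumes X: "definable S A [MainSort] X" and E: "finite E" "\<forall>e\<in>E. DS A (\<lambda>\<rho>. \<rho> 0 = e)"
  shows "\<exists>ss f. MainSort \<notin> set ss \<and> definable_map S A [MainSort] X ss (tuples S ss) f \<and>
    (\<forall>x y. f (emb x) = f (emb y) \<longleftrightarrow> y \<in> component E x)"
proof -
  obtain es where es: "set es = E" using E(1) finite_list by blast
  let ?Ps = "map (\<lambda>e x. x = e) es @ map (\<lambda>e x. x < e) es"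
  let ?f = "\<lambda>x. map (\<lambda>P. Inr (P (projl (hd x)))) ?Ps :: ('r + bool) list"
  have "DS A (\<lambda>\<rho>. P (\<rho> 0))" if P: "P \<in> set ?Ps" for P
  proof -
    from P es consider e where "e \<in> E" "P = (\<lambda>x. x = e)" | e where "e \<in> E" "P = (\<lambda>x. x < e)" by auto
    then show ?thesis
    proof cases
      case 2
      then show ?thesis using DS.D_less[OF DS.trm_var DS.trm_const[OF E(2)[rule_format]]] by simp
    qed (use E(2) in simp)
  qed
  from definable_indicator_map[OF X this]
  have "definable_map S A [MainSort] X (replicate (length ?Ps) AuxSort)
      (tuples S (replicate (length ?Ps) AuxSort)) ?f" .
  moreover have "?f (emb x) = ?f (emb y) \<longleftrightarrow> y \<in> component E x" for x y
    using es by (auto simp: component_def)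
  moreover have "MainSort \<notin> set (replicate (length ?Ps) AuxSort)" by simp
  ultimately show ?thesis by blast
qed

text \<open>Subintervals are included because a refining b-map may cut a piece further, at points
  that are not definable over \<open>A\<close>.\<close>

definition tame_interval :: "('r \<Rightarrow> 'r \<Rightarrow> bool) \<Rightarrow> bool \<Rightarrow> 'r set \<Rightarrow> bool" where
  "tame_interval G b J \<longleftrightarrow> open_interval J \<and> J \<noteq> {} \<and> (b \<longrightarrow> J \<noteq> UNIV) \<and>
     (\<forall>J'. open_interval J' \<longrightarrow> J' \<noteq> {} \<longrightarrow> J' \<subseteq> J \<longrightarrow> over.tame_on G b J')"

lemma tame_pieces:
  assumes X: "definable S A [MainSort] X"
    and G: "DS A (\<lambda>\<rho>. G (\<rho> 0) (\<rho> 1))" "functional G" "\<forall>x. emb x \<in> X \<longleftrightarrow> (\<exists>y. G x y)"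
    and C: "finite C" "\<forall>c\<in>C. DS A (\<lambda>\<rho>. \<rho> 0 = c)"
  shows "\<exists>ss f. MainSort \<notin> set ss \<and> definable_map S A [MainSort] X ss (tuples S ss) f \<and>
    (\<forall>s\<in>f ` X. (\<exists>x. emb x \<in> X \<and> fiber f X s = {emb x}) \<or>
      (\<exists>J. fiber f X s = emb ` J \<and> tame_interval G (C \<noteq> {}) J))"
proof -
  from over.definable_pieces[OF G(1,2) C] obtain E where
    E: "finite E" "C \<subseteq> E" "\<forall>e\<in>E. DS A (\<lambda>\<rho>. \<rho> 0 = e)" and
    pieces: "\<forall>J x y. open_interval J \<longrightarrow> J \<inter> E = {} \<longrightarrow> x \<in> J \<longrightarrow> G x y \<longrightarrow> over.tame_on G (C \<noteq> {}) J"
    by blast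
  from cut_map[OF X E(1,3)] obtain ss f where f: "MainSort \<notin> set ss"
    "definable_map S A [MainSort] X ss (tuples S ss) f"
    "\<forall>x y. f (emb x) = f (emb y) \<longleftrightarrow> y \<in> component E x" by blast
  have X_emb: "X \<subseteq> range emb" using X unfolding definable_def tuples_main by blast
  have "\<forall>s\<in>f ` X. (\<exists>x. emb x \<in> X \<and> fiber f X s = {emb x}) \<or>
      (\<exists>J. fiber f X s = emb ` J \<and> tame_interval G (C \<noteq> {}) J)"
  proof
    fix s assume "s \<in> f ` X"
    then obtain x where x: "emb x \<in> X" "s = f (emb x)" using X_emb by blast
    have fib: "fiber f X s = emb ` (component E x \<inter> {y. emb y \<in> X})"
    proof -
      have "f (emb y) = s \<longleftrightarrow> y \<in> component E x" for y using f(3) x(2) by metis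
      then have "z \<in> fiber f X s \<longleftrightarrow> z \<in> emb ` (component E x \<inter> {y. emb y \<in> X})" for z
        unfolding fiber_def using X_emb by (cases "z \<in> range emb") auto
      then show ?thesis by blast
    qed
    show "(\<exists>x. emb x \<in> X \<and> fiber f X s = {emb x}) \<or>
      (\<exists>J. fiber f X s = emb ` J \<and> tame_interval G (C \<noteq> {}) J)"
    proof (cases "x \<in> E")
      case True
      then show ?thesis using x(1) fib component_point[OF True] by auto
    next
      case False
      let ?J = "component E x"
      have J: "open_interval ?J" "?J \<inter> E = {}" "x \<in> ?J"
        using component_interval[OF E(1) False] component_disjoint[OF False] component_self by auto
      obtain y where "G x y" using G(3) x(1) by blast
      then have "over.tame_on G (C \<noteq> {}) ?J" using pieces J by blast
      then have dom: "\<exists>y. G z y" if "z \<in> ?J" for z using that unfolding over.tame_on_def by blast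
      then have "fiber f X s = emb ` ?J" unfolding fib using G(3) by blast
      \<comment> \<open>A subinterval of the cell also avoids \<open>E\<close> and lies in the
        domain, so the choice of \<open>E\<close> covers it.\<close>
      moreover have "over.tame_on G (C \<noteq> {}) J'" if "open_interval J'" "J' \<noteq> {}" "J' \<subseteq> ?J" for J'
        using pieces that J(2) dom by (metis (no_types) disjoint_iff ex_in_conv subsetD)
      moreover have "?J \<noteq> UNIV" if "C \<noteq> {}" using component_not_UNIV[of E x] that E(2) by blast
      ultimately show ?thesis using J unfolding tame_interval_def by blast
    qed
  qed
  with f(1,2) show ?thesis by blast
qed

lemma definable_main_pred: "definable S A [MainSort] X \<Longrightarrow> DS A (\<lambda>\<rho>. emb (\<rho> 0) \<in> X)"
  using definable_imp_pred[of S A 1 MainSort X Inl] univ_main by (simp add: env_Suc env_0)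

lemma definable_point_iff: "DS A (\<lambda>\<rho>. \<rho> 0 = c) \<longleftrightarrow> definable S A [MainSort] {emb c}"
proof
  assume "DS A (\<lambda>\<rho>. \<rho> 0 = c)"
  from definable_pred1_imp[OF this univ_main] show "definable S A [MainSort] {emb c}" by simp
next
  assume "definable S A [MainSort] {emb c}"
  from definable_main_pred[OF this] show "DS A (\<lambda>\<rho>. \<rho> 0 = c)" by simp
qed

lemma has_definable_point_iff: "has_definable_point S A \<longleftrightarrow> (\<exists>c. DS A (\<lambda>\<rho>. \<rho> 0 = c))"
  unfolding has_definable_point_def definable_point_iff by (auto simp: univ_R)

lemma has_definable_point_mono: "has_definable_point S A \<Longrightarrow> A \<subseteq> A' \<Longrightarrow> has_definable_point S A'"
  unfolding has_definable_point_def using definable_mono by blast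

text \<open>If the whole line is a ball, the empty set is a legitimate choice; otherwise a single
  definable point is the cut.\<close>

lemma cut_points:
  assumes "whole \<or> has_definable_point S A"
  shows "\<exists>C. finite C \<and> (\<forall>c\<in>C. DS A (\<lambda>\<rho>. \<rho> 0 = c)) \<and> (whole \<or> C \<noteq> {})"
proof (cases whole)
  case False
  then obtain c where "DS A (\<lambda>\<rho>. \<rho> 0 = c)" using assms has_definable_point_iff by blast
  then show ?thesis by (intro exI[of _ "{c}"]) simp
qed auto

lemma point_or_ball_emb:
  "(\<exists>p. Y = {p}) \<or> open_interval Y \<and> Y \<noteq> {} \<and> (whole \<or> Y \<noteq> UNIV) \<Longrightarrow>
    is_ball S (emb ` Y) \<or> is_point S (emb ` Y)"
  unfolding ball_iff is_point_iff by auto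

lemma tame_fiber:
  assumes "(\<exists>x. emb x \<in> X \<and> Z = {emb x}) \<or> (\<exists>J. Z = emb ` J \<and> tame_interval G b J)" "whole \<or> b"
  shows "is_point S Z \<or> is_ball S Z"
  using assms(1)
proof (elim disjE exE conjE)
  fix J assume "Z = emb ` J" "tame_interval G b J"
  then have "is_ball S Z" using assms(2) unfolding ball_iff tame_interval_def by blast
  then show ?thesis ..
qed (simp add: is_point_iff)

section \<open>The axioms and preservation of balls\<close>

lemma wf_ball_S: "wf_ball_structure S"
proof -
  have wfR: "wf_structure R" using omin by (simp add: o_minimal_def)
  have "fun_int S f us \<in> univ S (fun_sort S f)" if f: "f \<in> funs S" for f us
    by (cases f) (simp_all add: univ_R)
  moreover have "rel_int S p \<subseteq> tuples S (rel_arity S p)" if "p \<in> rels S" for p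
  proof (cases p)
    case None
    then show ?thesis using B_tuples by auto
  next
    case (Some q)
    then have "q \<in> rels R" using that by auto
    then have "rel_int R q \<subseteq> tuples R (rel_arity R q)" using wfR unfolding wf_structure_def by blast
    then have "length us = length (rel_arity R q)" if "us \<in> rel_int R q" for us
      using that by (auto simp: tuples_def dest: list_all2_lengthD)
    then show ?thesis using Some by (auto simp: tuples_def list_all2_conv_all_nth univ_R)
  qed
  moreover have "univ S s \<inter> univ S t = {}" if "s \<noteq> t" for s t
    using that by (cases s; cases t) auto
  moreover have "univ S s \<noteq> {}" for s by (cases s) (auto simp: univ_R)
  ultimately have "wf_structure S" unfolding wf_structure_def by blast
  then show ?thesis unfolding wf_ball_structure_def using B_nonempty by simp
qed

lemma axiom_b1_S:
  assumes "whole \<or> has_definable_point S A"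
  shows "axiom_b1 S A"
  unfolding axiom_b1_def
proof (intro allI impI)
  fix X assume "definable S A [main S] X"
  then have X: "definable S A [MainSort] X" by simp
  obtain C where C: "finite C" "\<forall>c\<in>C. DS A (\<lambda>\<rho>. \<rho> 0 = c)" "whole \<or> C \<noteq> {}"
    using cut_points[OF assms] by blast
  \<comment> \<open>(b1) asks only about the shape of the pieces, so the identity on
    \<open>X\<close> is taken as the function to be cut.\<close>
  let ?G = "\<lambda>x y. emb x \<in> X \<and> x = y"
  have G: "DS A (\<lambda>\<rho>. ?G (\<rho> 0) (\<rho> 1))"
    by (intro DS.D_conj DS.D_eq DS.trm_var definable_main_pred X)
  have "functional ?G" "\<forall>x. emb x \<in> X \<longleftrightarrow> (\<exists>y. ?G x y)" by (auto simp: functional_def)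
  from tame_pieces[OF X G this C(1,2)] obtain ss f where
    f: "MainSort \<notin> set ss" "definable_map S A [MainSort] X ss (tuples S ss) f" and
    fib: "\<forall>s\<in>f ` X. (\<exists>x. emb x \<in> X \<and> fiber f X s = {emb x}) \<or>
      (\<exists>J. fiber f X s = emb ` J \<and> tame_interval ?G (C \<noteq> {}) J)"
    by blast
  have "is_point S (fiber f X s) \<or> is_ball S (fiber f X s)" if "s \<in> f ` X" for s
    by (rule tame_fiber[OF fib[rule_format, OF that]]) (use C(3) in blast)
  then have "b_map S A X ss (tuples S ss) f"
    unfolding b_map_def using f auxiliary_tuples by simp
  then show "\<exists>ts T f. b_map S A X ts T f" by blast
qed

text \<open>Products of the two-point sort are finite, whereas balls are infinite because the order
  is dense.\<close>

lemma axiom_b2_S: "axiom_b2 S"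
  unfolding axiom_b2_def
proof (intro notI, elim exE conjE)
  fix ts T b f
  assume T: "auxiliary_set S ts T" and b: "is_ball S b" and onto: "f ` T = b"
  have ts: "ts = replicate (length ts) AuxSort"
    using T unfolding auxiliary_set_def
    by (intro nth_equalityI) (auto simp: in_set_conv_nth, metis o_sort.exhaust)
  have "T \<subseteq> tuples S ts" using T unfolding auxiliary_set_def definable_def by blast
  also have "\<dots> \<subseteq> {us. set us \<subseteq> range Inr \<and> length us = length ts}"
    by (subst ts) (auto simp: tuples_aux in_set_conv_nth)
  finally have "finite T"
    by (rule finite_subset) (intro finite_lists_length_eq finite_imageI finite)
  obtain J where "open_interval J" "J \<noteq> {}" "b = emb ` J" using b ball_iff by blast
  then have "infinite b"
    using infinite_open_interval finite_imageD inj_on_subset[OF inj_emb subset_UNIV] by blast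
  then show False using onto \<open>finite T\<close> by blast
qed

lemma map_graph:
  assumes F: "definable_map S A [MainSort] X [MainSort] Y F"
  defines "G \<equiv> \<lambda>x y. emb x \<in> X \<and> F (emb x) = emb y"
  shows "DS A (\<lambda>\<rho>. G (\<rho> 0) (\<rho> 1))" "functional G" "\<forall>x. emb x \<in> X \<longleftrightarrow> (\<exists>y. G x y)"
proof -
  have X: "X \<subseteq> range emb" and FX: "F ` X \<subseteq> range emb"
    using F unfolding definable_map_def definable_def tuples_main by blast+
  have "definable S A (replicate 2 MainSort) ((\<lambda>x. x @ F x) ` X)"
    using F unfolding definable_map_def by (simp add: numeral_2_eq_2)
  from definable_imp_pred[OF this univ_main]
  have "DS A (\<lambda>\<rho>. [Inl (\<rho> 0), Inl (\<rho> 1)] \<in> (\<lambda>x. x @ F x) ` X)"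
    by (simp add: numeral_2_eq_2 env_Suc env_0)
  moreover have "[Inl x, Inl y] \<in> (\<lambda>x. x @ F x) ` X \<longleftrightarrow> G x y" for x y
  proof
    assume "[Inl x, Inl y] \<in> (\<lambda>x. x @ F x) ` X"
    then obtain z where z: "z \<in> X" "[Inl x, Inl y] = z @ F z" by blast
    then obtain u where "z = emb u" using X by blast
    then show "G x y" using z unfolding G_def by simp
  next
    assume "G x y"
    then show "[Inl x, Inl y] \<in> (\<lambda>x. x @ F x) ` X"
      unfolding G_def by (intro image_eqI[of _ _ "emb x"]) simp_all
  qed
  ultimately show "DS A (\<lambda>\<rho>. G (\<rho> 0) (\<rho> 1))" by simp
  show "functional G" unfolding functional_def G_def by simp
  show "\<forall>x. emb x \<in> X \<longleftrightarrow> (\<exists>y. G x y)"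
    using FX unfolding G_def by blast
qed

text \<open>The pieces may be arbitrary open intervals, the whole line included, so the prescribed
  cut set is empty and the argument works over every \<open>A\<close>.\<close>

lemma axiom_b3_S: "axiom_b3 S A"
  unfolding axiom_b3_def
proof (intro allI impI)
  fix X F assume "definable_map S A [main S] X [main S] (tuples S [main S]) F"
  then have F: "definable_map S A [MainSort] X [MainSort] (tuples S [MainSort]) F" by simp
  then have X: "definable S A [MainSort] X" unfolding definable_map_def by blast
  let ?G = "\<lambda>x y. emb x \<in> X \<and> F (emb x) = emb y"
  have "\<forall>c\<in>{}. DS A (\<lambda>\<rho>. \<rho> 0 = c)" by simp
  from tame_pieces[OF X map_graph[OF F] finite.emptyI this] obtain ss f where
    f: "MainSort \<notin> set ss" "definable_map S A [MainSort] X ss (tuples S ss) f" and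
    fib: "\<forall>s\<in>f ` X. (\<exists>x. emb x \<in> X \<and> fiber f X s = {emb x}) \<or>
      (\<exists>J. fiber f X s = emb ` J \<and> tame_interval ?G ({} \<noteq> ({} :: 'r set)) J)"
    by blast
  have "inj_on F (fiber f X s) \<or> (\<exists>c. \<forall>x\<in>fiber f X s. F x = c)" if "s \<in> f ` X" for s
  proof -
    from fib[rule_format, OF that] consider x where "fiber f X s = {emb x}"
      | J where "fiber f X s = emb ` J" "over.tame_on ?G ({} \<noteq> ({} :: 'r set)) J"
      unfolding tame_interval_def by blast
    then show ?thesis
    proof cases
      case (2 J)
      then have dom: "\<And>x. x \<in> J \<Longrightarrow> \<exists>y. ?G x y"
        and "(\<exists>y. \<forall>x\<in>J. ?G x y) \<or> (\<forall>x\<in>J. \<forall>x'\<in>J. \<forall>y. ?G x y \<and> ?G x' y \<longrightarrow> x = x')"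
        unfolding over.tame_on_def by blast+
      then consider y where "\<forall>x\<in>J. F (emb x) = emb y"
        | "\<forall>x\<in>J. \<forall>x'\<in>J. \<forall>y. ?G x y \<and> ?G x' y \<longrightarrow> x = x'" by blast
      then show ?thesis
      proof cases
        case 2
        have "x = x'" if "x \<in> J" "x' \<in> J" "F (emb x) = F (emb x')" for x x'
          using dom[OF that(1)] dom[OF that(2)] that 2 by metis
        then have "inj_on F (emb ` J)" by (auto simp: inj_on_def)
        then show ?thesis using \<open>fiber f X s = emb ` J\<close> by simp
      qed (use \<open>fiber f X s = emb ` J\<close> in auto)
    qed simp
  qed
  then show "\<exists>ts T f. auxiliary_set S ts T \<and> definable_map S A [main S] X ts T f \<and>
      (\<forall>s\<in>f ` X. inj_on F (fiber f X s) \<or> (\<exists>c. \<forall>x\<in>fiber f X s. F x = c))"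
    using f auxiliary_tuples by (intro exI[of _ ss] exI[of _ "tuples S ss"] exI[of _ f]) simp
qed

lemma preserves_balls_S:
  assumes "whole \<or> has_definable_point S A"
  shows "preserves_balls_over S A"
  unfolding preserves_balls_over_def
proof (intro allI impI)
  fix X Y F assume "definable_map S A [main S] X [main S] Y F"
  then have F: "definable_map S A [MainSort] X [MainSort] Y F" by simp
  then have X: "definable S A [MainSort] X" unfolding definable_map_def by blast
  obtain C where C: "finite C" "\<forall>c\<in>C. DS A (\<lambda>\<rho>. \<rho> 0 = c)" "whole \<or> C \<noteq> {}"
    using cut_points[OF assms] by blast
  let ?G = "\<lambda>x y. emb x \<in> X \<and> F (emb x) = emb y"
  from tame_pieces[OF X map_graph[OF F] C(1,2)] obtain ss f where
    f: "MainSort \<notin> set ss" "definable_map S A [MainSort] X ss (tuples S ss) f" and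
    fib: "\<forall>s\<in>f ` X. (\<exists>x. emb x \<in> X \<and> fiber f X s = {emb x}) \<or>
      (\<exists>J. fiber f X s = emb ` J \<and> tame_interval ?G (C \<noteq> {}) J)"
    by blast
  have F_main: "F x \<in> range emb" if "x \<in> X" for x
    using F that unfolding definable_map_def definable_def tuples_main by blast
  have b: "is_point S (fiber f X s) \<or> is_ball S (fiber f X s)" if "s \<in> f ` X" for s
    by (rule tame_fiber[OF fib[rule_format, OF that]]) (use C(3) in blast)
  then have bmap: "b_map S A X ss (tuples S ss) f"
    unfolding b_map_def using f auxiliary_tuples by simp
  \<comment> \<open>Images are computed for every point or ball inside a fiber of \<open>f\<close>;
    this covers the fibers of \<open>f\<close> and those of all its refinements.\<close>
  have image: "is_ball S (F ` Z) \<or> is_point S (F ` Z)"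
    if s: "s \<in> f ` X" and Z: "Z \<subseteq> fiber f X s" "is_point S Z \<or> is_ball S Z" for s Z
  proof -
    have "Z \<subseteq> X" using Z(1) by (auto simp: fiber_def)
    from Z(2) show ?thesis
    proof
      assume "is_point S Z"
      then obtain x where "Z = {emb x}" using is_point_iff by blast
      then show ?thesis using F_main[of "emb x"] \<open>Z \<subseteq> X\<close> unfolding is_point_iff by auto
    next
      assume "is_ball S Z"
      then obtain J' where J': "open_interval J'" "J' \<noteq> {}" "Z = emb ` J'" unfolding ball_iff by blast
      \<comment> \<open>This excludes the one-point fibers, into which no ball fits.\<close>
      have "infinite Z"
        using infinite_open_interval[OF J'(1,2)] J'(3) finite_imageD inj_on_subset[OF inj_emb subset_UNIV] by blast
      then have "fiber f X s \<noteq> {emb x}" for x using Z(1) finite_subset by fastforce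
      then obtain J where J: "fiber f X s = emb ` J" "tame_interval ?G (C \<noteq> {}) J"
        using fib[rule_format, OF s] by blast
      have "J' \<subseteq> J" using Z(1) J(1) J'(3) by auto
      with J(2) J'(1,2) have tame: "over.tame_on ?G (C \<noteq> {}) J'"
        unfolding tame_interval_def by blast
      define Y where "Y = {y. \<exists>x\<in>J'. ?G x y}"
      have "\<forall>x\<in>J'. \<exists>y. ?G x y" and Y: "(\<exists>p. Y = {p}) \<or> open_interval Y" "C \<noteq> {} \<longrightarrow> Y \<noteq> UNIV"
        using tame unfolding over.tame_on_def Y_def by blast+
      then obtain h where h: "\<And>x. x \<in> J' \<Longrightarrow> ?G x (h x)" by metis
      have "Y = h ` J'" unfolding Y_def using h by fastforce
      moreover have "F ` Z = emb ` h ` J'" unfolding J'(3) image_image using h by auto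
      ultimately have "F ` Z = emb ` Y" "Y \<noteq> {}" using J'(2) by auto
      moreover have "(\<exists>p. Y = {p}) \<or> open_interval Y \<and> Y \<noteq> {} \<and> (whole \<or> Y \<noteq> UNIV)"
        using Y C(3) \<open>Y \<noteq> {}\<close> by blast
      ultimately show ?thesis using point_or_ball_emb by simp
    qed
  qed
  have refined: "is_ball S (F ` fiber f1 X s) \<or> is_point S (F ` fiber f1 X s)"
    if f1: "b_map S (elements S) X ts1 T1 f1" "refinement S X ss (tuples S ss) f ts1 T1 f1" and s: "s \<in> f1 ` X"
    for ts1 T1 f1 s
  proof -
    obtain g where g: "\<And>x. x \<in> X \<Longrightarrow> f x = g (f1 x)" using f1(2) unfolding refinement_def by blast
    obtain x where x: "x \<in> X" "s = f1 x" using s by blast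
    have "fiber f1 X s \<subseteq> fiber f X (f x)" unfolding fiber_def x(2) using g x(1) by auto
    moreover have "is_point S (fiber f1 X s) \<or> is_ball S (fiber f1 X s)"
      using f1(1) s unfolding b_map_def by blast
    ultimately show ?thesis using image[of "f x"] x(1) by blast
  qed
  show "\<exists>ts T f. b_map S A X ts T f \<and>
      (\<forall>s\<in>f ` X. is_ball S (F ` fiber f X s) \<or> is_point S (F ` fiber f X s)) \<and>
      (\<forall>ts1 T1 f1. b_map S (elements S) X ts1 T1 f1 \<and> refinement S X ts T f ts1 T1 f1 \<longrightarrow>
         (\<forall>s\<in>f1 ` X. is_ball S (F ` fiber f1 X s) \<or> is_point S (F ` fiber f1 X s)))"
    using bmap image[OF _ order_refl b] refined
    by (intro exI[of _ ss] exI[of _ "tuples S ss"] exI[of _ f] conjI ballI allI impI) (assumption | elim conjE)+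
qed

text \<open>If the line is no ball, it is not a fiber of a b-map on the line, so the fiber through
  any point is a nonempty proper subset. Replacing the auxiliary coordinates in the graph by
  constant symbols defines it over \<open>A\<close>, and its boundary provides the point.\<close>

lemma definable_point_of_b1:
  assumes "axiom_b1 S A" "\<not> whole"
  shows "has_definable_point S A"
proof -
  obtain ts T f where f: "b_map S A (range emb) ts T f"
    using assms(1) definable_tuples[of A "[MainSort]"] unfolding axiom_b1_def tuples_main by auto
  obtain a :: 'r where True by blast
  define s where "s = f (emb a)"
  have graph: "definable S A (MainSort # ts) ((\<lambda>x. x @ f x) ` range emb)"
    and "auxiliary_set S ts T" and "s \<in> T"
    using f unfolding b_map_def definable_map_def s_def by auto
  then have aux: "MainSort \<notin> set ts" and s: "list_all2 (\<lambda>u t. u \<in> univ S t) s ts"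
    unfolding auxiliary_set_def definable_def tuples_def by auto
  have "t = AuxSort" if "t \<in> set ts" for t using aux that by (cases t) auto
  then have ts: "ts ! i = AuxSort" if "i < length ts" for i using that by simp
  then have "s ! i \<in> range Inr" if "i < length ts" for i
    using list_all2_nthD2[OF s that] ts[OF that] by simp
  then have e: "s ! i = Inr (projr (s ! i))" if "i < length ts" for i using that by force
  obtain \<phi> where \<phi>: "wf_fm S A (MainSort # ts) \<phi>"
    "(\<lambda>x. x @ f x) ` range emb = {us \<in> tuples S (MainSort # ts). sat S us \<phi>}"
    using graph unfolding definable_def by blast
  \<comment> \<open>The main variable is kept, and coordinate \<open>i\<close> becomes the constant
    symbol naming \<open>s ! i\<close>; \<open>projr\<close> is meaningful because every coordinate
    of \<open>s\<close> is auxiliary.\<close>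
  define \<sigma> where "\<sigma> = case_nat (Var 0) (\<lambda>i. aux_const (projr (s ! i)))"
  have wf: "wf_fm S A [MainSort] (subst_fm \<phi> \<sigma>)"
  proof (rule wf_fm_subst[OF \<phi>(1)])
    fix i assume "i < length (MainSort # ts)"
    then show "has_sort S A [MainSort] (\<sigma> i) ((MainSort # ts) ! i)"
      using has_sort_Var[of 0 "[MainSort]" S A] ts aux_const_sort
      by (cases i) (simp_all add: \<sigma>_def)
  qed
  have sat: "sat S [Inl x] (subst_fm \<phi> \<sigma>) \<longleftrightarrow> f (emb x) = s" for x
  proof -
    have "sat S [Inl x] (subst_fm \<phi> \<sigma>) \<longleftrightarrow> sat S (Inl x # s) \<phi>"
    proof (rule sat_subst[OF \<phi>(1)])
      fix i assume "i < length (MainSort # ts)"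
      then show "trm_val S [Inl x] (\<sigma> i) = (Inl x # s) ! i"
        using e by (cases i) (simp_all add: \<sigma>_def)
    qed
    moreover have "Inl x # s \<in> tuples S (MainSort # ts)" using s by (simp add: tuples_def univ_R)
    ultimately have "sat S [Inl x] (subst_fm \<phi> \<sigma>) \<longleftrightarrow> Inl x # s \<in> (\<lambda>x. x @ f x) ` range emb"
      using \<phi>(2) by blast
    also have "\<dots> \<longleftrightarrow> f (emb x) = s" by (auto intro: rev_image_eqI[OF rangeI])
    finally show ?thesis .
  qed
  have "DS A (\<lambda>\<rho>. f (emb (\<rho> 0)) = s)"
    unfolding definable_pred_def definable_at_def
    by (intro exI[of _ 1] exI[of _ "subst_fm \<phi> \<sigma>"]) (simp add: wf sat env_Suc env_0)
  moreover have "f (emb a) = s" by (simp add: s_def)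
  moreover obtain v where "f (emb v) \<noteq> s"
  proof -
    have "is_point S (fiber f (range emb) s) \<or> is_ball S (fiber f (range emb) s)"
      using f unfolding b_map_def s_def by blast
    moreover have "\<not> is_point S (range emb)"
    proof
      assume "is_point S (range emb)"
      then obtain x where x: "range emb = {emb x}" using is_point_iff by blast
      obtain y where "x < y" using gt_ex by blast
      moreover have "emb y \<in> {emb x}" unfolding x[symmetric] by (rule rangeI)
      ultimately show False by simp
    qed
    moreover have "\<not> is_ball S (range emb)"
    proof
      assume "is_ball S (range emb)"
      then obtain J where J: "whole \<or> J \<noteq> UNIV" "range emb = emb ` J" unfolding ball_iff by (elim exE conjE)
      then have "J = UNIV" using inj_image_eq_iff[OF inj_emb, of UNIV J] by simp
      then show False using J(1) assms(2) by simp
    qed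
    ultimately have "fiber f (range emb) s \<noteq> range emb" by metis
    then show ?thesis using that unfolding fiber_def by blast
  qed
  ultimately have "\<exists>c. DS A (\<lambda>\<rho>. \<rho> 0 = c)"
    by (rule over.definable_pt_of_proper)
  then show ?thesis using has_definable_point_iff by blast
qed

end

section \<open>Open intervals as fibers of the ball predicate\<close>

lemma open_interval_between:
  fixes x y :: "'r::unbounded_dense_linorder"
  shows "open_interval {m. between x y m}" "{m. between x y m} \<noteq> UNIV"
proof -
  have "{m. between x y m} = (if x < y then {x<..<y} else if x = y then {x<..} else {..<y})"
    by (auto simp: between_def)
  then show "open_interval {m. between x y m}" by (auto simp: open_interval_def)
  \<comment> \<open>In each of the three cases the point \<open>x\<close> itself is left
    out.\<close>
  have "\<not> between x y x" by (auto simp: between_def)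
  then show "{m. between x y m} \<noteq> UNIV" by blast
qed

lemma open_interval_is_between:
  fixes J :: "'r::unbounded_dense_linorder set"
  assumes "open_interval J" "J \<noteq> {}" "J \<noteq> UNIV"
  obtains x y where "J = {m. between x y m}"
  using assms(1)
proof (cases rule: open_interval_cases)
  case (1 a b)
  then have "a < b" using assms(2) by (metis greaterThanLessThan_empty leI)
  then show ?thesis using 1 by (intro that[of a b]) (auto simp: between_def)
next
  case (2 a)
  then show ?thesis by (intro that[of a a]) (auto simp: between_def)
next
  case (3 b)
  \<comment> \<open>A lower half-line is coded by its bound \<open>b\<close> as second entry and any
    larger point as first entry.\<close>
  obtain c where "b < c" using gt_ex by blast
  then show ?thesis using 3 by (intro that[of c b]) (auto simp: between_def)
qed (use assms(3) in simp)


section \<open>The two ball predicates\<close>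

lemma DR_between:
  fixes R :: "(unit, 'f, 'p, 'r::unbounded_dense_linorder) fo_structure"
  assumes R: "o_minimal R" and "rterm R r" "rterm R s" "rterm R t"
  shows "DR R (\<lambda>\<rho>. between (r \<rho>) (s \<rho>) (t \<rho>))"
proof -
  obtain p where p: "p \<in> rels R" "rel_arity R p = [(), ()]" "\<And>x y. [x, y] \<in> rel_int R p \<longleftrightarrow> x < y"
    using R unfolding o_minimal_def by blast
  have univ: "univ R () = UNIV" using R by (simp add: o_minimal_def)
  interpret definable_preds "DR R"
    using definable_preds_definable_pred[of R "()" "\<lambda>x. x" p] p univ by simp
  have less: "DR R (\<lambda>\<rho>. u \<rho> < v \<rho>)" if "rterm R u" "rterm R v" for u v
    using DR_rel[OF p(1), of "[u, v]"] p(2,3) that by simp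
  have "DR R (\<lambda>\<rho>. (r \<rho> < s \<rho> \<and> r \<rho> < t \<rho> \<and> t \<rho> < s \<rho>) \<or> (r \<rho> = s \<rho> \<and> r \<rho> < t \<rho>) \<or> (s \<rho> < r \<rho> \<and> t \<rho> < s \<rho>))"
    by (intro D_disj D_conj less DR_eq assms)
  moreover have "between x y m \<longleftrightarrow> (x < y \<and> x < m \<and> m < y) \<or> (x = y \<and> x < m) \<or> (y < x \<and> m < y)"
    for x y m :: 'r
    by (auto simp: between_def)
  ultimately show ?thesis by (simp only:)
qed

lemma tuples_expansion_Cons:
  assumes "univ R () = UNIV"
  shows "us \<in> tuples (expansion R ab B) [] \<longleftrightarrow> us = []"
    and "us \<in> tuples (expansion R ab B) (MainSort # ss) \<longleftrightarrow>
      (\<exists>x vs. us = Inl x # vs \<and> vs \<in> tuples (expansion R ab B) ss)"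
    and "us \<in> tuples (expansion R ab B) (AuxSort # ss) \<longleftrightarrow>
      (\<exists>e vs. us = Inr e # vs \<and> vs \<in> tuples (expansion R ab B) ss)"
  using assms by (auto simp: tuples_def list_all2_Cons2)

lemma is_ball_expansion:
  "is_ball (expansion R ab B) b \<longleftrightarrow> b \<noteq> {} \<and>
    (\<exists>a\<in>tuples (expansion R ab B) ab. b = {m \<in> tuples (expansion R ab B) [MainSort]. a @ m \<in> B})"
  by (simp add: is_ball_def)

lemma o_min_expansion_o_expansion:
  fixes R :: "(unit, 'f, 'p, 'r::unbounded_dense_linorder) fo_structure"
  assumes R: "o_minimal R"
  shows "o_min_expansion R [MainSort, MainSort] {[Inl x, Inl y, Inl m] | x y m. between x y m} False"
    (is "o_min_expansion R ?ab ?B False")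
proof
  note tuples = tuples_expansion_Cons[where R = R and ab = "?ab" and B = "?B"]
  have univ: "univ R () = UNIV" using R by (simp add: o_minimal_def)
  show "o_minimal R" by (rule R)
  obtain x m :: 'r where "x < m" using gt_ex by blast
  then have "between x x m" by (simp add: between_def)
  then show "?B \<noteq> {}" by blast
  show "us \<in> tuples (expansion R ?ab ?B) (?ab @ [MainSort])" if "us \<in> ?B" for us
    using that by (auto simp: tuples[OF univ])
  show "DR R (\<lambda>\<rho>. map (\<lambda>g. g \<rho>) gs \<in> ?B)" if sorted: "list_all2 (sorted_val R) (?ab @ [MainSort]) gs" for gs
  proof -
    obtain r s t where "rterm R r" "rterm R s" "rterm R t"
      and gs: "gs = [\<lambda>\<rho>. Inl (r \<rho>), \<lambda>\<rho>. Inl (s \<rho>), \<lambda>\<rho>. Inl (t \<rho>)]"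
      using sorted by (auto simp: list_all2_Cons1 sorted_val_def)
    from DR_between[OF R this(1-3)] show ?thesis unfolding gs by simp
  qed
  have fib: "{m \<in> tuples (expansion R ?ab ?B) [MainSort]. [Inl x, Inl y] @ m \<in> ?B} =
      (\<lambda>m. [Inl m]) ` {m. between x y m}" for x y
    by (auto simp: tuples[OF univ])
  show "is_ball (expansion R ?ab ?B) b \<longleftrightarrow>
      (\<exists>J. open_interval J \<and> J \<noteq> {} \<and> (False \<or> J \<noteq> UNIV) \<and> b = (\<lambda>x. [Inl x]) ` J)" for b
  proof
    assume "is_ball (expansion R ?ab ?B) b"
    then obtain a where a: "b \<noteq> {}" "a \<in> tuples (expansion R ?ab ?B) ?ab"
      "b = {m \<in> tuples (expansion R ?ab ?B) [MainSort]. a @ m \<in> ?B}"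
      unfolding is_ball_expansion by blast
    obtain x y where "a = [Inl x, Inl y]" using a(2) by (auto simp: tuples[OF univ])
    then have "b = (\<lambda>m. [Inl m]) ` {m. between x y m}" unfolding a(3) by (simp only: fib)
    with a(1) show "\<exists>J. open_interval J \<and> J \<noteq> {} \<and> (False \<or> J \<noteq> UNIV) \<and> b = (\<lambda>x. [Inl x]) ` J"
      using open_interval_between[of x y] by blast
  next
    assume "\<exists>J. open_interval J \<and> J \<noteq> {} \<and> (False \<or> J \<noteq> UNIV) \<and> b = (\<lambda>x. [Inl x]) ` J"
    then obtain J where J: "open_interval J" "J \<noteq> {}" "J \<noteq> UNIV" "b = (\<lambda>x. [Inl x]) ` J" by blast
    obtain x y where "J = {m. between x y m}" using open_interval_is_between[OF J(1-3)] by blast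
    then have "b \<noteq> {}" "b = {m \<in> tuples (expansion R ?ab ?B) [MainSort]. [Inl x, Inl y] @ m \<in> ?B}"
      using J(2,4) fib[of x y] by simp_all
    moreover have "[Inl x, Inl y] \<in> tuples (expansion R ?ab ?B) ?ab" by (simp add: tuples[OF univ])
    ultimately show "is_ball (expansion R ?ab ?B) b"
      unfolding is_ball_expansion by blast
  qed
qed

lemma o_min_expansion_o_expansion_line:
  fixes R :: "(unit, 'f, 'p, 'r::unbounded_dense_linorder) fo_structure"
  assumes R: "o_minimal R"
  shows "o_min_expansion R [MainSort, MainSort, AuxSort]
    {[Inl x, Inl y, Inr e, Inl m] | x y e m. e \<or> between x y m} True"
    (is "o_min_expansion R ?ab ?B True")
proof
  note tuples = tuples_expansion_Cons[where R = R and ab = "?ab" and B = "?B"]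
  have univ: "univ R () = UNIV" using R by (simp add: o_minimal_def)
  show "o_minimal R" by (rule R)
  show "?B \<noteq> {}" by blast
  show "us \<in> tuples (expansion R ?ab ?B) (?ab @ [MainSort])" if "us \<in> ?B" for us
    using that by (auto simp: tuples[OF univ])
  show "DR R (\<lambda>\<rho>. map (\<lambda>g. g \<rho>) gs \<in> ?B)" if sorted: "list_all2 (sorted_val R) (?ab @ [MainSort]) gs" for gs
  proof -
    obtain r s e t where rst: "rterm R r" "rterm R s" "rterm R t"
      and gs: "gs = [\<lambda>\<rho>. Inl (r \<rho>), \<lambda>\<rho>. Inl (s \<rho>), \<lambda>\<rho>. Inr e, \<lambda>\<rho>. Inl (t \<rho>)]"
      using sorted by (auto simp: list_all2_Cons1 sorted_val_def)
    have B_iff: "map (\<lambda>g. g \<rho>) gs \<in> ?B \<longleftrightarrow> e \<or> between (r \<rho>) (s \<rho>) (t \<rho>)" for \<rho>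
      unfolding gs by auto
    show ?thesis
    proof (cases e)
      case True
      \<comment> \<open>With the auxiliary argument equal to 1 the predicate holds for all main
        arguments, and any tautology of \<open>R\<close> expresses that.\<close>
      have "DR R (\<lambda>\<rho>. r \<rho> = r \<rho>)" by (rule DR_eq[OF rst(1,1)])
      then show ?thesis unfolding B_iff using True by simp
    next
      case False
      from DR_between[OF R rst] show ?thesis unfolding B_iff using False by simp
    qed
  qed
  have fib: "{m \<in> tuples (expansion R ?ab ?B) [MainSort]. [Inl x, Inl y, Inr e] @ m \<in> ?B} =
      (\<lambda>m. [Inl m]) ` {m. e \<or> between x y m}" for x y e
    by (auto simp: tuples[OF univ])
  have UNIV: "open_interval (UNIV :: 'r set)" by (simp add: open_interval_def)
  show "is_ball (expansion R ?ab ?B) b \<longleftrightarrow>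
      (\<exists>J. open_interval J \<and> J \<noteq> {} \<and> (True \<or> J \<noteq> UNIV) \<and> b = (\<lambda>x. [Inl x]) ` J)" for b
  proof
    assume "is_ball (expansion R ?ab ?B) b"
    then obtain a where a: "b \<noteq> {}" "a \<in> tuples (expansion R ?ab ?B) ?ab"
      "b = {m \<in> tuples (expansion R ?ab ?B) [MainSort]. a @ m \<in> ?B}"
      unfolding is_ball_expansion by blast
    obtain x y e where "a = [Inl x, Inl y, Inr e]" using a(2) by (auto simp: tuples[OF univ])
    then have b: "b = (\<lambda>m. [Inl m]) ` {m. e \<or> between x y m}" unfolding a(3) by (simp only: fib)
    have "open_interval {m. e \<or> between x y m}"
      using UNIV open_interval_between[of x y] by (cases e) simp_all
    with a(1) b show "\<exists>J. open_interval J \<and> J \<noteq> {} \<and> (True \<or> J \<noteq> UNIV) \<and> b = (\<lambda>x. [Inl x]) ` J"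
      by blast
  next
    assume "\<exists>J. open_interval J \<and> J \<noteq> {} \<and> (True \<or> J \<noteq> UNIV) \<and> b = (\<lambda>x. [Inl x]) ` J"
    then obtain J where J: "open_interval J" "J \<noteq> {}" "b = (\<lambda>x. [Inl x]) ` J" by blast
    have "\<exists>x y e. J = {m. e \<or> between x y m}"
    proof (cases "J = UNIV")
      case False
      then obtain x y where "J = {m. between x y m}" using open_interval_is_between[OF J(1,2)] by blast
      then show ?thesis by (intro exI[of _ x] exI[of _ y] exI[of _ False]) simp
    qed auto
    then obtain x y e where "J = {m. e \<or> between x y m}" by blast
    then have "b \<noteq> {}" "b = {m \<in> tuples (expansion R ?ab ?B) [MainSort]. [Inl x, Inl y, Inr e] @ m \<in> ?B}"
      using J(2,3) fib[of x y e] by simp_all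
    moreover have "[Inl x, Inl y, Inr e] \<in> tuples (expansion R ?ab ?B) ?ab" by (simp add: tuples[OF univ])
    ultimately show "is_ball (expansion R ?ab ?B) b"
      unfolding is_ball_expansion by blast
  qed
qed

theorem mainTheorem7:
  fixes R :: "(unit, 'f, 'p, 'r::unbounded_dense_linorder) fo_structure"
  assumes "o_minimal R"
  shows
    "(b_minimal (o_expansion R) \<and> preserves_all_balls (o_expansion R)
        \<longleftrightarrow> has_definable_point (o_expansion R) {}) \<and>
     wf_ball_structure (o_expansion R) \<and>
     axiom_b2 (o_expansion R) \<and>
     (\<forall>A\<subseteq>elements (o_expansion R). axiom_b3 (o_expansion R) A) \<and>
     (\<forall>A\<subseteq>elements (o_expansion R). has_definable_point (o_expansion R) A \<longrightarrow>
        axiom_b1 (o_expansion R) A \<and> preserves_balls_over (o_expansion R) A) \<and>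
     b_minimal (o_expansion_line R) \<and> preserves_all_balls (o_expansion_line R)"
proof -
  interpret pt: o_min_expansion R "[MainSort, MainSort]"
    "{[Inl x, Inl y, Inl m] | x y m. between x y m}" False
    by (rule o_min_expansion_o_expansion[OF assms])
  interpret line: o_min_expansion R "[MainSort, MainSort, AuxSort]"
    "{[Inl x, Inl y, Inr e, Inl m] | x y e m. e \<or> between x y m}" True
    by (rule o_min_expansion_o_expansion_line[OF assms])
  have pieces: "axiom_b1 (o_expansion R) A \<and> preserves_balls_over (o_expansion R) A"
    if "has_definable_point (o_expansion R) A" for A
    using pt.axiom_b1_S[of A] pt.preserves_balls_S[of A] that unfolding o_expansion_def by blast
  \<comment> \<open>(b1) over the empty parameter set already forces a definable point.\<close>
  have "has_definable_point (o_expansion R) {}" if "b_minimal (o_expansion R)"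
    using that pt.definable_point_of_b1[of "{}"] unfolding o_expansion_def b_minimal_def by blast
  moreover have "b_minimal (o_expansion R) \<and> preserves_all_balls (o_expansion R)"
    if "has_definable_point (o_expansion R) {}"
  proof -
    \<comment> \<open>A point definable over the empty set stays definable over every
      \<open>A\<close>, so it serves all parameter sets at once.\<close>
    have "has_definable_point (o_expansion R) A" for A
      using that pt.has_definable_point_mono[of "{}" A] unfolding o_expansion_def by blast
    then show ?thesis
      using pieces pt.wf_ball_S pt.axiom_b2_S pt.axiom_b3_S
      unfolding b_minimal_def preserves_all_balls_def o_expansion_def by blast
  qed
  moreover have "b_minimal (o_expansion_line R) \<and> preserves_all_balls (o_expansion_line R)"
    using line.axiom_b1_S line.preserves_balls_S line.wf_ball_S line.axiom_b2_S line.axiom_b3_S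
    unfolding b_minimal_def preserves_all_balls_def o_expansion_line_def by blast
  moreover have "wf_ball_structure (o_expansion R)" "axiom_b2 (o_expansion R)" "axiom_b3 (o_expansion R) A" for A
    using pt.wf_ball_S pt.axiom_b2_S pt.axiom_b3_S unfolding o_expansion_def by blast+
  ultimately show ?thesis using pieces by blast
qed

end
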